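(* Let $d\ge 1$, let $V:\mathbb{R}^d\to[0,\infty)$ be Borel measurable and locally bounded, and suppose there are constants $C_1,C_2>0$ and $g\in\mathcal{G}$ such that $C_1g(|x|)\le V(x)\le C_2g(|x|)$ for all $x\in\mathbb{R}^d$ with $|x|>1$. Let $p(t,x,y)$ be the heat kernel of the Schrödinger semigroup $\{T_t^V\}_{t\ge0}$, and set $t_0(s)=\frac{1+s}{\sqrt{g(s)}}$ for $s\ge 0$. Then for every $C_0>0$ there exist constants $c_1,\dots,c_8>0$ (independent of $t,x,y$) such that: (i) for all $x,y\in\mathbb{R}^d$ and $0<t\le C_0\,t_0(|x|\wedge|y|)$, $$c_1t^{-d/2}e^{-c_2E(t,x,y)}\le p(t,x,y)\le c_3t^{-d/2}e^{-c_4E(t,x,y)},$$ where $$E(t,x,y)=\frac{|x-y|^2}{t}+t\min\{g(|x|),g(|y|)\}+|x-y|\sqrt{\max\{g(|x|),g(|y|)\}};$$ (ii) for all $x,y\in\mathbb{R}^d$ and $t\ge C_0\,t_0(|x|\wedge|y|)$, $$c_5\big(e^{-t}\psi(t,x)\psi(t,y)\big)^{c_6}\le p(t,x,y)\le c_7\big(e^{-t}\psi(t,x)\psi(t,y)\big)^{c_8},$$ where $$\psi(t,x)=\exp\left(-\left((1+|x|)\sqrt{g(|x|)}+\frac{(1+|x|)^2}{t}\right)\right),\quad t>0,\ x\in\mathbb{R}^d.$$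
   Context: $\mathcal{G}$ is the class of nondecreasing functions $g:[0,\infty)\to[1,\infty)$ with $\lim_{r\to\infty}g(r)=\infty$ for which there is a constant $c_0>0$ with $g(2r)\le c_0g(r)$ for all $r\ge0$. Locally bounded means bounded on compact sets. $a\wedge b=\min\{a,b\}$. $\{B_t\}_{t\ge0}$ is the standard Brownian motion on $\mathbb{R}^d$, with $\mathbb{P}_x,\mathbb{E}_x$ the probability and expectation when it starts at $x$. The Schrödinger semigroup of $\mathcal{L}^V=-\frac12\Delta+V$ is $$T_t^Vf(x)=\mathbb{E}_x\left[f(B_t)\exp\left(-\int_0^tV(B_s)\,ds\right)\right],\quad f\in C_b(\mathbb{R}^d).$$ Its heat kernel is the (existing) jointly continuous function $p:(0,\infty)\times\mathbb{R}^d\times\mathbb{R}^d\to[0,\infty)$ with $T_t^Vf(x)=\int_{\mathbb{R}^d}p(t,x,y)f(y)\,dy$ for all $f\in C_b(\mathbb{R}^d)$, $t>0$, $x\in\mathbb{R}^d$; it satisfies $p(t,x,y)=p(t,y,x)$. *)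

theory Defs
  imports "HOL-Probability.Probability"
begin

text \<open>
  Standard Brownian motion started at the origin.  The Euclidean space \<open>'a\<close> plays the
  role of \<open>\<real>\<^sup>d\<close> with \<open>d = DIM('a)\<close>; only the times \<open>t \<ge> 0\<close> are constrained.
  The starting point and path continuity hold for every \<open>\<omega>\<close>, not just almost surely, so that
  path integrals such as \<open>\<integral>\<^sub>0\<^sup>t V (x + B\<^sub>s) ds\<close> are measurable in \<open>\<omega>\<close> without completing \<open>M\<close>.
\<close>

locale standard_brownian_motion = prob_space M
  for M :: "'w measure" +
  fixes B :: "real \<Rightarrow> 'w \<Rightarrow> 'a::euclidean_space"
  assumes start_zero: "\<And>\<omega>. \<omega> \<in> space M \<Longrightarrow> B 0 \<omega> = 0"
    and continuous_paths: "\<And>\<omega>. \<omega> \<in> space M \<Longrightarrow> continuous_on {0..} (\<lambda>t. B t \<omega>)"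
    and independent_increments:
      "\<And>(n::nat) (\<tau>::nat \<Rightarrow> real). 0 \<le> \<tau> 0 \<Longrightarrow> (\<And>i. i < n \<Longrightarrow> \<tau> i \<le> \<tau> (Suc i)) \<Longrightarrow>
        indep_vars (\<lambda>_. borel) (\<lambda>i \<omega>. B (\<tau> (Suc i)) \<omega> - B (\<tau> i) \<omega>) {..<n}"
    and gaussian_increments:
      "\<And>s t. 0 \<le> s \<Longrightarrow> s < t \<Longrightarrow>
        distributed M lborel (\<lambda>\<omega>. B t \<omega> - B s \<omega>)
          (\<lambda>z. ennreal ((2 * pi * (t - s)) powr (- real DIM('a) / 2)
                         * exp (- (norm z)\<^sup>2 / (2 * (t - s)))))"

text \<open>
  With \<open>B\<close> started at the origin, the law of Brownian motion under \<open>\<P>\<^sub>x\<close> is that of \<open>x + B\<close>.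
\<close>

definition schroedinger_semigroup ::
  "'w measure \<Rightarrow> (real \<Rightarrow> 'w \<Rightarrow> 'a::euclidean_space) \<Rightarrow> ('a \<Rightarrow> real)
    \<Rightarrow> real \<Rightarrow> ('a \<Rightarrow> real) \<Rightarrow> 'a \<Rightarrow> real" where
  "schroedinger_semigroup M B V t f x =
     (\<integral>\<omega>. f (x + B t \<omega>) * exp (- (LINT s:{0..t}|lborel. V (x + B s \<omega>))) \<partial>M)"

text \<open>
  These conditions determine \<open>p\<close> on \<open>(0,\<infinity>) \<times> \<real>\<^sup>d \<times> \<real>\<^sup>d\<close>; its values for \<open>t \<le> 0\<close> are irrelevant.
  The symmetry of \<open>p\<close> is a consequence and is not part of the definition.
\<close>

definition heat_kernel ::
  "'w measure \<Rightarrow> (real \<Rightarrow> 'w \<Rightarrow> 'a::euclidean_space) \<Rightarrow> ('a \<Rightarrow> real)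
    \<Rightarrow> (real \<Rightarrow> 'a \<Rightarrow> 'a \<Rightarrow> real) \<Rightarrow> bool" where
  "heat_kernel M B V p \<longleftrightarrow>
     continuous_on ({0<..} \<times> UNIV \<times> UNIV) (\<lambda>(t, x, y). p t x y) \<and>
     (\<forall>t>0. \<forall>x y. 0 \<le> p t x y) \<and>
     (\<forall>f\<in>bcontfun. \<forall>t>0. \<forall>x.
        has_bochner_integral lborel (\<lambda>y. p t x y * f y) (schroedinger_semigroup M B V t f x))"

definition growth_class :: "(real \<Rightarrow> real) set" where
  "growth_class = {g. mono_on {0..} g \<and> (\<forall>r\<ge>0. 1 \<le> g r) \<and> filterlim g at_top at_top \<and>
     (\<exists>c>0. \<forall>r\<ge>0. g (2 * r) \<le> c * g r)}"

definition locally_bounded :: "('a::topological_space \<Rightarrow> real) \<Rightarrow> bool" where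
  "locally_bounded V \<longleftrightarrow> (\<forall>K. compact K \<longrightarrow> bounded (V ` K))"

definition t0 :: "(real \<Rightarrow> real) \<Rightarrow> real \<Rightarrow> real" where
  "t0 g s = (1 + s) / sqrt (g s)"

definition E :: "(real \<Rightarrow> real) \<Rightarrow> real \<Rightarrow> 'a::euclidean_space \<Rightarrow> 'a \<Rightarrow> real" where
  "E g t x y = (norm (x - y))\<^sup>2 / t + t * min (g (norm x)) (g (norm y))
     + norm (x - y) * sqrt (max (g (norm x)) (g (norm y)))"

definition \<psi> :: "(real \<Rightarrow> real) \<Rightarrow> real \<Rightarrow> 'a::euclidean_space \<Rightarrow> real" where
  "\<psi> g t x = exp (- ((1 + norm x) * sqrt (g (norm x)) + (1 + norm x)\<^sup>2 / t))"

end

theory Submission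
  imports Defs
begin

text \<open>
  The argument only uses the finite-dimensional distributions of Brownian motion, Tonelli's theorem
  and Jensen's inequality; neither the Markov property nor stopping times are needed.

  Upper bounds.  By Jensen, \<open>exp (- \<integral>\<^sub>a\<^bsup>a+\<sigma>\<^esup> V (X\<^sub>s) ds)\<close> is at most the average over \<open>s\<close> of
  \<open>exp (- \<sigma> V (X\<^sub>s))\<close>, whose expectation is a Gaussian integral.  Taking the window at the beginning or
  at the end of \<open>[0,t]\<close>, with length \<open>\<sigma> = min (t/2) (R / sqrt (g |x|))\<close> and \<open>R = |x|/2\<close>, a path either
  stays in the ball of radius \<open>R\<close>, where \<open>V\<close> is of order \<open>g |x|\<close>, or pays \<open>exp (- R\<^sup>2 / (4\<sigma>))\<close>; so \<open>p t x y\<close> is at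
  most \<open>C t\<^bsup>-d/2\<^esup> exp (- c min (t g |x|) ((1 + |x|) sqrt (g |x|)))\<close>, and likewise for \<open>y\<close>.  Applied to unit
  windows simultaneously, Jensen also gives decay \<open>exp (- c t)\<close>.  With the Gaussian bound, these
  estimates imply both upper bounds.

  Lower bounds.  Force the path through small balls at finitely many times; by Jensen the weight
  \<open>exp (- \<integral> V)\<close> is at least \<open>exp\<close> of minus the conditional mean of the action, which is controlled by Gaussian
  bridges between consecutive times.  For (i) the path waits at the endpoint of smaller norm and
  crosses at speed about \<open>sqrt (g (max |x| |y|))\<close>; for (ii) it passes through the origin at time \<open>t/2\<close>.
\<close>

section \<open>Gaussian integrals along finitely many times\<close>

text \<open>\<open>heat_kernel\<close> ties \<open>p\<close> to the semigroup only through integrals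
  against bounded continuous functions, so pointwise bounds come from testing with bumps near
  \<open>y\<close> and from continuity of \<open>p t x\<close>. Lower bounds are composed before
  \<open>p\<close> enters: concatenating chains of balls replaces the semigroup law of
  \<open>p\<close>, and Jensen is applied once to the whole chain.

  The scales solve two optimisation problems. Staying near \<open>x\<close> for a time
  \<open>\<sigma>\<close> costs \<open>\<sigma> * g |x|\<close>, leaving costs
  \<open>R^2 / \<sigma>\<close>; these balance at \<open>\<sigma> = R / sqrt (g |x|)\<close>.
  Crossing a distance \<open>D\<close> in time \<open>s\<close> costs
  \<open>D^2 / s + s * G\<close>, which is least at \<open>s = D / sqrt G\<close> and yields the
  term \<open>D * sqrt G\<close> of \<open>E\<close>.

  Doubling of \<open>g\<close> has two uses: it bounds \<open>V\<close> from below by a multiple of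
  \<open>g |x|\<close> on the ball of radius \<open>|x| / 2\<close> around \<open>x\<close>, and it
  makes \<open>g\<close> grow so slowly that the Gaussian tails of a bridge of duration at most 1
  change the mean of \<open>V\<close> only by a constant factor. In (ii), \<open>t^(-d/2)\<close> is
  absorbed because \<open>1 / t\<close> is at most a constant times the largest exponent among the
  upper bounds.\<close>

abbreviation mass :: "('a::euclidean_space \<Rightarrow> real) \<Rightarrow> ennreal" where
  "mass f \<equiv> \<integral>\<^sup>+z. ennreal (f z) \<partial>lborel"

lemma borel_measurable_bcontfun: "f \<in> bcontfun \<Longrightarrow> f \<in> borel_measurable borel"
  by (intro borel_measurable_continuous_onI) (auto simp: bcontfun_def)

text \<open>The density of \<open>gaussian_increments\<close>, that is, the heat kernel of half the
  Laplacian at time \<open>h\<close>.\<close>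

definition gauss :: "real \<Rightarrow> 'a::euclidean_space \<Rightarrow> real" where
  "gauss h z = (2 * pi * h) powr (- real DIM('a) / 2) * exp (- (norm z)\<^sup>2 / (2 * h))"

lemma gauss_nonneg [simp]: "0 \<le> gauss h z"
  by (simp add: gauss_def)

lemma gauss_minus_commute: "gauss h (x - y) = gauss h (y - x)"
  by (simp add: gauss_def norm_minus_commute)

lemma continuous_on_gauss [continuous_intros]:
  "continuous_on A f \<Longrightarrow> continuous_on A (\<lambda>x. gauss h (f x))"
  unfolding gauss_def divide_inverse by (intro continuous_intros)

lemma borel_measurable_gauss [measurable (raw)]:
  "f \<in> borel_measurable M \<Longrightarrow> (\<lambda>x. gauss h (f x)) \<in> borel_measurable M"
  by (rule measurable_compose[where N = borel])
    (auto intro!: borel_measurable_continuous_onI continuous_intros)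

text \<open>The expected weight of a Brownian path from \<open>x\<close>, written as an iterated
  integral over its positions at the prescribed times.\<close>

primrec gauss_chain :: "(real \<times> ('a::euclidean_space \<Rightarrow> ennreal)) list \<Rightarrow> ('a \<Rightarrow> ennreal) \<Rightarrow> 'a \<Rightarrow> ennreal" where
  "gauss_chain [] f x = f x"
| "gauss_chain (e # L) f x = (\<integral>\<^sup>+z. ennreal (gauss (fst e) (z - x)) * (snd e z * gauss_chain L f z) \<partial>lborel)"

text \<open>
  A list of pairs \<open>(h, \<phi>)\<close> means: after a further time \<open>h\<close>, weight the path by \<open>\<phi>\<close> of its position.
  The terminal function \<open>f\<close> is evaluated at the last of these times.
\<close>

primrec path_weight :: "(real \<times> ('a::euclidean_space \<Rightarrow> ennreal)) list \<Rightarrow> ('a \<Rightarrow> ennreal) \<Rightarrow> real \<Rightarrow> (real \<Rightarrow> 'a) \<Rightarrow> ennreal" where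
  "path_weight [] f \<tau> X = f (X \<tau>)"
| "path_weight (e # L) f \<tau> X = snd e (X (\<tau> + fst e)) * path_weight L f (\<tau> + fst e) X"

text \<open>The same weight as a function of the increments \<open>d m, d (m + 1), ...\<close>. The
  offset \<open>m\<close> lets an induction on the list integrate out one coordinate of a product
  measure without renumbering the others.\<close>

primrec incr_weight :: "(real \<times> ('a::euclidean_space \<Rightarrow> ennreal)) list \<Rightarrow> ('a \<Rightarrow> ennreal) \<Rightarrow> nat \<Rightarrow> 'a \<Rightarrow> (nat \<Rightarrow> 'a) \<Rightarrow> ennreal" where
  "incr_weight [] f m x d = f x"
| "incr_weight (e # L) f m x d = snd e (x + d m) * incr_weight L f (Suc m) (x + d m) d"

lemma borel_measurable_gauss_chain [measurable (raw)]:
  assumes "\<And>e. e \<in> set L \<Longrightarrow> snd e \<in> borel_measurable borel" "f \<in> borel_measurable borel"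
  shows "gauss_chain L f \<in> borel_measurable borel"
  using assms(1)
proof (induction L)
  case Nil
  then show ?case using assms(2) by simp
next
  case (Cons e L)
  have [measurable]: "gauss_chain L f \<in> borel_measurable borel" "snd e \<in> borel_measurable borel"
    using Cons by auto
  show ?case by simp
qed

lemma path_weight_eq_incr_weight:
  assumes "\<And>i. i < length L \<Longrightarrow>
    d (m + i) = X (s + sum_list (take (Suc i) (map fst L))) - X (s + sum_list (take i (map fst L)))"
  shows "path_weight L f s X = incr_weight L f m (X s) d"
  using assms
proof (induction L arbitrary: s m)
  case (Cons e L)
  have 1: "X s + d m = X (s + fst e)"
    using Cons.prems[of 0] by simp
  have "path_weight L f (s + fst e) X = incr_weight L f (Suc m) (X (s + fst e)) d"
  proof (rule Cons.IH)
    fix i assume "i < length L"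
    then show "d (Suc m + i) = X (s + fst e + sum_list (take (Suc i) (map fst L)))
        - X (s + fst e + sum_list (take i (map fst L)))"
      using Cons.prems[of "Suc i"] by (simp add: add.assoc)
  qed
  with 1 show ?case by simp
qed simp

lemma incr_weight_upd: "k < m \<Longrightarrow> incr_weight L f m x (d(k := y)) = incr_weight L f m x d"
  by (induction L arbitrary: m x) auto

lemma measurable_incr_weight:
  assumes "\<And>e. e \<in> set L \<Longrightarrow> snd e \<in> borel_measurable borel" "f \<in> borel_measurable borel"
    "{m..<m + length L} \<subseteq> I" "\<And>i. sets (N i) = sets borel"
    "g \<in> borel_measurable (PiM I N)"
  shows "(\<lambda>d. incr_weight L f m (g d) d) \<in> borel_measurable (PiM I N)"
  using assms
proof (induction L arbitrary: m g)
  case Nil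
  then show ?case by simp
next
  case (Cons e L)
  have m: "m \<in> I" using Cons.prems(3) by auto
  have s[measurable_cong]: "sets (N i) = sets borel" for i by (fact Cons.prems(4))
  have "(\<lambda>d. d m) \<in> measurable (PiM I N) (N m)" using m by simp
  then have [measurable]: "(\<lambda>d. d m) \<in> borel_measurable (PiM I N)"
    using measurable_cong_sets[OF refl s] by blast
  have [measurable]: "g \<in> borel_measurable (PiM I N)" "snd e \<in> borel_measurable borel"
    using Cons.prems by auto
  have [measurable]: "(\<lambda>d. incr_weight L f (Suc m) (g d + d m) d) \<in> borel_measurable (PiM I N)"
    using Cons.prems by (intro Cons.IH) auto
  show ?case by simp
qed

text \<open>By \<open>gauss_bridge\<close> this is \<open>gauss (s + u) (y - x)\<close> times the
  mean of \<open>\<phi>\<close> at time \<open>s\<close> along a Brownian bridge from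
  \<open>x\<close> to \<open>y\<close> of duration \<open>s + u\<close>. Keeping the factor avoids a
  division in \<open>ennreal\<close>.\<close>

abbreviation mid_integral :: "real \<Rightarrow> real \<Rightarrow> ('a::euclidean_space \<Rightarrow> ennreal) \<Rightarrow> 'a \<Rightarrow> 'a \<Rightarrow> ennreal" where
  "mid_integral s u \<phi> x y \<equiv> \<integral>\<^sup>+z. ennreal (gauss s (z - x)) * \<phi> z * ennreal (gauss u (y - z)) \<partial>lborel"

text \<open>Tonelli moves the endpoint outside. For fixed \<open>y\<close> the inner integral is
  pinned at both ends, so bounds for bridges apply to it.\<close>

lemma nn_integral_two_steps:
  assumes [measurable]: "\<phi> \<in> borel_measurable borel" "F \<in> borel_measurable borel"
  shows "(\<integral>\<^sup>+z. ennreal (gauss s (z - x)) * (\<phi> z * (\<integral>\<^sup>+y. ennreal (gauss u (y - z)) * F y \<partial>lborel)) \<partial>lborel)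
    = (\<integral>\<^sup>+y. mid_integral s u \<phi> x y * F y \<partial>lborel)" (is "?l = _")
proof -
  have "?l = (\<integral>\<^sup>+z. (\<integral>\<^sup>+y. ennreal (gauss s (z - x)) * \<phi> z * ennreal (gauss u (y - z)) * F y \<partial>lborel) \<partial>lborel)"
    by (intro nn_integral_cong) (subst nn_integral_cmult[symmetric]; auto simp: mult.assoc nn_integral_cmult)
  also have "\<dots> = (\<integral>\<^sup>+y. (\<integral>\<^sup>+z. ennreal (gauss s (z - x)) * \<phi> z * ennreal (gauss u (y - z)) * F y \<partial>lborel) \<partial>lborel)"
    by (rule lborel_pair.Fubini') (simp add: split_beta', measurable)
  also have "\<dots> = (\<integral>\<^sup>+y. mid_integral s u \<phi> x y * F y \<partial>lborel)"
    by (intro nn_integral_cong nn_integral_multc) measurable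
  finally show ?thesis .
qed

lemma nn_integral_lborel_shift:
  fixes f :: "'a::euclidean_space \<Rightarrow> ennreal"
  assumes [measurable]: "f \<in> borel_measurable borel"
  shows "(\<integral>\<^sup>+z. f (c + z) \<partial>lborel) = (\<integral>\<^sup>+z. f z \<partial>lborel)"
proof -
  have "(\<integral>\<^sup>+z. f z \<partial>lborel) = (\<integral>\<^sup>+z. f z \<partial>distr lborel borel ((+) c))"
    by (simp add: lborel_distr_plus)
  also have "\<dots> = (\<integral>\<^sup>+z. f (c + z) \<partial>lborel)"
    by (subst nn_integral_distr) auto
  finally show ?thesis by simp
qed

text \<open>Coordinate \<open>m\<close> is split off and integrated last. The remaining weight
  depends on it only through the new position \<open>x + d m\<close>, and translation by
  \<open>x\<close> turns the increment density into the transition density.\<close>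

lemma nn_integral_incr_weight:
  assumes "product_sigma_finite N" and sN: "\<And>i. sets (N i) = sets borel"
    and "f \<in> borel_measurable borel"
    and "\<And>e. e \<in> set L \<Longrightarrow> snd e \<in> borel_measurable borel"
    and "\<And>i. i < length L \<Longrightarrow> N (m + i) = density lborel (\<lambda>z. ennreal (gauss (fst (L ! i)) z))"
  shows "(\<integral>\<^sup>+d. incr_weight L f m x d \<partial>PiM {m..<m + length L} N) = gauss_chain L f x"
  using assms(4,5)
proof (induction L arbitrary: m x)
  interpret product_sigma_finite N by fact
  case Nil
  then show ?case by (simp add: PiM_empty nn_integral_count_space_finite)
next
  interpret product_sigma_finite N by fact
  case (Cons e L)
  have [measurable]: "snd e \<in> borel_measurable borel"
    using Cons.prems(1) by simp
  have [measurable]: "gauss_chain L f \<in> borel_measurable borel"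
    using Cons.prems(1) by (intro borel_measurable_gauss_chain assms(3)) simp
  have I: "{m..<m + length (e # L)} = insert m {Suc m..<Suc m + length L}" by auto
  have N: "N m = density lborel (\<lambda>z. ennreal (gauss (fst e) z))"
    using Cons.prems(2)[of 0] by simp
  have IH: "(\<integral>\<^sup>+d. incr_weight L f (Suc m) x d \<partial>PiM {Suc m..<Suc m + length L} N) = gauss_chain L f x" for x
    using Cons.prems(1) Cons.prems(2)[of "Suc _"] by (intro Cons.IH) auto
  have "(\<integral>\<^sup>+d. incr_weight (e # L) f m x d \<partial>PiM {m..<m + length (e # L)} N)
    = (\<integral>\<^sup>+y. (\<integral>\<^sup>+d. incr_weight (e # L) f m x (d(m := y)) \<partial>PiM {Suc m..<Suc m + length L} N) \<partial>N m)"
    unfolding I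
  proof (rule product_nn_integral_insert_rev)
    show "incr_weight (e # L) f m x \<in> borel_measurable (PiM (insert m {Suc m..<Suc m + length L}) N)"
      using Cons.prems(1) by (intro measurable_incr_weight assms(3) sN) auto
  qed auto
  also have "\<dots> = (\<integral>\<^sup>+y. snd e (x + y) * gauss_chain L f (x + y) \<partial>N m)"
  proof (intro nn_integral_cong)
    fix y
    have "(\<integral>\<^sup>+d. incr_weight (e # L) f m x (d(m := y)) \<partial>PiM {Suc m..<Suc m + length L} N)
      = (\<integral>\<^sup>+d. snd e (x + y) * incr_weight L f (Suc m) (x + y) d \<partial>PiM {Suc m..<Suc m + length L} N)"
      by (simp add: incr_weight_upd)
    also have "\<dots> = snd e (x + y) * gauss_chain L f (x + y)"
      using Cons.prems(1)
      by (subst nn_integral_cmult) (auto intro!: measurable_incr_weight assms(3) sN simp: IH[simplified])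
    finally show "(\<integral>\<^sup>+d. incr_weight (e # L) f m x (d(m := y)) \<partial>PiM {Suc m..<Suc m + length L} N)
      = snd e (x + y) * gauss_chain L f (x + y)" .
  qed
  also have "\<dots> = (\<integral>\<^sup>+y. ennreal (gauss (fst e) y) * (snd e (x + y) * gauss_chain L f (x + y)) \<partial>lborel)"
    unfolding N by (subst nn_integral_density) auto
  also have "\<dots> = (\<integral>\<^sup>+y. ennreal (gauss (fst e) (x + y - x)) * (snd e (x + y) * gauss_chain L f (x + y)) \<partial>lborel)"
    by simp
  also have "\<dots> = gauss_chain (e # L) f x"
    by (subst nn_integral_lborel_shift[where c = x]) auto
  finally show ?case .
qed

section \<open>Finite-dimensional distributions of Brownian motion\<close>

context standard_brownian_motion
begin

lemma measurable_B:
  assumes "0 \<le> t" shows "B t \<in> borel_measurable M"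
proof (cases "t = 0")
  case True
  then have "B t \<in> borel_measurable M \<longleftrightarrow> (\<lambda>_. 0) \<in> borel_measurable M"
    by (simp add: start_zero cong: measurable_cong)
  then show ?thesis by simp
next
  case False
  then have "(\<lambda>\<omega>. B t \<omega> - B 0 \<omega>) \<in> borel_measurable M"
    using gaussian_increments[of 0 t] assms by (auto simp: distributed_def)
  moreover have "(\<lambda>\<omega>. B t \<omega> - B 0 \<omega>) \<in> borel_measurable M \<longleftrightarrow> B t \<in> borel_measurable M"
    by (intro measurable_cong) (simp add: start_zero)
  ultimately show ?thesis by simp
qed

lemma nn_integral_path_weight:
  assumes h: "\<And>e. e \<in> set L \<Longrightarrow> 0 < fst e"
    and meas: "\<And>e. e \<in> set L \<Longrightarrow> snd e \<in> borel_measurable borel" "f \<in> borel_measurable borel"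
  shows "(\<integral>\<^sup>+\<omega>. path_weight L f 0 (\<lambda>s. x + B s \<omega>) \<partial>M) = gauss_chain L f x"
proof (cases "L = []")
  \<comment> \<open>The characterisation of independence by a product measure used below requires a
    nonempty index set.\<close>
  case True
  have "(\<integral>\<^sup>+\<omega>. f (x + B 0 \<omega>) \<partial>M) = (\<integral>\<^sup>+\<omega>. f x \<partial>M)"
    by (intro nn_integral_cong) (simp add: start_zero)
  with True show ?thesis by (simp add: emeasure_space_1)
next
  case False
  define n where "n = length L"
  define \<tau> where "\<tau> i = sum_list (take i (map fst L))" for i
  define D where "D i \<omega> = B (\<tau> (Suc i)) \<omega> - B (\<tau> i) \<omega>" for i \<omega>
  have \<tau>_Suc: "\<tau> (Suc i) = \<tau> i + fst (L ! i)" if "i < n" for i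
    using that by (simp add: \<tau>_def n_def take_Suc_conv_app_nth)
  have \<tau>_nonneg: "0 \<le> \<tau> i" for i
    unfolding \<tau>_def using h by (intro sum_list_nonneg) (force dest!: in_set_takeD intro: less_imp_le)
  have D_meas [measurable]: "D i \<in> borel_measurable M" for i
    using measurable_B[OF \<tau>_nonneg] unfolding D_def by measurable
  have indep: "indep_vars (\<lambda>_. borel) D {..<n}"
    unfolding D_def
    by (rule independent_increments) (auto simp: \<tau>_nonneg \<tau>_Suc intro!: less_imp_le h simp: n_def)
  define N where "N i = distr M borel (D i)" for i
  have N: "N i = density lborel (\<lambda>z. ennreal (gauss (fst (L ! i)) z))" if "i < n" for i
  proof -
    have hi: "0 < fst (L ! i)" using that h by (simp add: n_def)
    have "distributed M lborel (D i) (\<lambda>z. ennreal (gauss (\<tau> (Suc i) - \<tau> i) z))"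
      unfolding D_def gauss_def using hi \<tau>_Suc[OF that] by (intro gaussian_increments \<tau>_nonneg) simp
    then have "distr M lborel (D i) = density lborel (\<lambda>z. ennreal (gauss (\<tau> (Suc i) - \<tau> i) z))"
      by (simp add: distributed_def)
    moreover have "distr M lborel (D i) = N i"
      unfolding N_def by (intro distr_cong) auto
    ultimately show ?thesis using \<tau>_Suc[OF that] by simp
  qed
  have psf: "product_sigma_finite N"
    unfolding N_def product_sigma_finite_def
    by (intro allI prob_space_imp_sigma_finite prob_space_distr D_meas)
  have m1: "(\<lambda>\<omega>. \<lambda>i\<in>{..<n}. D i \<omega>) \<in> M \<rightarrow>\<^sub>M Pi\<^sub>M {..<n} (\<lambda>_. borel)"
    by (intro measurable_restrict) simp
  have m2: "incr_weight L f 0 x \<in> borel_measurable (Pi\<^sub>M {..<n} (\<lambda>_. borel))"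
    using meas by (intro measurable_incr_weight) (auto simp: n_def)
  have "(\<integral>\<^sup>+\<omega>. path_weight L f 0 (\<lambda>s. x + B s \<omega>) \<partial>M)
      = (\<integral>\<^sup>+\<omega>. incr_weight L f 0 x (\<lambda>i\<in>{..<n}. D i \<omega>) \<partial>M)"
  proof (intro nn_integral_cong)
    fix \<omega> assume "\<omega> \<in> space M"
    then have "path_weight L f 0 (\<lambda>s. x + B s \<omega>) = incr_weight L f 0 (x + B 0 \<omega>) (\<lambda>i\<in>{..<n}. D i \<omega>)"
      by (intro path_weight_eq_incr_weight) (auto simp: D_def \<tau>_def n_def)
    with \<open>\<omega> \<in> space M\<close> show "path_weight L f 0 (\<lambda>s. x + B s \<omega>) = incr_weight L f 0 x (\<lambda>i\<in>{..<n}. D i \<omega>)"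
      by (simp add: start_zero)
  qed
  also have "\<dots> = (\<integral>\<^sup>+d. incr_weight L f 0 x d \<partial>distr M (PiM {..<n} (\<lambda>_. borel)) (\<lambda>\<omega>. \<lambda>i\<in>{..<n}. D i \<omega>))"
    using m1 m2 by (simp add: nn_integral_distr)
  also have "distr M (PiM {..<n} (\<lambda>_. borel)) (\<lambda>\<omega>. \<lambda>i\<in>{..<n}. D i \<omega>) = PiM {..<n} N"
    using indep_vars_iff_distr_eq_PiM'[of "{..<n}" D "\<lambda>_. borel"] indep False n_def
    unfolding N_def[abs_def] by (auto simp: lessThan_empty_iff)
  also have "(\<integral>\<^sup>+d. incr_weight L f 0 x d \<partial>PiM {..<n} N) = gauss_chain L f x"
    using nn_integral_incr_weight[OF psf _ meas(2,1), of L 0 x] N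
    by (simp add: N_def n_def atLeast0LessThan)
  finally show ?thesis .
qed

end

section \<open>Gaussian bridges and Jensen's inequality\<close>

text \<open>Completing the square in \<open>z\<close>: given both endpoints, the position after time
  \<open>a\<close> is Gaussian, with mean on the segment between them and variance
  \<open>a * b / (a + b)\<close>.\<close>

lemma gauss_bridge:
  fixes x y z :: "'a::euclidean_space"
  assumes a: "0 < a" and b: "0 < b"
  shows "gauss a (z - x) * gauss b (y - z) =
    gauss (a + b) (y - x) * gauss (a * b / (a + b)) (z - ((b / (a + b)) *\<^sub>R x + (a / (a + b)) *\<^sub>R y))"
proof -
  have ab: "0 < a + b" using a b by simp
  define u where "u = z - x"
  define w where "w = y - z"
  have m: "z - ((b / (a + b)) *\<^sub>R x + (a / (a + b)) *\<^sub>R y) = (1 / (a + b)) *\<^sub>R (b *\<^sub>R u - a *\<^sub>R w)"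
  proof -
    have "(a + b) *\<^sub>R (z - ((b / (a + b)) *\<^sub>R x + (a / (a + b)) *\<^sub>R y)) = b *\<^sub>R u - a *\<^sub>R w"
    proof -
      have "(a + b) * (b / (a + b)) = b" "(a + b) * (a / (a + b)) = a" using ab by auto
      then have "(a + b) *\<^sub>R (z - ((b / (a + b)) *\<^sub>R x + (a / (a + b)) *\<^sub>R y)) = (a + b) *\<^sub>R z - (b *\<^sub>R x + a *\<^sub>R y)"
        by (simp only: scaleR_right_diff_distrib scaleR_right_distrib scaleR_scaleR)
      then show ?thesis by (simp add: u_def w_def algebra_simps)
    qed
    then have "(1 / (a + b)) *\<^sub>R ((a + b) *\<^sub>R (z - ((b / (a + b)) *\<^sub>R x + (a / (a + b)) *\<^sub>R y))) = (1 / (a + b)) *\<^sub>R (b *\<^sub>R u - a *\<^sub>R w)"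
      by simp
    then show ?thesis using ab by simp
  qed
  have yx: "y - x = u + w" by (simp add: u_def w_def)
  have e: "(norm u)\<^sup>2 / (2 * a) + (norm w)\<^sup>2 / (2 * b) =
    (norm (u + w))\<^sup>2 / (2 * (a + b)) + (norm ((1 / (a + b)) *\<^sub>R (b *\<^sub>R u - a *\<^sub>R w)))\<^sup>2 / (2 * (a * b / (a + b)))"
  proof -
    define p q r where "p = inner u u" "q = inner w w" "r = inner u w"
    have 1: "(norm u)\<^sup>2 = p" "(norm w)\<^sup>2 = q" "(norm (u + w))\<^sup>2 = p + 2 * r + q"
      unfolding p_q_r_def power2_norm_eq_inner by (simp_all add: inner_simps inner_commute)
    have 2: "(norm (b *\<^sub>R u - a *\<^sub>R w))\<^sup>2 = b\<^sup>2 * p - 2 * a * b * r + a\<^sup>2 * q"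
      unfolding p_q_r_def power2_norm_eq_inner
      by (simp add: inner_simps inner_commute power2_eq_square algebra_simps)
    have 3: "(norm ((1 / (a + b)) *\<^sub>R (b *\<^sub>R u - a *\<^sub>R w)))\<^sup>2 = (b\<^sup>2 * p - 2 * a * b * r + a\<^sup>2 * q) / (a + b)\<^sup>2"
      unfolding norm_scaleR power_mult_distrib 2 by (simp add: power_divide)
    have "(b\<^sup>2 * p - 2 * a * b * r + a\<^sup>2 * q) / (a + b)\<^sup>2 / (2 * (a * b / (a + b)))
        = (b\<^sup>2 * p - 2 * a * b * r + a\<^sup>2 * q) / (2 * a * b * (a + b))"
      using a b ab by (simp add: power2_eq_square)
    moreover have "p / (2 * a) + q / (2 * b) - (p + 2 * r + q) / (2 * (a + b)) = (b\<^sup>2 * p - 2 * a * b * r + a\<^sup>2 * q) / (2 * a * b * (a + b))"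
      using a b ab by (simp add: divide_simps power2_eq_square) (simp add: algebra_simps)
    ultimately show ?thesis unfolding 1 3 by simp
  qed
  have pre: "(2 * pi * a) powr c * (2 * pi * b) powr c = (2 * pi * (a + b)) powr c * (2 * pi * (a * b / (a + b))) powr c" for c
  proof -
    have "(2 * pi * a) * (2 * pi * b) = (2 * pi * (a + b)) * (2 * pi * (a * b / (a + b)))"
      using ab by simp
    then show ?thesis using a b ab by (subst (1 2) powr_mult[symmetric]) (auto simp: mult_ac)
  qed
  have "gauss a u * gauss b w = ((2 * pi * a) powr (- real DIM('a) / 2) * (2 * pi * b) powr (- real DIM('a) / 2))
      * exp (- ((norm u)\<^sup>2 / (2 * a) + (norm w)\<^sup>2 / (2 * b)))"
    by (simp add: gauss_def mult_exp_exp algebra_simps)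
  also have "\<dots> = gauss (a + b) (u + w) * gauss (a * b / (a + b)) ((1 / (a + b)) *\<^sub>R (b *\<^sub>R u - a *\<^sub>R w))"
    unfolding e pre by (simp only: gauss_def minus_add_distrib exp_add minus_divide_left) (simp only: mult_ac)
  finally show ?thesis unfolding m yx u_def[symmetric] w_def[symmetric] .
qed

text \<open>Half of the Gaussian exponent becomes an explicit decay factor, and the other half
  remains a probability density, of variance \<open>2 * h\<close>.\<close>

lemma gauss_double:
  assumes "0 < h"
  shows "gauss h (z::'a::euclidean_space) = 2 powr (real DIM('a) / 2) * exp (- (norm z)\<^sup>2 / (4 * h)) * gauss (2 * h) z"
proof -
  have 1: "(2 * pi * h) powr (- real DIM('a) / 2) = 2 powr (real DIM('a) / 2) * (2 * pi * (2 * h)) powr (- real DIM('a) / 2)"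
  proof -
    have "(2 * pi * (2 * h)) powr (- real DIM('a) / 2) = 2 powr (- real DIM('a) / 2) * (2 * pi * h) powr (- real DIM('a) / 2)"
      using assms by (simp add: powr_mult[symmetric] mult_ac)
    moreover have "2 powr (real DIM('a) / 2) * 2 powr (- real DIM('a) / 2) = (1::real)"
      by (simp add: powr_add[symmetric])
    ultimately show ?thesis by (simp add: mult.assoc[symmetric])
  qed
  have 2: "exp (- (norm z)\<^sup>2 / (2 * h)) = exp (- (norm z)\<^sup>2 / (4 * h)) * exp (- (norm z)\<^sup>2 / (2 * (2 * h)))"
    using assms by (simp add: mult_exp_exp)
  show ?thesis unfolding gauss_def 1 2 by (simp only: mult_ac)
qed

lemma gauss_le:
  assumes "0 < s" "s \<le> h"
  shows "gauss h (z::'a::euclidean_space) \<le> (2 * pi * s) powr (- real DIM('a) / 2)"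
proof -
  have "gauss h z \<le> (2 * pi * h) powr (- real DIM('a) / 2) * 1"
    unfolding gauss_def using assms by (intro mult_left_mono) (auto simp: divide_simps)
  also have "\<dots> \<le> (2 * pi * s) powr (- real DIM('a) / 2)"
    using assms by (simp add: powr_mono2')
  finally show ?thesis .
qed

text \<open>
  Jensen's inequality in unnormalised form: integrate the tangent line of \<open>u \<mapsto> exp (- u)\<close> at \<open>m\<close>.
\<close>

lemma nn_integral_exp_minus_ge:
  fixes u :: "'b \<Rightarrow> real"
  assumes [measurable]: "u \<in> borel_measurable M" "w \<in> borel_measurable M"
    and u: "\<And>\<omega>. 0 \<le> u \<omega>" and m: "0 \<le> m"
    and fin: "(\<integral>\<^sup>+\<omega>. w \<omega> \<partial>M) < \<infinity>"
    and le: "(\<integral>\<^sup>+\<omega>. w \<omega> * ennreal (u \<omega>) \<partial>M) \<le> ennreal m * (\<integral>\<^sup>+\<omega>. w \<omega> \<partial>M)"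
  shows "ennreal (exp (- m)) * (\<integral>\<^sup>+\<omega>. w \<omega> \<partial>M) \<le> (\<integral>\<^sup>+\<omega>. w \<omega> * ennreal (exp (- u \<omega>)) \<partial>M)"
proof -
  obtain W where W: "(\<integral>\<^sup>+\<omega>. w \<omega> \<partial>M) = ennreal W" "0 \<le> W"
    using fin by (cases "\<integral>\<^sup>+\<omega>. w \<omega> \<partial>M") auto
  have "(\<integral>\<^sup>+\<omega>. w \<omega> * ennreal (exp (- u \<omega>)) \<partial>M) \<le> (\<integral>\<^sup>+\<omega>. w \<omega> * 1 \<partial>M)"
    using u by (intro nn_integral_mono mult_left_mono) (auto simp: ennreal_le_1)
  then have "(\<integral>\<^sup>+\<omega>. w \<omega> * ennreal (exp (- u \<omega>)) \<partial>M) < \<infinity>"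
    using W(1) by (simp add: order_le_less_trans[OF _ ennreal_less_top])
  then obtain I where I: "(\<integral>\<^sup>+\<omega>. w \<omega> * ennreal (exp (- u \<omega>)) \<partial>M) = ennreal I" "0 \<le> I"
    by (cases "\<integral>\<^sup>+\<omega>. w \<omega> * ennreal (exp (- u \<omega>)) \<partial>M") auto
  have tangent: "exp (- m) * (1 + m) \<le> exp (- u \<omega>) + exp (- m) * u \<omega>" for \<omega>
  proof -
    have "exp (- m) * (1 + (m - u \<omega>)) \<le> exp (- m) * exp (m - u \<omega>)"
      by (intro mult_left_mono exp_ge_add_one_self) simp
    also have "\<dots> = exp (- u \<omega>)" by (simp add: mult_exp_exp)
    finally show ?thesis by (simp add: algebra_simps)
  qed
  have "ennreal (exp (- m) * (1 + m)) * ennreal W = (\<integral>\<^sup>+\<omega>. ennreal (exp (- m) * (1 + m)) * w \<omega> \<partial>M)"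
    by (simp add: nn_integral_cmult W)
  also have "\<dots> \<le> (\<integral>\<^sup>+\<omega>. w \<omega> * ennreal (exp (- u \<omega>)) + ennreal (exp (- m)) * (w \<omega> * ennreal (u \<omega>)) \<partial>M)"
  proof (intro nn_integral_mono)
    fix \<omega>
    have "ennreal (exp (- m) * (1 + m)) * w \<omega> \<le> ennreal (exp (- u \<omega>) + exp (- m) * u \<omega>) * w \<omega>"
      by (intro mult_right_mono ennreal_leI tangent) simp
    also have "\<dots> = w \<omega> * ennreal (exp (- u \<omega>)) + ennreal (exp (- m)) * (w \<omega> * ennreal (u \<omega>))"
      using u[of \<omega>] by (simp add: ennreal_plus ennreal_mult distrib_left distrib_right mult_ac)
    finally show "ennreal (exp (- m) * (1 + m)) * w \<omega> \<le> w \<omega> * ennreal (exp (- u \<omega>)) + ennreal (exp (- m)) * (w \<omega> * ennreal (u \<omega>))" .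
  qed
  also have "\<dots> = ennreal I + ennreal (exp (- m)) * (\<integral>\<^sup>+\<omega>. w \<omega> * ennreal (u \<omega>) \<partial>M)"
    by (simp add: nn_integral_add nn_integral_cmult I)
  also have "\<dots> \<le> ennreal I + ennreal (exp (- m)) * (ennreal m * ennreal W)"
    using le by (intro add_left_mono mult_left_mono) (auto simp: W)
  \<comment> \<open>Since \<open>W\<close> and \<open>I\<close> are finite, the inequality passes to
    the reals, where the term with \<open>m * W\<close> can be cancelled.\<close>
  finally have "exp (- m) * (1 + m) * W \<le> I + exp (- m) * (m * W)"
    using m W I by (simp add: ennreal_mult[symmetric] ennreal_plus[symmetric] del: ennreal_plus)
  then have "exp (- m) * W \<le> I" by (simp add: algebra_simps)
  then show ?thesis unfolding I W by (simp add: ennreal_mult[symmetric] W I)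
qed

context standard_brownian_motion
begin

text \<open>The Gaussian integral is not computed: a chain of one step with weight 1 identifies it
  with the total mass of \<open>M\<close>.\<close>

lemma nn_integral_gauss:
  assumes "0 < h" shows "(\<integral>\<^sup>+z. ennreal (gauss h (z - x :: 'a)) \<partial>lborel) = 1"
  using nn_integral_path_weight[of "[(h, \<lambda>_. 1)]" "\<lambda>_. 1" x] assms
  by (simp add: emeasure_space_1)

text \<open>Joint measurability follows from path continuity. Rounding the time down to a multiple
  of \<open>1 / (n + 1)\<close> leaves countably many times, for each of which \<open>B\<close> is
  measurable, and the rounded processes converge pointwise.\<close>

lemma measurable_process:
  "(\<lambda>z. B (max (fst z) 0) (snd z)) \<in> borel_measurable (lborel \<Otimes>\<^sub>M M)"
proof (rule borel_measurable_LIMSEQ_metric)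
  let ?d = "\<lambda>n s. real (nat \<lfloor>max s 0 * real (Suc n)\<rfloor>) / real (Suc n)"
  fix n
  have [measurable]: "(\<lambda>z. B (real i / real (Suc n)) (snd z)) \<in> borel_measurable (lborel \<Otimes>\<^sub>M M)" for i :: nat
    using measurable_B[of "real i / real (Suc n)"] by (intro measurable_compose[OF measurable_snd]) simp
  have [measurable]: "(\<lambda>z. nat \<lfloor>max (fst z) 0 * real (Suc n)\<rfloor>) \<in> measurable (lborel \<Otimes>\<^sub>M M) (count_space UNIV)"
    by measurable
  show "(\<lambda>z. B (?d n (fst z)) (snd z)) \<in> borel_measurable (lborel \<Otimes>\<^sub>M M)"
    by (rule measurable_compose_countable[where f = "\<lambda>i z. B (real i / real (Suc n)) (snd z)"]) measurable
next
  let ?d = "\<lambda>n s. real (nat \<lfloor>max s 0 * real (Suc n)\<rfloor>) / real (Suc n)"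
  fix z :: "real \<times> 'w" assume "z \<in> space (lborel \<Otimes>\<^sub>M M)"
  then have \<omega>: "snd z \<in> space M" by (auto simp: space_pair_measure)
  define s where "s = max (fst z) 0"
  have lim: "(\<lambda>n. ?d n (fst z)) \<longlonglongrightarrow> s"
  proof (rule real_tendsto_sandwich[where f = "\<lambda>n. s - 1 / real (Suc n)" and h = "\<lambda>n. s"])
    have "s - 1 / real (Suc n) \<le> ?d n (fst z) \<and> ?d n (fst z) \<le> s" for n
    proof -
      have nn: "0 \<le> s * real (Suc n)" by (simp add: s_def)
      then have "real (nat \<lfloor>s * real (Suc n)\<rfloor>) = of_int \<lfloor>s * real (Suc n)\<rfloor>" by (simp add: of_nat_nat)
      then have "s * real (Suc n) - 1 \<le> real (nat \<lfloor>s * real (Suc n)\<rfloor>) \<and> real (nat \<lfloor>s * real (Suc n)\<rfloor>) \<le> s * real (Suc n)"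
        by linarith
      moreover have "s - 1 / N \<le> k / N \<and> k / N \<le> s" if "0 < N" "s * N - 1 \<le> k \<and> k \<le> s * N" for k N :: real
      proof -
        have "s - 1 / N = (s * N - 1) / N" "s = s * N / N" using that(1) by (auto simp: field_simps)
        then show ?thesis using that by (metis divide_right_mono less_imp_le)
      qed
      ultimately show ?thesis unfolding s_def[symmetric] by simp
    qed
    then show "\<forall>\<^sub>F n in sequentially. s - 1 / real (Suc n) \<le> ?d n (fst z)"
      "\<forall>\<^sub>F n in sequentially. ?d n (fst z) \<le> s" by auto
    show "(\<lambda>n. s - 1 / real (Suc n)) \<longlonglongrightarrow> s"
      using tendsto_diff[OF tendsto_const[of s] LIMSEQ_inverse_real_of_nat] by (simp add: inverse_eq_divide del: of_nat_Suc)
  qed auto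
  show "(\<lambda>n. B (?d n (fst z)) (snd z)) \<longlonglongrightarrow> B (max (fst z) 0) (snd z)"
    using continuous_on_tendsto_compose[OF continuous_paths[OF \<omega>] lim] by (simp add: s_def)
qed

end

section \<open>Brownian paths and the action\<close>

locale nonneg_potential = standard_brownian_motion M B
  for M :: "'w measure" and B :: "real \<Rightarrow> 'w \<Rightarrow> 'a::euclidean_space" +
  fixes V :: "'a \<Rightarrow> real"
  assumes V_borel [measurable]: "V \<in> borel_measurable borel"
    and V_nonneg [simp]: "0 \<le> V x"
    and V_bounded: "locally_bounded V"
begin

text \<open>
  The value for negative times is clamped so that the path is continuous, hence measurable, on all of \<open>\<real>\<close>.
\<close>

definition path :: "'a \<Rightarrow> 'w \<Rightarrow> real \<Rightarrow> 'a" where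
  "path x \<omega> s = x + B (max s 0) \<omega>"

definition action :: "real \<Rightarrow> 'a \<Rightarrow> 'w \<Rightarrow> real" where
  "action t x \<omega> = (LINT s:{0..t}|lborel. V (path x \<omega> s))"

lemma measurable_path [measurable]:
  "(\<lambda>z. path x (snd z) (fst z)) \<in> borel_measurable (lborel \<Otimes>\<^sub>M M)"
  using measurable_process unfolding path_def by measurable

lemma measurable_path2 [measurable]:
  assumes [measurable]: "f \<in> borel_measurable N" "g \<in> measurable N M"
  shows "(\<lambda>z. path x (g z) (f z)) \<in> borel_measurable N"
proof -
  have "(\<lambda>z. (f z, g z)) \<in> measurable N (lborel \<Otimes>\<^sub>M M)" by measurable
  from measurable_compose[OF this measurable_path] show ?thesis by simp
qed

lemma action_eq: "action t x \<omega> = (LINT s:{0..t}|lborel. V (x + B s \<omega>))"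
  unfolding action_def by (intro set_lebesgue_integral_cong) (auto simp: path_def max_def)

lemma action_nonneg: "0 \<le> action t x \<omega>"
  unfolding action_def set_lebesgue_integral_def by (intro integral_nonneg_AE) auto

lemma measurable_action [measurable]: "action t x \<in> borel_measurable M"
  unfolding action_def set_lebesgue_integral_def by measurable

text \<open>A continuous path has compact image on \<open>{0..t}\<close>, where \<open>V\<close> is
  bounded. Hence the Bochner integral in \<open>action\<close> exists and is not the default value
  0.\<close>

lemma action_nn:
  assumes \<omega>: "\<omega> \<in> space M"
  shows "ennreal (action t x \<omega>) = (\<integral>\<^sup>+s\<in>{0..t}. ennreal (V (path x \<omega> s)) \<partial>lborel)"
proof -
  have c: "continuous_on {0..t} (\<lambda>s. x + B s \<omega>)"
    by (intro continuous_intros continuous_on_subset[OF continuous_paths[OF \<omega>]]) auto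
  have "compact ((\<lambda>s. x + B s \<omega>) ` {0..t})"
    by (intro compact_continuous_image c) simp
  then have "bounded (V ` (\<lambda>s. x + B s \<omega>) ` {0..t})"
    using V_bounded by (auto simp: locally_bounded_def)
  then obtain K where K: "\<And>s. s \<in> {0..t} \<Longrightarrow> V (x + B s \<omega>) \<le> K"
    unfolding bounded_iff by (force simp: abs_le_iff)
  have [measurable]: "(\<lambda>s. V (path x \<omega> s)) \<in> borel_measurable lborel"
    using \<omega> by measurable
  have "set_integrable lborel {0..t} (\<lambda>s. V (path x \<omega> s))"
    unfolding set_integrable_def
  proof (rule Bochner_Integration.integrable_bound)
    show "integrable lborel (\<lambda>s. indicator {0..t} s *\<^sub>R K)"
      by (intro integrable_scaleR_left impI integrable_real_indicator) (auto simp: emeasure_lborel_Icc_eq)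
    show "AE s in lborel. norm (indicator {0..t} s *\<^sub>R V (path x \<omega> s)) \<le> norm (indicator {0..t} s *\<^sub>R K)"
      using K by (intro AE_I2) (auto simp: indicator_def path_def max_def intro: order_trans[OF _ abs_ge_self])
  qed measurable
  then have "ennreal (action t x \<omega>) = (\<integral>\<^sup>+s. ennreal (indicator {0..t} s *\<^sub>R V (path x \<omega> s)) \<partial>lborel)"
    unfolding action_def set_lebesgue_integral_def set_integrable_def
    by (subst nn_integral_eq_integral) auto
  also have "\<dots> = (\<integral>\<^sup>+s\<in>{0..t}. ennreal (V (path x \<omega> s)) \<partial>lborel)"
    by (intro nn_integral_cong) (auto simp: indicator_def)
  finally show ?thesis .
qed

lemma semigroup_nn:
  assumes t: "0 \<le> t" and f: "f \<in> bcontfun" "\<And>x. 0 \<le> f x"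
  shows "ennreal (schroedinger_semigroup M B V t f x) =
    (\<integral>\<^sup>+\<omega>. ennreal (f (path x \<omega> t)) * ennreal (exp (- action t x \<omega>)) \<partial>M)"
    and "0 \<le> schroedinger_semigroup M B V t f x"
proof -
  have [measurable]: "f \<in> borel_measurable borel"
    using f(1) by (rule borel_measurable_bcontfun)
  have eq: "schroedinger_semigroup M B V t f x = (\<integral>\<omega>. f (path x \<omega> t) * exp (- action t x \<omega>) \<partial>M)"
    unfolding schroedinger_semigroup_def action_eq path_def using t by (simp add: max_def)
  obtain K where K: "\<And>x. norm (f x) \<le> K"
    using f(1) by (auto simp: bcontfun_def bounded_iff)
  have int: "integrable M (\<lambda>\<omega>. f (path x \<omega> t) * exp (- action t x \<omega>))"
  proof (rule integrable_const_bound[where B = K])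
    show "AE \<omega> in M. norm (f (path x \<omega> t) * exp (- action t x \<omega>)) \<le> K"
    proof (intro AE_I2)
      fix \<omega>
      have "norm (f (path x \<omega> t) * exp (- action t x \<omega>)) \<le> norm (f (path x \<omega> t)) * 1"
        unfolding norm_mult using action_nonneg by (intro mult_left_mono) auto
      with K[of "path x \<omega> t"] show "norm (f (path x \<omega> t) * exp (- action t x \<omega>)) \<le> K" by simp
    qed
  qed measurable
  show "ennreal (schroedinger_semigroup M B V t f x) =
    (\<integral>\<^sup>+\<omega>. ennreal (f (path x \<omega> t)) * ennreal (exp (- action t x \<omega>)) \<partial>M)"
    unfolding eq using int f(2) by (subst nn_integral_eq_integral[symmetric]) (auto simp: ennreal_mult)
  show "0 \<le> schroedinger_semigroup M B V t f x"
    unfolding eq using f(2) by (intro integral_nonneg_AE) auto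
qed

abbreviation semigroup :: "real \<Rightarrow> ('a \<Rightarrow> real) \<Rightarrow> 'a \<Rightarrow> real" where
  "semigroup \<equiv> schroedinger_semigroup M B V"

lemma gauss_chain_eq_path_integral:
  assumes "\<And>e. e \<in> set L \<Longrightarrow> 0 < fst e"
    and "\<And>e. e \<in> set L \<Longrightarrow> snd e \<in> borel_measurable borel" "f \<in> borel_measurable borel"
  shows "(\<integral>\<^sup>+\<omega>. path_weight L f 0 (path x \<omega>) \<partial>M) = gauss_chain L f x"
proof -
  have "path_weight L f s (path x \<omega>) = path_weight L f s (\<lambda>s. x + B s \<omega>)" if "0 \<le> s" for s \<omega>
    using that assms(1)
  proof (induction L arbitrary: s)
    case (Cons e L)
    have "0 < fst e" using Cons.prems(2) by simp
    then have "0 \<le> s + fst e" using Cons.prems(1) by simp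
    with Cons.IH[OF this] Cons.prems(2) show ?case by (simp add: path_def max_def)
  qed (simp add: path_def max_def)
  with nn_integral_path_weight[OF assms] show ?thesis by simp
qed

end

section \<open>Upper bounds for the heat kernel\<close>

lemma nn_integral_unit_interval_le:
  assumes "\<And>\<theta>. 0 < \<theta> \<Longrightarrow> \<theta> < 1 \<Longrightarrow> F \<theta> \<le> (K :: ennreal)"
  shows "(\<integral>\<^sup>+\<theta>. indicator {0<..<1::real} \<theta> * F \<theta> \<partial>lborel) \<le> K"
proof -
  have "(\<integral>\<^sup>+\<theta>. indicator {0<..<1::real} \<theta> * F \<theta> \<partial>lborel) \<le> (\<integral>\<^sup>+\<theta>. K * indicator {0<..<1::real} \<theta> \<partial>lborel)"
    using assms by (intro nn_integral_mono) (auto simp: indicator_def)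
  also have "\<dots> = K" by (simp add: nn_integral_cmult_indicator)
  finally show ?thesis .
qed

lemma nn_integral_gauss_mult_le:
  assumes "0 < s" "s \<le> h" "f \<in> borel_measurable borel"
  shows "(\<integral>\<^sup>+w. ennreal (gauss h (w - z :: 'a::euclidean_space)) * f w \<partial>lborel)
    \<le> ennreal ((2 * pi * s) powr (- real DIM('a) / 2)) * (\<integral>\<^sup>+w. f w \<partial>lborel)"
proof -
  have "(\<integral>\<^sup>+w. ennreal (gauss h (w - z)) * f w \<partial>lborel)
     \<le> (\<integral>\<^sup>+w. ennreal ((2 * pi * s) powr (- real DIM('a) / 2)) * f w \<partial>lborel)"
    by (intro nn_integral_mono mult_right_mono ennreal_leI gauss_le assms) simp
  also have "\<dots> = ennreal ((2 * pi * s) powr (- real DIM('a) / 2)) * (\<integral>\<^sup>+w. f w \<partial>lborel)"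
    using assms by (intro nn_integral_cmult) simp
  finally show ?thesis .
qed

lemma sum_indicator_consecutive_intervals_le:
  assumes "0 < \<sigma>"
  shows "(\<Sum>k<n. indicator {a + \<sigma> * real k<..<a + \<sigma> * real k + \<sigma>} s :: ennreal) \<le> indicator {a<..<a + \<sigma> * real n} s"
proof (induction n)
  case (Suc n)
  have "(\<Sum>k<Suc n. indicator {a + \<sigma> * real k<..<a + \<sigma> * real k + \<sigma>} s :: ennreal)
    \<le> indicator {a<..<a + \<sigma> * real n} s + indicator {a + \<sigma> * real n<..<a + \<sigma> * real n + \<sigma>} s"
    using Suc by (simp add: add_right_mono)
  also have "\<dots> \<le> indicator {a<..<a + \<sigma> * real (Suc n)} s"
  proof -
    have *: "indicator {a<..<a + b} s + indicator {a + b<..<a + b + \<sigma>} s \<le> (indicator {a<..<a + b + \<sigma>} s :: ennreal)"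
      if "0 \<le> b" for b
      using assms that by (auto simp: indicator_def)
    from *[of "\<sigma> * real n"] have "indicator {a<..<a + \<sigma> * real n} s + indicator {a + \<sigma> * real n<..<a + \<sigma> * real n + \<sigma>} s
        \<le> (indicator {a<..<a + \<sigma> * real n + \<sigma>} s :: ennreal)"
      using assms by simp
    then show ?thesis by (simp add: algebra_simps)
  qed
  finally show ?case .
qed simp

text \<open>With a common offset \<open>\<theta>\<close> in all \<open>n\<close> windows, the
  integral over their union is the average over \<open>\<theta>\<close> of \<open>n\<close> point
  values times \<open>\<sigma>\<close>; Jensen moves the average out of the exponential. The single
  offset keeps the sampling times equally spaced, so each \<open>\<theta>\<close> gives one Gaussian
  chain.\<close>

lemma exp_minus_integral_le_average:
  fixes v :: "real \<Rightarrow> real"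
  assumes [measurable]: "v \<in> borel_measurable borel" and v: "\<And>s. 0 \<le> v s"
    and I: "(\<integral>\<^sup>+s\<in>{0..t}. ennreal (v s) \<partial>lborel) = ennreal I" "0 \<le> I"
    and a: "0 \<le> a" and \<sigma>: "0 < \<sigma>" and t: "a + \<sigma> * real n \<le> t"
  shows "ennreal (exp (- I)) \<le> (\<integral>\<^sup>+\<theta>. indicator {0<..<1} \<theta> * ennreal (exp (- (\<Sum>k<n. \<sigma> * v (a + \<sigma> * real k + \<sigma> * \<theta>)))) \<partial>lborel)"
proof -
  define u where "u \<theta> = (\<Sum>k<n. \<sigma> * v (a + \<sigma> * real k + \<sigma> * \<theta>))" for \<theta>
  have u_nonneg: "0 \<le> u \<theta>" for \<theta> unfolding u_def using v \<sigma> by (intro sum_nonneg) simp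
  have [measurable]: "u \<in> borel_measurable borel" unfolding u_def by measurable
  have w: "(\<integral>\<^sup>+\<theta>. indicator {0<..<1::real} \<theta> \<partial>lborel) = 1" by simp
  have "(\<integral>\<^sup>+\<theta>. indicator {0<..<1} \<theta> * ennreal (u \<theta>) \<partial>lborel)
      = (\<integral>\<^sup>+\<theta>. (\<Sum>k<n. ennreal \<sigma> * (indicator {0<..<1} \<theta> * ennreal (v (a + \<sigma> * real k + \<sigma> * \<theta>)))) \<partial>lborel)"
  proof (intro nn_integral_cong)
    fix \<theta>
    have "ennreal (u \<theta>) = (\<Sum>k<n. ennreal \<sigma> * ennreal (v (a + \<sigma> * real k + \<sigma> * \<theta>)))"
      unfolding u_def using v \<sigma> by (subst sum_ennreal[symmetric]) (auto simp: ennreal_mult)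
    then show "indicator {0<..<1} \<theta> * ennreal (u \<theta>) = (\<Sum>k<n. ennreal \<sigma> * (indicator {0<..<1} \<theta> * ennreal (v (a + \<sigma> * real k + \<sigma> * \<theta>))))"
      by (simp add: sum_distrib_left mult_ac)
  qed
  also have "\<dots> = (\<Sum>k<n. ennreal \<sigma> * (\<integral>\<^sup>+\<theta>. indicator {0<..<1} \<theta> * ennreal (v (a + \<sigma> * real k + \<sigma> * \<theta>)) \<partial>lborel))"
    by (simp add: nn_integral_sum nn_integral_cmult)
  also have "\<dots> = (\<Sum>k<n. \<integral>\<^sup>+s. indicator {a + \<sigma> * real k<..<a + \<sigma> * real k + \<sigma>} s * ennreal (v s) \<partial>lborel)"
  proof (intro sum.cong refl)
    fix k
    have ind: "indicator {a + \<sigma> * real k<..<a + \<sigma> * real k + \<sigma>} (a + \<sigma> * real k + \<sigma> * \<theta>) = (indicator {0<..<1} \<theta> :: ennreal)" for \<theta>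
      using \<sigma> by (auto simp: indicator_def zero_less_mult_iff)
    have "(\<integral>\<^sup>+s. indicator {a + \<sigma> * real k<..<a + \<sigma> * real k + \<sigma>} s * ennreal (v s) \<partial>lborel)
      = ennreal \<bar>\<sigma>\<bar> * (\<integral>\<^sup>+\<theta>. indicator {a + \<sigma> * real k<..<a + \<sigma> * real k + \<sigma>} (a + \<sigma> * real k + \<sigma> * \<theta>) * ennreal (v (a + \<sigma> * real k + \<sigma> * \<theta>)) \<partial>lborel)"
      using \<sigma> by (intro nn_integral_real_affine) auto
    then show "ennreal \<sigma> * (\<integral>\<^sup>+\<theta>. indicator {0<..<1} \<theta> * ennreal (v (a + \<sigma> * real k + \<sigma> * \<theta>)) \<partial>lborel)
      = (\<integral>\<^sup>+s. indicator {a + \<sigma> * real k<..<a + \<sigma> * real k + \<sigma>} s * ennreal (v s) \<partial>lborel)"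
      using \<sigma> unfolding ind by simp
  qed
  also have "\<dots> = (\<integral>\<^sup>+s. (\<Sum>k<n. indicator {a + \<sigma> * real k<..<a + \<sigma> * real k + \<sigma>} s) * ennreal (v s) \<partial>lborel)"
    by (simp add: nn_integral_sum[symmetric] sum_distrib_right)
  also have "\<dots> \<le> (\<integral>\<^sup>+s\<in>{0..t}. ennreal (v s) \<partial>lborel)"
  proof (intro nn_integral_mono)
    fix s
    have "(\<Sum>k<n. indicator {a + \<sigma> * real k<..<a + \<sigma> * real k + \<sigma>} s :: ennreal) \<le> indicator {a<..<a + \<sigma> * real n} s"
      by (rule sum_indicator_consecutive_intervals_le[OF \<sigma>])
    also have "\<dots> \<le> indicator {0..t} s" using a t by (auto simp: indicator_def)
    finally show "(\<Sum>k<n. indicator {a + \<sigma> * real k<..<a + \<sigma> * real k + \<sigma>} s) * ennreal (v s) \<le> ennreal (v s) * indicator {0..t} s"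
      by (subst mult.commute) (intro mult_left_mono, auto)
  qed
  finally have "(\<integral>\<^sup>+\<theta>. indicator {0<..<1} \<theta> * ennreal (u \<theta>) \<partial>lborel) \<le> ennreal I * (\<integral>\<^sup>+\<theta>. indicator {0<..<1::real} \<theta> \<partial>lborel)"
    unfolding w I by simp
  from nn_integral_exp_minus_ge[OF _ _ u_nonneg I(2) _ this] show ?thesis
    unfolding u_def[symmetric] by (simp add: w)
qed

section \<open>Pointwise bounds from integrals against bumps\<close>

lemma nn_integral_bump:
  fixes y :: "'a::euclidean_space"
  assumes "0 < \<rho>"
  defines "f \<equiv> \<lambda>z. max 0 (\<rho> - dist y z)"
  shows "f \<in> bcontfun" "mass f \<noteq> 0" "mass f < \<infinity>"
proof -
  have c: "continuous_on UNIV f" unfolding f_def by (intro continuous_intros)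
  then have [measurable]: "f \<in> borel_measurable borel" by (rule borel_measurable_continuous_onI)
  have b: "norm (f z) \<le> \<rho>" for z using assms by (auto simp: f_def)
  then show "f \<in> bcontfun" using c unfolding bcontfun_def by (auto simp: bounded_iff)
  have "mass f \<le> (\<integral>\<^sup>+z. ennreal \<rho> * indicator (ball y \<rho>) z \<partial>lborel)"
    using assms by (intro nn_integral_mono) (auto simp: f_def indicator_def ennreal_neg intro!: ennreal_leI)
  also have "\<dots> < \<infinity>"
    using emeasure_lborel_ball_finite[of y \<rho>] by (simp add: nn_integral_cmult_indicator ennreal_mult_less_top less_top)
  finally show "mass f < \<infinity>" .
  show "mass f \<noteq> 0"
  proof
    assume "mass f = 0"
    then have "AE z in lborel. ennreal (f z) = 0" by (simp add: nn_integral_0_iff_AE)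
    then have "AE z in lborel. z \<notin> ball y \<rho>" by eventually_elim (auto simp: f_def ennreal_eq_0_iff)
    then have "emeasure lborel (ball y \<rho>) = 0" by (subst (asm) AE_iff_measurable[of "ball y \<rho>"]) auto
    moreover have "0 < unit_ball_vol (real DIM('a)) * \<rho> ^ DIM('a)" using assms(1) by simp
    ultimately show False using assms(1) by (simp add: emeasure_ball ennreal_eq_0_iff)
  qed
qed

text \<open>The support lies both in \<open>U\<close>, where continuity is used, and in
  \<open>ball y r\<close>, where the integral estimates are known. The last property cancels
  \<open>mass f\<close>, which is positive and finite.\<close>

lemma bump_near:
  fixes y :: "'a::euclidean_space"
  assumes U: "open U" "y \<in> U" and r: "0 < r"
  obtains f where "f \<in> bcontfun" "\<And>z. 0 \<le> f z" "\<And>z. z \<notin> ball y r \<Longrightarrow> f z = 0" "\<And>z. z \<notin> U \<Longrightarrow> f z = 0"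
    "\<And>c c' :: real. 0 \<le> c' \<Longrightarrow> ennreal c * mass f \<le> ennreal c' * mass f \<Longrightarrow> c \<le> c'"
proof -
  obtain \<rho>' where \<rho>': "0 < \<rho>'" "ball y \<rho>' \<subseteq> U" using U open_contains_ball by metis
  define \<rho> where "\<rho> = min r \<rho>'"
  have \<rho>: "0 < \<rho>" using r \<rho>' by (simp add: \<rho>_def)
  define f where "f z = max 0 (\<rho> - dist y z)" for z
  have f: "f \<in> bcontfun" "mass f \<noteq> 0" "mass f < \<infinity>"
    unfolding f_def[abs_def] using nn_integral_bump[OF \<rho>, of y] by auto
  show ?thesis
  proof (rule that[OF f(1)])
    show "0 \<le> f z" for z by (simp add: f_def)
    show "f z = 0" if "z \<notin> ball y r" for z using that by (simp add: f_def \<rho>_def)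
    show "f z = 0" if "z \<notin> U" for z
    proof -
      have "z \<notin> ball y \<rho>'" using \<rho>'(2) that by blast
      then show ?thesis by (simp add: f_def \<rho>_def)
    qed
    fix c c' :: real assume "0 \<le> c'" "ennreal c * mass f \<le> ennreal c' * mass f"
    then have "ennreal c \<le> ennreal c'"
      using f(2,3) ennreal_mult_le_mult_iff[of "mass f" "ennreal c" "ennreal c'"] by (simp add: mult.commute)
    then show "c \<le> c'" using \<open>0 \<le> c'\<close> by (simp add: ennreal_le_iff)
  qed
qed

text \<open>If \<open>k y\<close> exceeded \<open>c\<close>, a bump supported where \<open>k\<close>
  exceeds an intermediate value \<open>c'\<close> would violate the integral bound. The radius
  \<open>r\<close> restricts the hypothesis to endpoints near \<open>y\<close>.\<close>

lemma le_of_nn_integral_le: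
  fixes k :: "'a::euclidean_space \<Rightarrow> real"
  assumes k: "continuous_on UNIV k" and c: "0 \<le> c" and r: "0 < r"
    and le: "\<And>f. f \<in> bcontfun \<Longrightarrow> (\<And>z. 0 \<le> f z) \<Longrightarrow> (\<And>z. z \<notin> ball y r \<Longrightarrow> f z = 0) \<Longrightarrow>
      (\<integral>\<^sup>+z. ennreal (k z) * ennreal (f z) \<partial>lborel) \<le> ennreal c * mass f"
  shows "k y \<le> c"
proof (rule ccontr)
  assume "\<not> k y \<le> c"
  then obtain c' where c': "c < c'" "c' < k y" using dense[of c "k y"] by auto
  have "open {z. c' < k z}" using k by (intro open_Collect_less) auto
  from bump_near[OF this _ r, of y] c' obtain f where f: "f \<in> bcontfun" "\<And>z. 0 \<le> f z" "\<And>z. z \<notin> ball y r \<Longrightarrow> f z = 0"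
    "\<And>z. z \<notin> {z. c' < k z} \<Longrightarrow> f z = 0" "\<And>c c' :: real. 0 \<le> c' \<Longrightarrow> ennreal c * mass f \<le> ennreal c' * mass f \<Longrightarrow> c \<le> c'"
    by (metis mem_Collect_eq)
  have [measurable]: "f \<in> borel_measurable borel"
    using f(1) by (rule borel_measurable_bcontfun)
  have "ennreal c' * mass f = (\<integral>\<^sup>+z. ennreal c' * ennreal (f z) \<partial>lborel)"
    by (simp add: nn_integral_cmult)
  also have "\<dots> \<le> (\<integral>\<^sup>+z. ennreal (k z) * ennreal (f z) \<partial>lborel)"
  proof (intro nn_integral_mono)
    show "ennreal c' * ennreal (f z) \<le> ennreal (k z) * ennreal (f z)" for z
      using f(4)[of z] by (cases "c' < k z") (auto intro!: mult_right_mono ennreal_leI)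
  qed
  also have "\<dots> \<le> ennreal c * mass f" by (intro le f)
  finally have "c' \<le> c" by (rule f(5)[OF c])
  with c' show False by simp
qed

lemma ge_of_nn_integral_ge:
  fixes k :: "'a::euclidean_space \<Rightarrow> real"
  assumes k: "continuous_on UNIV k" "\<And>z. 0 \<le> k z" and r: "0 < r"
    and ge: "\<And>f. f \<in> bcontfun \<Longrightarrow> (\<And>z. 0 \<le> f z) \<Longrightarrow> (\<And>z. z \<notin> ball y r \<Longrightarrow> f z = 0) \<Longrightarrow>
      ennreal c * mass f \<le> (\<integral>\<^sup>+z. ennreal (k z) * ennreal (f z) \<partial>lborel)"
  shows "c \<le> k y"
proof (rule ccontr)
  assume "\<not> c \<le> k y"
  then obtain c' where c': "c' < c" "k y < c'" using dense[of "k y" c] by auto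
  have c'0: "0 \<le> c'" using k(2)[of y] c' by simp
  have "open {z. k z < c'}" using k by (intro open_Collect_less) auto
  from bump_near[OF this _ r, of y] c' obtain f where f: "f \<in> bcontfun" "\<And>z. 0 \<le> f z" "\<And>z. z \<notin> ball y r \<Longrightarrow> f z = 0"
    "\<And>z. z \<notin> {z. k z < c'} \<Longrightarrow> f z = 0" "\<And>c c' :: real. 0 \<le> c' \<Longrightarrow> ennreal c * mass f \<le> ennreal c' * mass f \<Longrightarrow> c \<le> c'"
    by (metis mem_Collect_eq)
  have [measurable]: "f \<in> borel_measurable borel"
    using f(1) by (rule borel_measurable_bcontfun)
  have "ennreal c * mass f \<le> (\<integral>\<^sup>+z. ennreal (k z) * ennreal (f z) \<partial>lborel)" by (intro ge f)
  also have "\<dots> \<le> (\<integral>\<^sup>+z. ennreal c' * ennreal (f z) \<partial>lborel)"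
  proof (intro nn_integral_mono)
    show "ennreal (k z) * ennreal (f z) \<le> ennreal c' * ennreal (f z)" for z
      using f(4)[of z] by (cases "k z < c'") (auto intro!: mult_right_mono ennreal_leI)
  qed
  also have "\<dots> = ennreal c' * mass f" by (simp add: nn_integral_cmult)
  finally have "c \<le> c'" by (rule f(5)[OF c'0])
  with c' show False by simp
qed

section \<open>Sampling the potential at equally spaced times with a random offset\<close>

context nonneg_potential
begin

abbreviation damp :: "real \<Rightarrow> 'a \<Rightarrow> ennreal" where
  "damp \<sigma> z \<equiv> ennreal (exp (- \<sigma> * V z))"

text \<open>The first sample is at time \<open>a + \<sigma> * \<theta>\<close> and \<open>N\<close>
  more follow, so there are \<open>Suc N\<close> windows; the last step, of weight 1, uses up the
  time that remains until \<open>t\<close>.\<close>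

abbreviation sample_steps :: "real \<Rightarrow> real \<Rightarrow> nat \<Rightarrow> real \<Rightarrow> real \<Rightarrow> (real \<times> ('a \<Rightarrow> ennreal)) list" where
  "sample_steps a \<sigma> N t \<theta> \<equiv> (a + \<sigma> * \<theta>, damp \<sigma>) # replicate N (\<sigma>, damp \<sigma>)
    @ [(t - a - \<sigma> * \<theta> - \<sigma> * real N, \<lambda>_. 1)]"

abbreviation sampled :: "real \<Rightarrow> real \<Rightarrow> nat \<Rightarrow> real \<Rightarrow> real \<Rightarrow> ('a \<Rightarrow> real) \<Rightarrow> 'a \<Rightarrow> ennreal" where
  "sampled a \<sigma> N t \<theta> f x \<equiv> gauss_chain (sample_steps a \<sigma> N t \<theta>) (\<lambda>z. ennreal (f z)) x"

lemma path_weight_replicate_damp: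
  "path_weight (replicate n (\<sigma>, damp \<sigma>) @ [(r, \<lambda>_. 1)]) f \<tau> X =
    ennreal (exp (- (\<Sum>k<n. \<sigma> * V (X (\<tau> + \<sigma> * real (Suc k)))))) * f (X (\<tau> + \<sigma> * real n + r))"
proof (induction n arbitrary: \<tau>)
  case (Suc n)
  have "path_weight (replicate (Suc n) (\<sigma>, damp \<sigma>) @ [(r, \<lambda>_. 1)]) f \<tau> X
    = ennreal (exp (- \<sigma> * V (X (\<tau> + \<sigma>)))) * (ennreal (exp (- (\<Sum>k<n. \<sigma> * V (X (\<tau> + \<sigma> + \<sigma> * real (Suc k)))))) * f (X (\<tau> + \<sigma> + \<sigma> * real n + r)))"
    using Suc by simp
  also have "\<dots> = ennreal (exp (- \<sigma> * V (X (\<tau> + \<sigma>))) * exp (- (\<Sum>k<n. \<sigma> * V (X (\<tau> + \<sigma> + \<sigma> * real (Suc k)))))) * f (X (\<tau> + \<sigma> + \<sigma> * real n + r))"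
    by (simp add: ennreal_mult mult.assoc)
  also have "exp (- \<sigma> * V (X (\<tau> + \<sigma>))) * exp (- (\<Sum>k<n. \<sigma> * V (X (\<tau> + \<sigma> + \<sigma> * real (Suc k)))))
     = exp (- (\<Sum>k<Suc n. \<sigma> * V (X (\<tau> + \<sigma> * real (Suc k)))))"
    unfolding sum.lessThan_Suc_shift by (simp add: mult_exp_exp algebra_simps)
  finally show ?case by (simp add: algebra_simps)
qed simp

text \<open>After \<open>exp_minus_integral_le_average\<close> and Tonelli, the expectation for a
  fixed offset involves finitely many times only and equals a Gaussian chain.\<close>

lemma semigroup_le_average:
  assumes f: "f \<in> bcontfun" "\<And>x. 0 \<le> f x"
    and a: "0 \<le> a" and \<sigma>: "0 < \<sigma>" and t: "a + \<sigma> * real (Suc N) \<le> t"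
  shows "ennreal (semigroup t f x) \<le>
    (\<integral>\<^sup>+\<theta>. indicator {0<..<1} \<theta> * sampled a \<sigma> N t \<theta> f x \<partial>lborel)"
proof -
  have t0: "0 \<le> t" using a \<sigma> t by (smt (verit) mult_nonneg_nonneg of_nat_0_le_iff)
  have [measurable]: "f \<in> borel_measurable borel"
    using f(1) by (rule borel_measurable_bcontfun)
  define G where "G \<theta> \<omega> = ennreal (exp (- (\<Sum>k<Suc N. \<sigma> * V (path x \<omega> (a + \<sigma> * real k + \<sigma> * \<theta>)))))" for \<theta> \<omega>
  have [measurable]: "(\<lambda>z. G (fst z) (snd z)) \<in> borel_measurable (lborel \<Otimes>\<^sub>M M)"
    unfolding G_def by measurable
  interpret pair_sigma_finite lborel M ..
  have "ennreal (semigroup t f x)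
    = (\<integral>\<^sup>+\<omega>. ennreal (f (path x \<omega> t)) * ennreal (exp (- action t x \<omega>)) \<partial>M)"
    by (rule semigroup_nn[OF t0 f])
  also have "\<dots> \<le> (\<integral>\<^sup>+\<omega>. ennreal (f (path x \<omega> t)) * (\<integral>\<^sup>+\<theta>. indicator {0<..<1} \<theta> * G \<theta> \<omega> \<partial>lborel) \<partial>M)"
  proof (intro nn_integral_mono mult_left_mono)
    fix \<omega> assume [measurable]: "\<omega> \<in> space M"
    show "ennreal (exp (- action t x \<omega>)) \<le> (\<integral>\<^sup>+\<theta>. indicator {0<..<1} \<theta> * G \<theta> \<omega> \<partial>lborel)"
      unfolding G_def
      using \<open>\<omega> \<in> space M\<close>
      by (intro exp_minus_integral_le_average[OF _ _ action_nn[symmetric] action_nonneg a \<sigma> t]) auto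
  qed simp
  also have "\<dots> = (\<integral>\<^sup>+\<omega>. (\<integral>\<^sup>+\<theta>. ennreal (f (path x \<omega> t)) * (indicator {0<..<1} \<theta> * G \<theta> \<omega>) \<partial>lborel) \<partial>M)"
  proof (intro nn_integral_cong nn_integral_cmult[symmetric])
    fix \<omega> assume [measurable]: "\<omega> \<in> space M"
    show "(\<lambda>\<theta>. indicator {0<..<1} \<theta> * G \<theta> \<omega>) \<in> borel_measurable lborel"
      unfolding G_def by measurable
  qed
  also have "\<dots> = (\<integral>\<^sup>+\<theta>. (\<integral>\<^sup>+\<omega>. ennreal (f (path x \<omega> t)) * (indicator {0<..<1} \<theta> * G \<theta> \<omega>) \<partial>M) \<partial>lborel)"
    by (rule Fubini') (simp add: split_beta', measurable)
  also have "\<dots> = (\<integral>\<^sup>+\<theta>. indicator {0<..<1} \<theta> * (\<integral>\<^sup>+\<omega>. G \<theta> \<omega> * ennreal (f (path x \<omega> t)) \<partial>M) \<partial>lborel)"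
  proof (intro nn_integral_cong)
    fix \<theta> :: real
    have [measurable]: "G \<theta> \<in> borel_measurable M" unfolding G_def by measurable
    show "(\<integral>\<^sup>+\<omega>. ennreal (f (path x \<omega> t)) * (indicator {0<..<1} \<theta> * G \<theta> \<omega>) \<partial>M) =
        indicator {0<..<1} \<theta> * (\<integral>\<^sup>+\<omega>. G \<theta> \<omega> * ennreal (f (path x \<omega> t)) \<partial>M)"
      by (subst nn_integral_cmult[symmetric]) (auto simp: mult_ac)
  qed
  also have "\<dots> = (\<integral>\<^sup>+\<theta>. indicator {0<..<1} \<theta> * sampled a \<sigma> N t \<theta> f x \<partial>lborel)"
  proof (intro nn_integral_cong)
    fix \<theta> :: real
    show "indicator {0<..<1} \<theta> * (\<integral>\<^sup>+\<omega>. G \<theta> \<omega> * ennreal (f (path x \<omega> t)) \<partial>M) =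
      indicator {0<..<1} \<theta> * sampled a \<sigma> N t \<theta> f x"
    \<comment> \<open>The open interval makes the first and the last step length positive even when
      \<open>a = 0\<close> or the windows end exactly at \<open>t\<close>.\<close>
    proof (cases "\<theta> \<in> {0<..<1}")
      case True
      then have \<theta>: "0 < \<theta>" "\<theta> < 1" by auto
      have "\<sigma> * \<theta> < \<sigma>" using \<sigma> \<theta> by simp
      then have r: "0 < t - a - \<sigma> * \<theta> - \<sigma> * real N" using t by (simp add: algebra_simps)
      have "0 < a + \<sigma> * \<theta>" using a \<sigma> \<theta> by (simp add: add_nonneg_pos)
      then have "sampled a \<sigma> N t \<theta> f x =
        (\<integral>\<^sup>+\<omega>. path_weight (sample_steps a \<sigma> N t \<theta>) (\<lambda>z. ennreal (f z)) 0 (path x \<omega>) \<partial>M)"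
        using r \<sigma> by (intro gauss_chain_eq_path_integral[symmetric]) auto
      also have "\<dots> = (\<integral>\<^sup>+\<omega>. G \<theta> \<omega> * ennreal (f (path x \<omega> t)) \<partial>M)"
      proof (intro nn_integral_cong)
        fix \<omega>
        let ?X = "path x \<omega>"
        have "a + \<sigma> * \<theta> + \<sigma> * real N + (t - a - \<sigma> * \<theta> - \<sigma> * real N) = t" by simp
        then have "path_weight (sample_steps a \<sigma> N t \<theta>) (\<lambda>z. ennreal (f z)) 0 ?X
          = ennreal (exp (- \<sigma> * V (?X (a + \<sigma> * \<theta>))) * exp (- (\<Sum>k<N. \<sigma> * V (?X (a + \<sigma> * \<theta> + \<sigma> * real (Suc k)))))) * ennreal (f (?X t))"
          unfolding path_weight.simps path_weight_replicate_damp by (simp add: ennreal_mult mult.assoc)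
        also have "exp (- \<sigma> * V (?X (a + \<sigma> * \<theta>))) * exp (- (\<Sum>k<N. \<sigma> * V (?X (a + \<sigma> * \<theta> + \<sigma> * real (Suc k)))))
          = exp (- (\<Sum>k<Suc N. \<sigma> * V (?X (a + \<sigma> * real k + \<sigma> * \<theta>))))"
          unfolding sum.lessThan_Suc_shift by (simp add: mult_exp_exp algebra_simps)
        finally show "path_weight (sample_steps a \<sigma> N t \<theta>) (\<lambda>z. ennreal (f z)) 0 ?X = G \<theta> \<omega> * ennreal (f (?X t))"
          by (simp add: G_def)
      qed
      finally show ?thesis by simp
    qed simp
  qed
  finally show ?thesis .
qed

text \<open>Inside the ball the potential supplies the factor \<open>exp (- \<sigma> * lam)\<close>.
  Outside, the damping is dropped and \<open>gauss_double\<close> supplies the decay;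
  \<open>s \<le> \<sigma>\<close> makes it uniform in \<open>s\<close>.\<close>

lemma nn_integral_gauss_damp_le:
  assumes s: "0 < s" "s \<le> \<sigma>" and R: "0 < R" and lb: "\<And>z. z \<in> ball x R \<Longrightarrow> lam \<le> V z"
  shows "(\<integral>\<^sup>+z. ennreal (gauss s (z - x)) * damp \<sigma> z \<partial>lborel)
    \<le> ennreal (exp (- \<sigma> * lam) + 2 powr (real DIM('a) / 2) * exp (- R\<^sup>2 / (4 * \<sigma>)))"
proof -
  let ?K = "2 powr (real DIM('a) / 2) * exp (- R\<^sup>2 / (4 * \<sigma>))"
  have pt: "gauss s (z - x) * exp (- \<sigma> * V z) \<le> exp (- \<sigma> * lam) * gauss s (z - x) + ?K * gauss (2 * s) (z - x)" for z
  proof (cases "z \<in> ball x R")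
    case True
    then have "gauss s (z - x) * exp (- \<sigma> * V z) \<le> gauss s (z - x) * exp (- \<sigma> * lam)"
      using lb s by (intro mult_left_mono) auto
    moreover have "0 \<le> ?K * gauss (2 * s) (z - x)" by simp
    ultimately show ?thesis unfolding mult.commute[of "exp (- \<sigma> * lam)"] by linarith
  next
    case False
    then have n: "R \<le> norm (z - x)" by (simp add: dist_norm norm_minus_commute)
    have "R\<^sup>2 / (4 * \<sigma>) \<le> (norm (z - x))\<^sup>2 / (4 * s)"
      using n R s by (intro frac_le power_mono) auto
    then have "gauss s (z - x) \<le> ?K * gauss (2 * s) (z - x)"
      unfolding gauss_double[OF s(1)] by (intro mult_right_mono mult_left_mono) auto
    moreover have "gauss s (z - x) * exp (- \<sigma> * V z) \<le> gauss s (z - x) * 1"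
      using s by (intro mult_left_mono) auto
    moreover have "0 \<le> exp (- \<sigma> * lam) * gauss s (z - x)" by simp
    ultimately show ?thesis by linarith
  qed
  have "(\<integral>\<^sup>+z. ennreal (gauss s (z - x)) * damp \<sigma> z \<partial>lborel)
    \<le> (\<integral>\<^sup>+z. ennreal (exp (- \<sigma> * lam)) * ennreal (gauss s (z - x)) + ennreal ?K * ennreal (gauss (2 * s) (z - x)) \<partial>lborel)"
  proof (intro nn_integral_mono)
    fix z
    show "ennreal (gauss s (z - x)) * damp \<sigma> z \<le>
      ennreal (exp (- \<sigma> * lam)) * ennreal (gauss s (z - x)) + ennreal ?K * ennreal (gauss (2 * s) (z - x))"
      using ennreal_leI[OF pt[of z]] by (simp add: ennreal_mult ennreal_plus del: mult_minus_left)
  qed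
  also have "\<dots> = ennreal (exp (- \<sigma> * lam)) + ennreal ?K"
    using s by (simp add: nn_integral_add nn_integral_cmult nn_integral_gauss)
  also have "\<dots> = ennreal (exp (- \<sigma> * lam) + ?K)" by (simp add: ennreal_plus)
  finally show ?thesis .
qed

end

section \<open>Gaussian bound, decay off a ball, and exponential decay in time\<close>

locale schroedinger_kernel = nonneg_potential M B V
  for M :: "'w measure" and B :: "real \<Rightarrow> 'w \<Rightarrow> 'a::euclidean_space" and V :: "'a \<Rightarrow> real" +
  fixes p :: "real \<Rightarrow> 'a \<Rightarrow> 'a \<Rightarrow> real"
  assumes heat_kernel: "heat_kernel M B V p"
begin

lemma kernel_nonneg: "0 < t \<Longrightarrow> 0 \<le> p t x y"
  using heat_kernel by (auto simp: heat_kernel_def)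

lemma continuous_on_kernel:
  assumes "0 < t" shows "continuous_on UNIV (p t x)"
proof -
  have "continuous_on UNIV ((\<lambda>(t, x, y). p t x y) \<circ> (\<lambda>y. (t, x, y)))"
    using heat_kernel assms unfolding heat_kernel_def
    by (intro continuous_on_compose continuous_intros) (auto elim!: continuous_on_subset)
  then show ?thesis by (simp add: o_def)
qed

lemma semigroup_eq_nn_integral_kernel:
  assumes "0 < t" "f \<in> bcontfun" "\<And>z. 0 \<le> f z"
  shows "ennreal (semigroup t f x) = (\<integral>\<^sup>+z. ennreal (p t x z) * ennreal (f z) \<partial>lborel)"
proof -
  have "has_bochner_integral lborel (\<lambda>z. p t x z * f z) (semigroup t f x)"
    using heat_kernel assms unfolding heat_kernel_def by blast
  then have "(\<integral>\<^sup>+z. ennreal (p t x z * f z) \<partial>lborel) = ennreal (semigroup t f x)"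
    using kernel_nonneg[OF assms(1)] assms(3)
    by (subst nn_integral_eq_integral) (auto simp: has_bochner_integral_iff)
  then show ?thesis
    using kernel_nonneg[OF assms(1)] assms(3) by (simp add: ennreal_mult)
qed

lemma kernel_leI:
  assumes "0 < t" "0 \<le> c" "0 < r"
    and "\<And>f. f \<in> bcontfun \<Longrightarrow> (\<And>z. 0 \<le> f z) \<Longrightarrow> (\<And>z. z \<notin> ball y r \<Longrightarrow> f z = 0) \<Longrightarrow>
      ennreal (semigroup t f x) \<le> ennreal c * mass f"
  shows "p t x y \<le> c"
  by (rule le_of_nn_integral_le[OF continuous_on_kernel assms(2,3)])
    (use assms semigroup_eq_nn_integral_kernel in auto)

lemma kernel_geI:
  assumes "0 < t" "0 < r"
    and "\<And>f. f \<in> bcontfun \<Longrightarrow> (\<And>z. 0 \<le> f z) \<Longrightarrow> (\<And>z. z \<notin> ball y r \<Longrightarrow> f z = 0) \<Longrightarrow>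
      ennreal c * mass f \<le> ennreal (semigroup t f x)"
  shows "c \<le> p t x y"
  by (rule ge_of_nn_integral_ge[OF continuous_on_kernel _ assms(2)])
    (use assms semigroup_eq_nn_integral_kernel kernel_nonneg in auto)

text \<open>The case of a single window: it suffices to bound, uniformly over the sampling time in
  the window, the integral pinned at \<open>x\<close> and at endpoints close to
  \<open>y\<close>.\<close>

lemma kernel_le_window:
  assumes a: "0 \<le> a" and \<sigma>: "0 < \<sigma>" "a + \<sigma> \<le> t" and c: "0 \<le> c" and r: "0 < r"
    and le: "\<And>s w. a < s \<Longrightarrow> s < a + \<sigma> \<Longrightarrow> w \<in> ball y r \<Longrightarrow> mid_integral s (t - s) (damp \<sigma>) x w \<le> ennreal c"
  shows "p t x y \<le> c"
proof (rule kernel_leI[OF _ c r])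
  show "0 < t" using a \<sigma> by simp
  fix f :: "'a \<Rightarrow> real" assume f: "f \<in> bcontfun" "\<And>z. 0 \<le> f z" "\<And>z. z \<notin> ball y r \<Longrightarrow> f z = 0"
  have [measurable]: "f \<in> borel_measurable borel"
    using f(1) by (rule borel_measurable_bcontfun)
  have "ennreal (semigroup t f x) \<le> (\<integral>\<^sup>+\<theta>. indicator {0<..<1} \<theta> * sampled a \<sigma> 0 t \<theta> f x \<partial>lborel)"
    using a \<sigma> by (intro semigroup_le_average f) auto
  also have "\<dots> \<le> ennreal c * mass f"
  proof (rule nn_integral_unit_interval_le)
    fix \<theta> :: real assume \<theta>: "0 < \<theta>" "\<theta> < 1"
    define s where "s = a + \<sigma> * \<theta>"
    have s: "a < s" "s < a + \<sigma>" using \<theta> \<sigma> by (auto simp: s_def)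
    have ts: "t - a - \<sigma> * \<theta> - \<sigma> * real 0 = t - s" by (simp add: s_def)
    have "sampled a \<sigma> 0 t \<theta> f x = (\<integral>\<^sup>+z. ennreal (gauss s (z - x)) * (damp \<sigma> z *
        (\<integral>\<^sup>+w. ennreal (gauss (t - s) (w - z)) * ennreal (f w) \<partial>lborel)) \<partial>lborel)"
      unfolding ts s_def[symmetric] by simp
    also have "\<dots> = (\<integral>\<^sup>+w. mid_integral s (t - s) (damp \<sigma>) x w * ennreal (f w) \<partial>lborel)"
      by (rule nn_integral_two_steps) measurable
    also have "\<dots> \<le> (\<integral>\<^sup>+w. ennreal c * ennreal (f w) \<partial>lborel)"
    proof (intro nn_integral_mono)
      fix w
      show "mid_integral s (t - s) (damp \<sigma>) x w * ennreal (f w) \<le> ennreal c * ennreal (f w)"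
      proof (cases "w \<in> ball y r")
        case True
        from le[OF s this] show ?thesis by (rule mult_right_mono) simp
      qed (simp add: f(3))
    qed
    also have "\<dots> = ennreal c * mass f" by (simp add: nn_integral_cmult)
    finally show "sampled a \<sigma> 0 t \<theta> f x \<le> ennreal c * mass f" .
  qed
  finally show "ennreal (semigroup t f x) \<le> ennreal c * mass f" .
qed

text \<open>Bounding \<open>damp\<close> by 1 leaves the free density by
  \<open>gauss_bridge\<close>, but at endpoints \<open>w\<close> near \<open>y\<close>. Any
  \<open>c\<close> above \<open>gauss t (y - x)\<close> still dominates it on a small ball, which is
  why the proof argues by density of the order.\<close>

lemma kernel_le_gauss:
  assumes t: "0 < t" shows "p t x y \<le> gauss t (y - x)"
proof (rule dense_ge)
  fix c assume c: "gauss t (y - x) < c"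
  have "open {z. gauss t (z - x) < c}" by (intro open_Collect_less continuous_intros)
  then obtain r where r: "0 < r" "ball y r \<subseteq> {z. gauss t (z - x) < c}"
    using c open_contains_ball[of "{z. gauss t (z - x) < c}"] by auto
  show "p t x y \<le> c"
  proof (rule kernel_le_window[of 0 t])
    show "0 \<le> c" using c gauss_nonneg[of t "y - x"] by linarith
    fix s w assume s: "0 < s" "s < 0 + t" and w: "w \<in> ball y r"
    define m where "m = ((t - s) / t) *\<^sub>R x + (s / t) *\<^sub>R w"
    have "mid_integral s (t - s) (damp t) x w \<le> (\<integral>\<^sup>+z. ennreal (gauss t (w - x)) * ennreal (gauss (s * (t - s) / t) (z - m)) \<partial>lborel)"
    proof (intro nn_integral_mono)
      fix z
      have "ennreal (gauss s (z - x)) * damp t z * ennreal (gauss (t - s) (w - z))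
        \<le> ennreal (gauss s (z - x)) * 1 * ennreal (gauss (t - s) (w - z))"
        using t by (intro mult_right_mono mult_left_mono) (auto simp: ennreal_le_1)
      also have "\<dots> = ennreal (gauss t (w - x)) * ennreal (gauss (s * (t - s) / t) (z - m))"
        using gauss_bridge[of s "t - s" z x w] s by (simp add: m_def ennreal_mult[symmetric])
      finally show "ennreal (gauss s (z - x)) * damp t z * ennreal (gauss (t - s) (w - z))
        \<le> ennreal (gauss t (w - x)) * ennreal (gauss (s * (t - s) / t) (z - m))" .
    qed
    also have "\<dots> = ennreal (gauss t (w - x))" using s by (simp add: nn_integral_cmult nn_integral_gauss)
    also have "\<dots> \<le> ennreal c" using r(2) w by (intro ennreal_leI) auto
    finally show "mid_integral s (t - s) (damp t) x w \<le> ennreal c" .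
  qed (use t r in auto)
qed

text \<open>The window lies at the end of \<open>{0..t}\<close> belonging to \<open>v\<close>. The
  other factor of the bridge integral then has duration at least \<open>t / 2\<close> and is bounded
  by its maximum, leaving the one-sided integral of
  \<open>nn_integral_gauss_damp_le\<close>.\<close>

lemma kernel_le_off_ball:
  assumes v: "v \<in> {x, y}" and \<sigma>: "0 < \<sigma>" "2 * \<sigma> \<le> t" and R: "0 < R" and lb: "\<And>z. z \<in> ball v R \<Longrightarrow> lam \<le> V z"
  shows "p t x y \<le> (pi * t) powr (- real DIM('a) / 2)
    * (exp (- \<sigma> * lam) + 2 powr (real DIM('a) / 2) * exp (- R\<^sup>2 / (16 * \<sigma>)))" (is "_ \<le> ?K * ?e")
proof -
  have K: "?K = (2 * pi * (t / 2)) powr (- real DIM('a) / 2)" by simp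
  have nn: "0 \<le> ?K * ?e" by (intro mult_nonneg_nonneg add_nonneg_nonneg) auto
  \<comment> \<open>When \<open>v = y\<close> the endpoint \<open>w\<close> varies, so half of the
    radius is reserved for its distance from \<open>v\<close>; this turns
    \<open>4 * \<sigma>\<close> into \<open>16 * \<sigma>\<close>.\<close>
  have near: "(\<integral>\<^sup>+z. ennreal (gauss s (z - w)) * damp \<sigma> z \<partial>lborel) \<le> ennreal ?e"
    if s: "0 < s" "s \<le> \<sigma>" and w: "w \<in> ball v (R / 2)" for s w
  proof -
    have "(\<integral>\<^sup>+z. ennreal (gauss s (z - w)) * damp \<sigma> z \<partial>lborel) \<le>
      ennreal (exp (- \<sigma> * lam) + 2 powr (real DIM('a) / 2) * exp (- (R / 2)\<^sup>2 / (4 * \<sigma>)))"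
    proof (intro nn_integral_gauss_damp_le s lb)
      fix z assume "z \<in> ball w (R / 2)"
      with w show "z \<in> ball v R" using dist_triangle[of v z w] by auto
    qed (use R in auto)
    also have "- (R / 2)\<^sup>2 / (4 * \<sigma>) = - R\<^sup>2 / (16 * \<sigma>)" by (simp add: power_divide)
    finally show ?thesis .
  qed
  have ke: "ennreal (?K * ?e) = ennreal ?K * ennreal ?e"
    by (intro ennreal_mult add_nonneg_nonneg) auto
  show ?thesis
  proof (cases "v = x")
    case True
    show ?thesis
    proof (rule kernel_le_window[of 0 \<sigma> t _ 1])
      fix s w assume s: "0 < s" "s < 0 + \<sigma>"
      have "mid_integral s (t - s) (damp \<sigma>) x w \<le> (\<integral>\<^sup>+z. ennreal (gauss s (z - x)) * damp \<sigma> z * ennreal ?K \<partial>lborel)"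
        unfolding K using s \<sigma> by (intro nn_integral_mono mult_left_mono ennreal_leI gauss_le) auto
      also have "\<dots> = (\<integral>\<^sup>+z. ennreal (gauss s (z - x)) * damp \<sigma> z \<partial>lborel) * ennreal ?K"
        by (intro nn_integral_multc) measurable
      also have "\<dots> \<le> ennreal ?e * ennreal ?K" using s R True by (intro mult_right_mono near) auto
      finally show "mid_integral s (t - s) (damp \<sigma>) x w \<le> ennreal (?K * ?e)" unfolding ke by (simp only: mult.commute)
    qed (use \<sigma> nn in auto)
  next
    case False
    then have vy: "v = y" using v by simp
    show ?thesis
    proof (rule kernel_le_window[of "t - \<sigma>" \<sigma> t _ "R / 2"])
      fix s w assume s: "t - \<sigma> < s" "s < t - \<sigma> + \<sigma>" and w: "w \<in> ball y (R / 2)"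
      have "mid_integral s (t - s) (damp \<sigma>) x w \<le> (\<integral>\<^sup>+z. ennreal ?K * (ennreal (gauss (t - s) (z - w)) * damp \<sigma> z) \<partial>lborel)"
      proof (intro nn_integral_mono)
        fix z
        have "gauss s (z - x) \<le> ?K" unfolding K using s \<sigma> by (intro gauss_le) auto
        then have "ennreal (gauss s (z - x)) * (ennreal (gauss (t - s) (z - w)) * damp \<sigma> z) \<le> ennreal ?K * (ennreal (gauss (t - s) (z - w)) * damp \<sigma> z)"
          by (intro mult_right_mono ennreal_leI) auto
        then show "ennreal (gauss s (z - x)) * damp \<sigma> z * ennreal (gauss (t - s) (w - z))
          \<le> ennreal ?K * (ennreal (gauss (t - s) (z - w)) * damp \<sigma> z)"
          unfolding gauss_minus_commute[of _ w z] by (simp only: mult_ac)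
      qed
      also have "\<dots> = ennreal ?K * (\<integral>\<^sup>+z. ennreal (gauss (t - s) (z - w)) * damp \<sigma> z \<partial>lborel)"
        by (intro nn_integral_cmult) measurable
      also have "\<dots> \<le> ennreal ?K * ennreal ?e" using s w vy by (intro mult_left_mono near) auto
      finally show "mid_integral s (t - s) (damp \<sigma>) x w \<le> ennreal (?K * ?e)" unfolding ke .
    qed (use \<sigma> R nn in auto)
  qed
qed

text \<open>From every \<open>x\<close>, a fixed amount \<open>\<kappa> * unit_ball_vol\<close> of
  Gaussian mass at time 1 lies in some unit ball avoiding the unit ball around 0. There the damping
  removes at least the fraction \<open>1 - exp (- v)\<close>.\<close>

lemma nn_integral_gauss_damp_le_const:
  assumes v: "0 < v" "\<And>z. 1 < norm z \<Longrightarrow> v \<le> V z"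
  obtains q where "0 < q" "q < 1" "\<And>x. (\<integral>\<^sup>+z. ennreal (gauss 1 (z - x)) * damp 1 z \<partial>lborel) \<le> ennreal q"
proof -
  define \<kappa> where "\<kappa> = (2 * pi) powr (- real DIM('a) / 2) * exp (- 49 / 2)"
  define \<beta> where "\<beta> = (1 - exp (- v)) * \<kappa> * unit_ball_vol (real DIM('a))"
  have \<kappa>: "0 < \<kappa>" by (simp add: \<kappa>_def)
  have ev: "0 < 1 - exp (- v)" using v by simp
  have \<beta>: "0 < \<beta>" using \<kappa> ev by (simp add: \<beta>_def)
  obtain b :: 'a where b: "b \<in> Basis" by (metis nonempty_Basis ex_in_conv)
  have le: "(\<integral>\<^sup>+z. ennreal (gauss 1 (z - x)) * damp 1 z \<partial>lborel) + ennreal \<beta> \<le> 1" for x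
  proof -
    \<comment> \<open>The centre has norm at least 3, so its unit ball stays where
      \<open>V \<ge> v\<close>. Its distance from \<open>x\<close> is at most 6, so all points of
      that ball are within 7 of \<open>x\<close>; this is the 49 in \<open>\<kappa>\<close>.\<close>
    define c where "c = (if norm x > 3 then x else 3 *\<^sub>R b)"
    have c: "3 \<le> norm c" "norm (c - x) \<le> 6"
      using b norm_triangle_ineq4[of c x] by (auto simp: c_def norm_Basis)
    have pt: "gauss 1 (z - x) * exp (- V z) + (1 - exp (- v)) * \<kappa> * indicator (ball c 1) z \<le> gauss 1 (z - x)" for z
    proof (cases "z \<in> ball c 1")
      case True
      then have d: "norm (c - z) < 1" by (simp add: dist_norm)
      have n1: "1 < norm z" using c(1) d norm_triangle_ineq2[of c z] by linarith
      have n2: "norm (z - x) \<le> 7"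
        using c(2) d norm_triangle_ineq[of "z - c" "c - x"] by (simp add: norm_minus_commute)
      then have "(norm (z - x))\<^sup>2 \<le> 49" using power_mono[OF n2, of 2] by simp
      then have g: "\<kappa> \<le> gauss 1 (z - x)"
        unfolding \<kappa>_def gauss_def by (simp add: mult_left_mono)
      have "gauss 1 (z - x) * exp (- V z) \<le> gauss 1 (z - x) * exp (- v)"
        using v(2)[OF n1] by (intro mult_left_mono) auto
      moreover have "(1 - exp (- v)) * \<kappa> \<le> (1 - exp (- v)) * gauss 1 (z - x)"
        using g ev by (intro mult_left_mono) auto
      ultimately show ?thesis using True by (simp add: algebra_simps)
    next
      case False
      have "gauss 1 (z - x) * exp (- V z) \<le> gauss 1 (z - x) * 1" by (intro mult_left_mono) auto
      with False show ?thesis by simp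
    qed
    have "ennreal \<beta> = ennreal ((1 - exp (- v)) * \<kappa>) * emeasure lborel (ball c 1)"
      using ev \<kappa> by (simp add: \<beta>_def emeasure_ball ennreal_mult)
    also have "\<dots> = (\<integral>\<^sup>+z. ennreal ((1 - exp (- v)) * \<kappa>) * indicator (ball c 1) z \<partial>lborel)"
      by (simp add: nn_integral_cmult_indicator)
    finally have "(\<integral>\<^sup>+z. ennreal (gauss 1 (z - x)) * damp 1 z \<partial>lborel) + ennreal \<beta> =
        (\<integral>\<^sup>+z. ennreal (gauss 1 (z - x)) * damp 1 z \<partial>lborel) + (\<integral>\<^sup>+z. ennreal ((1 - exp (- v)) * \<kappa>) * indicator (ball c 1) z \<partial>lborel)"
      by simp
    also have "\<dots> = (\<integral>\<^sup>+z. ennreal (gauss 1 (z - x)) * damp 1 z + ennreal ((1 - exp (- v)) * \<kappa>) * indicator (ball c 1) z \<partial>lborel)"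
      by (intro nn_integral_add[symmetric] borel_measurable_times_ennreal borel_measurable_const
          borel_measurable_indicator) auto
    also have "\<dots> \<le> (\<integral>\<^sup>+z. ennreal (gauss 1 (z - x)) \<partial>lborel)"
    proof (intro nn_integral_mono)
      fix z
      have "ennreal (gauss 1 (z - x)) * damp 1 z + ennreal ((1 - exp (- v)) * \<kappa>) * indicator (ball c 1) z
        = ennreal (gauss 1 (z - x) * exp (- V z) + (1 - exp (- v)) * \<kappa> * indicator (ball c 1) z)"
        using ev \<kappa> by (auto simp: ennreal_plus ennreal_mult indicator_def)
      also have "\<dots> \<le> ennreal (gauss 1 (z - x))" by (intro ennreal_leI pt)
      finally show "ennreal (gauss 1 (z - x)) * damp 1 z + ennreal ((1 - exp (- v)) * \<kappa>) * indicator (ball c 1) z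
        \<le> ennreal (gauss 1 (z - x))" .
    qed
    also have "\<dots> = 1" by (intro nn_integral_gauss) simp
    finally show ?thesis .
  qed
  show ?thesis
  proof
    \<comment> \<open>The maximum with \<open>1 / 2\<close> keeps \<open>q\<close> positive, so that
      \<open>ln q\<close> can serve as a rate.\<close>
    define q where "q = max (1 - \<beta>) (1 / 2)"
    show "0 < q" "q < 1" using \<beta> by (auto simp: q_def)
    fix x
    obtain I where I: "(\<integral>\<^sup>+z. ennreal (gauss 1 (z - x)) * damp 1 z \<partial>lborel) = ennreal I" "0 \<le> I"
      using le[of x] by (cases "\<integral>\<^sup>+z. ennreal (gauss 1 (z - x)) * damp 1 z \<partial>lborel") (auto simp: top_unique)
    have "ennreal (I + \<beta>) \<le> ennreal 1" using le[of x] I \<beta> by (simp add: ennreal_plus)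
    then have "I + \<beta> \<le> 1" by (subst (asm) ennreal_le_iff) auto
    then have "I \<le> q" by (simp add: q_def)
    then show "(\<integral>\<^sup>+z. ennreal (gauss 1 (z - x)) * damp 1 z \<partial>lborel) \<le> ennreal q"
      unfolding I by (rule ennreal_leI)
  qed
qed

text \<open>Each of the \<open>N\<close> unit steps contributes a factor \<open>q\<close>, uniformly
  in its starting point, so the factors multiply along the chain.\<close>

lemma kernel_le_exp_decay:
  assumes v: "0 < v" "\<And>z. 1 < norm z \<Longrightarrow> v \<le> V z"
  obtains C c where "0 < C" "0 < c" "\<And>t x y. 2 \<le> t \<Longrightarrow> p t x y \<le> C * exp (- c * t)"
proof -
  from nn_integral_gauss_damp_le_const[OF v] obtain q where
    q: "0 < q" "q < 1" "\<And>x. (\<integral>\<^sup>+z. ennreal (gauss 1 (z - x)) * damp 1 z \<partial>lborel) \<le> ennreal q"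
    by metis
  let ?K = "(2 * pi) powr (- real DIM('a) / 2)"
  \<comment> \<open>After the offset \<open>\<theta> < 1\<close> and \<open>N\<close> unit steps,
    time at least 1 is left, hence the last density is bounded by a constant.\<close>
  have main: "p t x y \<le> ?K * q ^ N" if N: "real (Suc (Suc N)) \<le> t" for t x y N
  proof (rule kernel_leI[where r = 1])
    show "0 < t" using N by linarith
    show "0 \<le> ?K * q ^ N" using q by simp
    fix f :: "'a \<Rightarrow> real" assume f: "f \<in> bcontfun" "\<And>z. 0 \<le> f z"
    have [measurable]: "f \<in> borel_measurable borel"
      using f(1) by (rule borel_measurable_bcontfun)
    have "ennreal (semigroup t f x) \<le>
      (\<integral>\<^sup>+\<theta>. indicator {0<..<1} \<theta> * sampled 0 1 N t \<theta> f x \<partial>lborel)"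
      using N by (intro semigroup_le_average f) auto
    also have "\<dots> \<le> ennreal (q ^ N) * (ennreal ?K * mass f)"
    proof (rule nn_integral_unit_interval_le)
      fix \<theta> :: real assume \<theta>: "0 < \<theta>" "\<theta> < 1"
      have ch: "gauss_chain (replicate n (1, damp 1) @ [(t - 0 - 1 * \<theta> - 1 * real N, \<lambda>_. 1)]) (\<lambda>z. ennreal (f z)) w
        \<le> ennreal (q ^ n) * (ennreal ?K * mass f)" for n w
      proof (induction n arbitrary: w)
        case 0
        have "(\<integral>\<^sup>+z. ennreal (gauss (t - \<theta> - real N) (z - w)) * ennreal (f z) \<partial>lborel)
          \<le> ennreal ((2 * pi * 1) powr (- real DIM('a) / 2)) * mass f"
          using N \<theta> by (intro nn_integral_gauss_mult_le) auto
        then show ?case by simp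
      next
        case (Suc n)
        have "gauss_chain (replicate (Suc n) (1, damp 1) @ [(t - 0 - 1 * \<theta> - 1 * real N, \<lambda>_. 1)]) (\<lambda>z. ennreal (f z)) w
          \<le> (\<integral>\<^sup>+z. (ennreal (gauss 1 (z - w)) * damp 1 z) * (ennreal (q ^ n) * (ennreal ?K * mass f)) \<partial>lborel)"
          unfolding replicate_Suc append_Cons gauss_chain.simps fst_conv snd_conv mult.assoc
          by (intro nn_integral_mono mult_left_mono Suc) auto
        also have "\<dots> = (\<integral>\<^sup>+z. (ennreal (gauss 1 (z - w)) * damp 1 z) \<partial>lborel) * (ennreal (q ^ n) * (ennreal ?K * mass f))"
          by (intro nn_integral_multc) measurable
        also have "\<dots> \<le> ennreal q * (ennreal (q ^ n) * (ennreal ?K * mass f))"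
          by (intro mult_right_mono q) simp
        finally show ?case using q by (simp add: ennreal_mult mult.assoc)
      qed
      \<comment> \<open>The initial step has length \<open>\<theta>\<close>, not 1, so its damping
        is only bounded by 1 and yields no factor \<open>q\<close>.\<close>
      have "sampled 0 1 N t \<theta> f x
        \<le> (\<integral>\<^sup>+z. ennreal (gauss (1 * \<theta>) (z - x)) * (1 * (ennreal (q ^ N) * (ennreal ?K * mass f))) \<partial>lborel)"
        unfolding append_Cons gauss_chain.simps fst_conv snd_conv add_0
          by (intro nn_integral_mono mult_left_mono mult_mono ch) (auto simp: ennreal_le_1)
      also have "\<dots> = ennreal (q ^ N) * (ennreal ?K * mass f)"
        using \<theta> by (subst nn_integral_multc) (auto simp: nn_integral_gauss)
      finally show "sampled 0 1 N t \<theta> f x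
        \<le> ennreal (q ^ N) * (ennreal ?K * mass f)" .
    qed
    also have "\<dots> = ennreal (?K * q ^ N) * mass f"
      using q by (simp add: ennreal_mult mult_ac)
    finally show "ennreal (semigroup t f x) \<le> ennreal (?K * q ^ N) * mass f" .
  qed simp
  show ?thesis
  proof
    show "0 < ?K * exp (3 * - ln q)" "0 < - ln q" using q by auto
    fix t x y assume t: "(2::real) \<le> t"
    define N where "N = nat \<lfloor>t\<rfloor> - 2"
    have "2 \<le> \<lfloor>t\<rfloor>" using t by linarith
    then have N: "real (Suc (Suc N)) \<le> t" "t - 3 \<le> real N" unfolding N_def by linarith+
    have "q ^ N = exp (real N * ln q)" using q by (simp add: exp_of_nat_mult)
    also have "\<dots> \<le> exp ((t - 3) * ln q)"
      using q N(2) by (simp add: mult_right_mono_neg)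
    also have "\<dots> = exp (3 * - ln q) * exp (- (- ln q) * t)"
      by (simp add: mult_exp_exp algebra_simps)
    finally have "?K * q ^ N \<le> ?K * (exp (3 * - ln q) * exp (- (- ln q) * t))"
      by (intro mult_left_mono) auto
    from order_trans[OF main[OF N(1), of x y] this]
    show "p t x y \<le> ?K * exp (3 * - ln q) * exp (- (- ln q) * t)"
      by (simp only: mult.assoc)
  qed
qed

end

section \<open>Combining the upper bounds\<close>

text \<open>Here \<open>a\<close>, \<open>b\<close> stand for the smaller and larger norm and
  \<open>D\<close> for the distance. Short time makes \<open>t * g a\<close> at most
  \<open>C0\<close> times \<open>(1 + a) * sqrt (g a)\<close>, so either value of the minimum
  controls it. For the mixed term, if the minimum at \<open>b\<close> is \<open>t * g b\<close>, the
  arithmetic-geometric inequality with \<open>D\<^sup>2 / t\<close> suffices; otherwise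
  \<open>D \<le> 2 * (1 + b)\<close> does.\<close>

lemma short_time_exponent_le:
  fixes g :: "real \<Rightarrow> real"
  assumes a: "0 \<le> a" "a \<le> b" and D: "0 \<le> D" "D \<le> a + b"
    and g: "1 \<le> g a" "1 \<le> g b" and t: "0 < t" "t \<le> C0 * ((1 + a) / sqrt (g a))" and C0: "0 < C0"
    and m: "D\<^sup>2 / t \<le> m" "min (t * g a) ((1 + a) * sqrt (g a)) \<le> m" "min (t * g b) ((1 + b) * sqrt (g b)) \<le> m"
  shows "D\<^sup>2 / t + t * g a + D * sqrt (g b) \<le> (4 + C0) * m"
proof -
  have m0: "0 \<le> m" using m(1) t by (meson divide_nonneg_pos order_trans zero_le_power2)
  have sa: "sqrt (g a) * sqrt (g a) = g a" "0 < sqrt (g a)" using g by auto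
  have sb: "sqrt (g b) * sqrt (g b) = g b" "0 < sqrt (g b)" using g by auto
  have "t * g a \<le> C0 * ((1 + a) * sqrt (g a))"
  proof -
    have "t * g a \<le> C0 * ((1 + a) / sqrt (g a)) * (sqrt (g a) * sqrt (g a))"
      unfolding sa(1) using t g by (intro mult_right_mono) auto
    also have "\<dots> = C0 * ((1 + a) * sqrt (g a))" using sa(2) by (simp add: field_simps)
    finally show ?thesis .
  qed
  moreover have "C0 * ((1 + a) * sqrt (g a)) \<le> C0 * m" if "(1 + a) * sqrt (g a) \<le> m"
    using that C0 by simp
  moreover have "0 \<le> C0 * m" using C0 m0 by simp
  ultimately have 2: "t * g a \<le> (1 + C0) * m"
    using m(2) m0 by (auto simp: min_def algebra_simps split: if_splits)
  have 3: "D * sqrt (g b) \<le> 2 * m"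
  proof (cases "t * g b \<le> (1 + b) * sqrt (g b)")
    case True
    then have *: "t * g b \<le> m" using m(3) by (simp add: min_def)
    have "D * sqrt (g b) * (2 * t) \<le> D * D + (t * sqrt (g b)) * (t * sqrt (g b))"
      using sum_squares_bound[of D "t * sqrt (g b)"] by (simp add: power2_eq_square algebra_simps)
    also have "\<dots> = (D\<^sup>2 / t + t * g b) * t"
    proof -
      have "(t * sqrt (g b)) * (t * sqrt (g b)) = t * t * g b" using sb(1) by (simp add: mult.assoc mult.left_commute)
      then show ?thesis using t by (simp add: distrib_right power2_eq_square)
    qed
    also have "\<dots> \<le> (m + m) * t" using m(1) * t by (intro mult_right_mono) auto
    finally have "D * sqrt (g b) * (2 * t) \<le> m * (2 * t)" by (simp add: algebra_simps)
    then have "D * sqrt (g b) \<le> m" using t by (subst (asm) mult_le_cancel_right) auto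
    then show ?thesis using m0 by simp
  next
    case False
    then have *: "(1 + b) * sqrt (g b) \<le> m" using m(3) by (simp add: min_def)
    have "D * sqrt (g b) \<le> (2 * (1 + b)) * sqrt (g b)" using D a sb by (intro mult_right_mono) auto
    then show ?thesis using * unfolding mult.assoc by linarith
  qed
  show ?thesis using m(1) 2 3 by (simp add: algebra_simps)
qed

text \<open>Long time makes \<open>(1 + a) * sqrt (g a)\<close> at most \<open>t * g a / C0\<close>,
  so the minimum at \<open>a\<close> controls it, and then also \<open>(1 + a)\<^sup>2 / t\<close>.
  The bound on \<open>1 / t\<close> serves to absorb the prefactor \<open>t^(-d/2)\<close>.\<close>

lemma long_time_exponent_le:
  fixes g :: "real \<Rightarrow> real"
  assumes a: "0 \<le> a" "a \<le> b" and D: "b - a \<le> D"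
    and g: "1 \<le> g a" "1 \<le> g b" and K: "1 \<le> K" "b \<le> 2 * a + 1 \<Longrightarrow> g b \<le> K * g a"
    and C0: "0 < C0" and t: "C0 * ((1 + a) / sqrt (g a)) \<le> t"
    and k: "1 \<le> k" "1 / C0 \<le> k"
    and m: "D\<^sup>2 / t \<le> m" "min (t * g a) ((1 + a) * sqrt (g a)) \<le> m" "min (t * g b) ((1 + b) * sqrt (g b)) \<le> m"
  shows "(1 + a) * sqrt (g a) \<le> k * m"
    and "1 / t \<le> k\<^sup>2 * m"
    and "(1 + a) * sqrt (g a) + (1 + a)\<^sup>2 / t + ((1 + b) * sqrt (g b) + (1 + b)\<^sup>2 / t)
      \<le> (k + 5 * k\<^sup>2 + 2 * K * k + 7) * m"
proof -
  have sa: "sqrt (g a) * sqrt (g a) = g a" "0 < sqrt (g a)" using g by auto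
  have sb: "sqrt (g b) * sqrt (g b) = g b" "0 < sqrt (g b)" using g by auto
  have "0 < C0 * ((1 + a) / sqrt (g a))" using C0 a sa by simp
  then have t0: "0 < t" using t by linarith
  have m0: "0 \<le> m" using m(1) t0 by (meson divide_nonneg_pos order_trans zero_le_power2)
  have km: "m \<le> k * m" using k m0 by (simp add: mult_le_cancel_right1)
  have tA: "C0 * ((1 + a) * sqrt (g a)) \<le> t * g a"
  proof -
    have "C0 * ((1 + a) * sqrt (g a)) = C0 * ((1 + a) / sqrt (g a)) * (sqrt (g a) * sqrt (g a))"
      using sa(2) by (simp add: field_simps)
    also have "\<dots> \<le> t * g a" unfolding sa(1) using t g by (intro mult_right_mono) auto
    finally show ?thesis .
  qed
  show 1: "(1 + a) * sqrt (g a) \<le> k * m"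
  proof (cases "t * g a \<le> (1 + a) * sqrt (g a)")
    case True
    then have "C0 * ((1 + a) * sqrt (g a)) \<le> m" using m(2) tA by (simp add: min_def)
    then have "(1 + a) * sqrt (g a) \<le> (1 / C0) * m" using C0 by (simp add: field_simps)
    also have "\<dots> \<le> k * m" using k m0 by (intro mult_right_mono) auto
    finally show ?thesis .
  next
    case False
    then show ?thesis using m(2) km by (simp add: min_def)
  qed
  have tt: "(1 + a)\<^sup>2 / t \<le> k\<^sup>2 * m"
  proof -
    have "(1 + a) * (1 + a) * C0 \<le> (1 + a) * sqrt (g a) * t"
    proof -
      have "C0 * (1 + a) \<le> t * sqrt (g a)" using t sa(2) by (simp add: field_simps)
      then have "(1 + a) * (C0 * (1 + a)) \<le> (1 + a) * (t * sqrt (g a))" using a by (intro mult_left_mono) auto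
      then show ?thesis by (simp add: algebra_simps)
    qed
    then have "(1 + a)\<^sup>2 / t \<le> (1 / C0) * ((1 + a) * sqrt (g a))"
      using t0 C0 by (simp add: field_simps power2_eq_square)
    also have "\<dots> \<le> k * (k * m)" using k C0 sa a by (intro mult_mono[OF k(2) 1]) auto
    finally show ?thesis by (simp add: power2_eq_square algebra_simps)
  qed
  have "1 / t \<le> (1 + a)\<^sup>2 / t" using a t0 by (intro divide_right_mono) (auto simp: power2_eq_square algebra_simps)
  with tt show "1 / t \<le> k\<^sup>2 * m" by linarith
  have k2m: "0 \<le> k\<^sup>2 * m" "0 \<le> k * m" "0 \<le> K * k * m" using k K m0 by auto
  have b: "(1 + b) * sqrt (g b) \<le> (2 * K * k + 3) * m \<and> (1 + b)\<^sup>2 / t \<le> (4 * k\<^sup>2 + 4) * m"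
  \<comment> \<open>If \<open>b\<close> is comparable to \<open>a\<close>, doubling reduces
    everything to \<open>a\<close>. Otherwise \<open>D\<close> is at least
    \<open>(1 + b) / 2\<close>, and \<open>D\<^sup>2 / t\<close> takes over the role of
    \<open>(1 + b)\<^sup>2 / t\<close>.\<close>
  proof (cases "b \<le> 2 * a + 1")
    case True
    have "sqrt (g b) \<le> sqrt (K * g a)" using K(2)[OF True] by simp
    also have "\<dots> = sqrt K * sqrt (g a)" by (simp add: real_sqrt_mult)
    also have "\<dots> \<le> K * sqrt (g a)"
      using K(1) sa real_sqrt_le_mono[of K "K * K"] by (intro mult_right_mono) (auto simp: real_sqrt_mult mult_le_cancel_left1)
    finally have "(1 + b) * sqrt (g b) \<le> (2 * (1 + a)) * (K * sqrt (g a))"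
      using a True sb by (intro mult_mono) auto
    also have "\<dots> = 2 * K * ((1 + a) * sqrt (g a))" by simp
    also have "\<dots> \<le> 2 * K * (k * m)" using 1 K by (intro mult_left_mono) auto
    finally have "(1 + b) * sqrt (g b) \<le> 2 * K * k * m" by simp
    moreover have "(1 + b)\<^sup>2 / t \<le> 4 * (k\<^sup>2 * m)"
    proof -
      have "(1 + b)\<^sup>2 / t \<le> (2 * (1 + a))\<^sup>2 / t"
        using a True t0 by (intro divide_right_mono power_mono) auto
      also have "\<dots> = 4 * ((1 + a)\<^sup>2 / t)" unfolding power_mult_distrib by simp
      finally show ?thesis using tt by linarith
    qed
    ultimately show ?thesis using m0 by (simp add: algebra_simps)
  next
    case False
    then have D2: "1 + b \<le> 2 * D" using D by linarith
    have "(1 + b)\<^sup>2 / t \<le> (2 * D)\<^sup>2 / t"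
      using a D2 t0 by (intro divide_right_mono power_mono) auto
    also have "\<dots> = 4 * (D\<^sup>2 / t)" by (simp add: power_mult_distrib)
    finally have 4: "(1 + b)\<^sup>2 / t \<le> 4 * m" using m(1) by linarith
    have "(1 + b) * sqrt (g b) \<le> 3 * m"
    proof (cases "t * g b \<le> (1 + b) * sqrt (g b)")
      case True
      then have *: "t * g b \<le> m" using m(3) by (simp add: min_def)
      have "(1 + b) * sqrt (g b) * (2 * t) \<le> (1 + b) * (1 + b) + (t * sqrt (g b)) * (t * sqrt (g b))"
        using sum_squares_bound[of "1 + b" "t * sqrt (g b)"] by (simp add: power2_eq_square algebra_simps)
      also have "\<dots> = ((1 + b)\<^sup>2 / t + t * g b) * t"
      proof -
        have "(t * sqrt (g b)) * (t * sqrt (g b)) = t * g b * t"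
          using sb(1) by (simp only: mult_ac)
        moreover have "(1 + b) * (1 + b) = (1 + b)\<^sup>2 / t * t" using t0 by (simp add: power2_eq_square)
        ultimately show ?thesis by (simp only: distrib_right)
      qed
      also have "\<dots> \<le> (4 * m + m) * t" using 4 * t0 by (intro mult_right_mono) auto
      also have "\<dots> \<le> (6 * m) * t" using m0 t0 by (intro mult_right_mono) auto
      finally have "(1 + b) * sqrt (g b) * (2 * t) \<le> (3 * m) * (2 * t)" by (simp add: algebra_simps)
      then show ?thesis using t0 by (subst (asm) mult_le_cancel_right) auto
    next
      case False
      then show ?thesis using m(3) m0 by (simp add: min_def)
    qed
    then show ?thesis using 4 k2m by (simp add: algebra_simps)
  qed
  show "(1 + a) * sqrt (g a) + (1 + a)\<^sup>2 / t + ((1 + b) * sqrt (g b) + (1 + b)\<^sup>2 / t)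
      \<le> (k + 5 * k\<^sup>2 + 2 * K * k + 7) * m"
    using 1 tt b by (simp add: algebra_simps)
qed

text \<open>The inequality \<open>v \<le> exp v\<close> at \<open>v = \<epsilon> * u / e\<close>,
  raised to the power \<open>e\<close>. With \<open>u = 1 / t\<close> it trades
  \<open>t^(-d/2)\<close> for an arbitrarily small exponential rate.\<close>

lemma powr_le_exp:
  fixes u e \<epsilon> :: real
  assumes "0 \<le> u" "0 < e" "0 < \<epsilon>"
  shows "u powr e \<le> (e / \<epsilon>) powr e * exp (\<epsilon> * u)"
proof -
  have "\<epsilon> * u / e \<le> exp (\<epsilon> * u / e)" using exp_ge_add_one_self[of "\<epsilon> * u / e"] by linarith
  then have "(e / \<epsilon>) * (\<epsilon> * u / e) \<le> (e / \<epsilon>) * exp (\<epsilon> * u / e)"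
    using assms by (intro mult_left_mono) auto
  then have "u \<le> (e / \<epsilon>) * exp (\<epsilon> * u / e)" using assms by simp
  then have "u powr e \<le> ((e / \<epsilon>) * exp (\<epsilon> * u / e)) powr e" using assms by (intro powr_mono2) auto
  also have "\<dots> = (e / \<epsilon>) powr e * exp (\<epsilon> * u)" using assms by (subst powr_mult) (auto simp: exp_powr_real)
  finally show ?thesis .
qed

section \<open>Potentials comparable to a doubling function\<close>

locale schroedinger_growth = schroedinger_kernel M B V p
  for M :: "'w measure" and B :: "real \<Rightarrow> 'w \<Rightarrow> 'a::euclidean_space" and V :: "'a \<Rightarrow> real" and p +
  fixes g :: "real \<Rightarrow> real" and C1 C2 c0 :: real
  assumes g_mono: "\<And>r s. 0 \<le> r \<Longrightarrow> r \<le> s \<Longrightarrow> g r \<le> g s"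
    and g_ge_1: "\<And>r. 0 \<le> r \<Longrightarrow> 1 \<le> g r"
    and g_double: "\<And>r. 0 \<le> r \<Longrightarrow> g (2 * r) \<le> c0 * g r"
    and C1_pos: "0 < C1" and C2_pos: "0 < C2"
    and V_lower: "\<And>x. 1 < norm x \<Longrightarrow> C1 * g (norm x) \<le> V x"
    and V_upper: "\<And>x. 1 < norm x \<Longrightarrow> V x \<le> C2 * g (norm x)"
begin

abbreviation travel :: "'a \<Rightarrow> real" where
  "travel x \<equiv> (1 + norm x) * sqrt (g (norm x))"

lemma c0_ge_1: "1 \<le> c0"
proof -
  have "g 1 \<le> c0 * g 1" using g_mono[of 1 "2 * 1"] g_double[of 1] by simp
  then show ?thesis using g_ge_1[of 1] by (simp add: mult_le_cancel_right1)
qed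

text \<open>For \<open>r \<ge> 1\<close> two doublings suffice; for smaller \<open>r\<close> the
  argument is at most 3 and \<open>g r \<ge> 1\<close>. The affine form covers arguments near 0,
  where doubling alone cannot absorb an added constant.\<close>

lemma g_affine_le:
  assumes "0 \<le> r" shows "g (2 * r + 1) \<le> (c0\<^sup>2 + g 3) * g r"
proof (cases "1 \<le> r")
  case True
  have "g (2 * r + 1) \<le> g (2 * (2 * r))" using True by (intro g_mono) auto
  also have "\<dots> \<le> c0 * (c0 * g r)"
    using g_double[of "2 * r"] g_double[of r] c0_ge_1 True by (smt (verit) mult_left_mono)
  also have "\<dots> \<le> (c0\<^sup>2 + g 3) * g r"
    using g_ge_1[of r] g_ge_1[of 3] True by (simp add: power2_eq_square algebra_simps)
  finally show ?thesis .
next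
  case False
  have "g (2 * r + 1) \<le> g 3 * 1" using False assms g_mono[of "2 * r + 1" 3] by simp
  also have "\<dots> \<le> (c0\<^sup>2 + g 3) * g r"
    using g_ge_1[OF assms] g_ge_1[of 3] by (intro mult_mono) auto
  finally show ?thesis .
qed

text \<open>On the ball of radius \<open>norm w / 2\<close> around \<open>w\<close> doubling gives
  \<open>V \<ge> (C1 / c0) * g (norm w)\<close>. The window length makes both terms of
  \<open>kernel_le_off_ball\<close> decay at least like the claimed minimum.\<close>

lemma off_ball_decay:
  obtains C c where "1 \<le> C" "0 < c" "c \<le> 1 / 2"
    "\<And>t x y w. 0 < t \<Longrightarrow> w \<in> {x, y} \<Longrightarrow>
      p t x y \<le> C * t powr (- real DIM('a) / 2) * exp (- c * min (t * g (norm w)) (travel w))"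
proof
  \<comment> \<open>Both factors 3 come from \<open>(1 + norm w) / 3 \<le> R\<close>; 48 is 3 times
    the 16 of \<open>kernel_le_off_ball\<close>. That \<open>c \<le> 1 / 2\<close> makes the rate
    compatible with the free Gaussian bound.\<close>
  define c where "c = min (C1 / (3 * c0)) (1 / 48)"
  define A2 where "A2 = 3 * sqrt (g 2)"
  define C where "C = 1 + 2 powr (real DIM('a) / 2) + exp (c * A2)"
  show C: "1 \<le> C" by (simp add: C_def add_nonneg_nonneg)
  show c: "0 < c" "c \<le> 1 / 2" using C1_pos c0_ge_1 by (auto simp: c_def)
  fix t :: real and x y w :: 'a
  assume t: "0 < t" and w: "w \<in> {x, y}"
  define P where "P = p t x y"
  have P1: "P \<le> t powr (- real DIM('a) / 2)"
  proof -
    have "gauss t (y - x) \<le> (2 * pi * t) powr (- real DIM('a) / 2)" by (rule gauss_le[OF t order_refl])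
    also have "\<dots> \<le> t powr (- real DIM('a) / 2)"
      using t pi_ge_two by (intro powr_mono2') (auto simp: mult_le_cancel_right1)
    finally show ?thesis using kernel_le_gauss[OF t, of x y] unfolding P_def by linarith
  qed
  define G where "G = g (norm w)"
  define A where "A = (1 + norm w) * sqrt G"
  define m where "m = min (t * G) A"
  define T where "T = t powr (- real DIM('a) / 2)"
  have G: "1 \<le> G" unfolding G_def by (simp add: g_ge_1)
  have sG: "sqrt G * sqrt G = G" "0 < sqrt G" using G by auto
  have T: "0 \<le> T" by (simp add: T_def)
  have "P \<le> C * T * exp (- c * m)"
  proof (cases "norm w < 2")
    \<comment> \<open>For small \<open>w\<close> the exponent is at most \<open>c * A2\<close>, so
      the constant \<open>C\<close> absorbs it.\<close>
    case True
    have "m \<le> A" by (simp add: m_def)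
    also have "A \<le> A2" unfolding A_def A2_def G_def
      using True g_mono[of "norm w" 2] g_ge_1[of "norm w"] by (intro mult_mono) auto
    finally have "c * m \<le> c * A2" using c by simp
    have "P \<le> T * 1" using P1 by (simp add: T_def)
    also have "\<dots> \<le> T * (exp (c * A2) * exp (- c * m))"
      using T \<open>c * m \<le> c * A2\<close> by (intro mult_left_mono) (auto simp: mult_exp_exp)
    also have "\<dots> \<le> T * (C * exp (- c * m))"
      using T by (intro mult_left_mono mult_right_mono) (auto simp: C_def add_nonneg_nonneg)
    finally show ?thesis by (simp add: mult_ac)
  next
    case False
    define R where "R = norm w / 2"
    have R: "0 < R" "1 \<le> R" "(1 + norm w) / 3 \<le> R" using False by (auto simp: R_def)
    have RA: "A / 3 \<le> R * sqrt G"
      using mult_right_mono[OF R(3), of "sqrt G"] sG by (simp add: A_def)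
    define \<sigma> where "\<sigma> = min (t / 2) (R / sqrt G)"
    have \<sigma>: "0 < \<sigma>" "2 * \<sigma> \<le> t" "\<sigma> \<le> R / sqrt G" using t R sG by (auto simp: \<sigma>_def)
    define lam where "lam = (C1 / c0) * G"
    have lb: "lam \<le> V z" if "z \<in> ball w R" for z
    proof -
      have "norm w - norm z < R" using that norm_triangle_ineq2[of w z] by (simp add: dist_norm)
      then have z: "norm w / 2 < norm z" "1 < norm z" using R(2) by (auto simp: R_def)
      have "G \<le> c0 * g (norm z)"
        using g_double[of "norm w / 2"] g_mono[of "norm w / 2" "norm z"] z c0_ge_1
        unfolding G_def by (smt (verit) mult_left_mono norm_ge_zero field_sum_of_halves)
      then have "lam \<le> C1 * g (norm z)"
        using C1_pos c0_ge_1 by (simp add: lam_def field_simps)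
      with V_lower[OF z(2)] show ?thesis by simp
    qed
    have s1: "c * m \<le> \<sigma> * lam"
    proof -
      have "C1 / (3 * c0) * m \<le> (C1 / c0) * min (t * G / 2) (R * sqrt G)"
      proof -
        have "m / 3 \<le> min (t * G / 2) (R * sqrt G)"
        proof (rule min.boundedI)
          have "0 \<le> t * G" using t G by simp
          moreover have "m \<le> t * G" by (simp add: m_def)
          ultimately show "m / 3 \<le> t * G / 2" by linarith
          show "m / 3 \<le> R * sqrt G" using RA by (simp add: m_def)
        qed
        then have "(C1 / c0) * (m / 3) \<le> (C1 / c0) * min (t * G / 2) (R * sqrt G)"
          using C1_pos c0_ge_1 by (intro mult_left_mono) auto
        then show ?thesis by (simp add: field_simps)
      qed
      also have "min (t * G / 2) (R * sqrt G) = \<sigma> * G"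
      proof -
        have "R / sqrt G * G = R * sqrt G" using sG by (metis nonzero_mult_div_cancel_right mult.assoc times_divide_eq_left less_irrefl)
        then show ?thesis using G by (simp add: \<sigma>_def min_mult_distrib_right)
      qed
      finally have "C1 / (3 * c0) * m \<le> \<sigma> * lam" by (simp add: lam_def mult_ac)
      moreover have "c * m \<le> C1 / (3 * c0) * m"
        using t G by (intro mult_right_mono) (auto simp: c_def m_def A_def)
      ultimately show ?thesis by linarith
    qed
    have s2: "c * m \<le> R\<^sup>2 / (16 * \<sigma>)"
    proof -
      have "c * m \<le> 1 / 48 * m" using t G by (intro mult_right_mono) (auto simp: c_def m_def A_def)
      also have "\<dots> \<le> (A / 3) / 16" by (simp add: m_def)
      also have "\<dots> \<le> R * sqrt G / 16" using RA by simp
      also have "\<dots> \<le> R\<^sup>2 / (16 * \<sigma>)"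
      proof -
        have "\<sigma> * sqrt G \<le> R" using \<sigma>(3) sG by (simp add: field_simps)
        then have "R * (\<sigma> * sqrt G) \<le> R * R" using R by (intro mult_left_mono) auto
        then show ?thesis using \<sigma>(1) by (simp add: field_simps power2_eq_square)
      qed
      finally show ?thesis .
    qed
    have "P \<le> (pi * t) powr (- real DIM('a) / 2) * (exp (- \<sigma> * lam) + 2 powr (real DIM('a) / 2) * exp (- R\<^sup>2 / (16 * \<sigma>)))"
      unfolding P_def using \<sigma> R lb by (intro kernel_le_off_ball[OF w]) auto
    also have "\<dots> \<le> T * (exp (- c * m) + 2 powr (real DIM('a) / 2) * exp (- c * m))"
    proof (intro mult_mono add_mono)
      show "(pi * t) powr (- real DIM('a) / 2) \<le> T"
        unfolding T_def using t pi_ge_two by (intro powr_mono2') (auto simp: mult_le_cancel_right1)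
    qed (use s1 s2 T in \<open>auto simp: add_nonneg_nonneg\<close>)
    also have "\<dots> = T * ((1 + 2 powr (real DIM('a) / 2)) * exp (- c * m))" by (simp add: algebra_simps)
    also have "\<dots> \<le> T * (C * exp (- c * m))"
      using T by (intro mult_left_mono mult_right_mono) (auto simp: C_def)
    finally show ?thesis by (simp add: mult_ac)
  qed
  then show "p t x y \<le> C * t powr (- real DIM('a) / 2) * exp (- c * min (t * g (norm w)) (travel w))"
    by (simp add: m_def A_def G_def T_def P_def)
qed

text \<open>A single number \<open>m\<close> dominating all three exponents separates the
  probabilistic input from the real inequalities \<open>short_time_exponent_le\<close> and
  \<open>long_time_exponent_le\<close>.\<close>

abbreviation exp_bound :: "real \<Rightarrow> real \<Rightarrow> real \<Rightarrow> 'a \<Rightarrow> 'a \<Rightarrow> bool" where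
  "exp_bound C c t x y \<equiv> \<exists>m. p t x y \<le> C * t powr (- real DIM('a) / 2) * exp (- c * m)
    \<and> (norm (x - y))\<^sup>2 / t \<le> m \<and> min (t * g (norm x)) (travel x) \<le> m \<and> min (t * g (norm y)) (travel y) \<le> m"

text \<open>The three upper bounds share prefactor and rate, so the strongest of them has the
  maximum of the exponents.\<close>

lemma kernel_le_exp_max:
  obtains C c where "1 \<le> C" "0 < c"
    "\<And>t x y. 0 < t \<Longrightarrow> exp_bound C c t x y"
proof -
  from off_ball_decay obtain C c where C: "1 \<le> C" "0 < c" "c \<le> 1 / 2" and dec:
    "\<And>t x y w. 0 < t \<Longrightarrow> w \<in> {x, y} \<Longrightarrow>
      p t x y \<le> C * t powr (- real DIM('a) / 2) * exp (- c * min (t * g (norm w)) (travel w))"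
    by blast
  show ?thesis
  proof (rule that[OF C(1,2)])
    fix t :: real and x y :: 'a assume t: "0 < t"
    define T where "T = t powr (- real DIM('a) / 2)"
    have T: "0 \<le> T" by (simp add: T_def)
    have T2: "(2 * pi * t) powr (- real DIM('a) / 2) \<le> T"
      unfolding T_def using t pi_ge_two by (intro powr_mono2') (auto simp: mult_le_cancel_right1)
    have g1: "p t x y \<le> T * exp (- (norm (x - y))\<^sup>2 / (2 * t))"
    proof -
      have "gauss t (y - x) \<le> T * exp (- (norm (x - y))\<^sup>2 / (2 * t))"
        unfolding gauss_def norm_minus_commute[of y x] using T2 by (intro mult_right_mono) auto
      with kernel_le_gauss[OF t, of x y] show ?thesis by linarith
    qed
    define mx where "mx = min (t * g (norm x)) (travel x)"
    define my where "my = min (t * g (norm y)) (travel y)"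
    have b1: "p t x y \<le> C * T * exp (- c * ((norm (x - y))\<^sup>2 / t))"
    proof -
      have "c * ((norm (x - y))\<^sup>2 / t) \<le> (1 / 2) * ((norm (x - y))\<^sup>2 / t)"
        using C t by (intro mult_right_mono) auto
      then have "T * exp (- (norm (x - y))\<^sup>2 / (2 * t)) \<le> C * T * exp (- c * ((norm (x - y))\<^sup>2 / t))"
        using C T by (intro mult_mono) (auto simp: mult_le_cancel_right1)
      with g1 show ?thesis by linarith
    qed
    have b2: "p t x y \<le> C * T * exp (- c * mx)" and b3: "p t x y \<le> C * T * exp (- c * my)"
      unfolding T_def mx_def my_def by (intro dec[OF t]; simp)+
    have "p t x y \<le> C * T * exp (- c * max ((norm (x - y))\<^sup>2 / t) (max mx my))"
      using b1 b2 b3 unfolding max_def by auto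
    then show "exp_bound C c t x y"
      unfolding T_def[symmetric] mx_def[symmetric] my_def[symmetric]
      by (intro exI[of _ "max ((norm (x - y))\<^sup>2 / t) (max mx my)"]) (simp add: le_max_iff_disj)
  qed
qed

lemma min_max_g:
  shows "min (g (norm (x::'a))) (g (norm (y::'a))) = g (min (norm x) (norm y))"
    "max (g (norm x)) (g (norm y)) = g (max (norm x) (norm y))"
  using g_mono[of "norm x" "norm y"] g_mono[of "norm y" "norm x"] by (auto simp: min_def max_def)

lemma norm_diff_min_max:
  shows "norm (x - y :: 'a) \<le> min (norm x) (norm y) + max (norm x) (norm y)"
    "max (norm x) (norm y) - min (norm x) (norm y) \<le> norm (x - y)"
  using norm_triangle_ineq4[of x y] norm_triangle_ineq3[of x y] by (auto simp: min_def max_def)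

lemma kernel_upper_short_time:
  assumes "0 < C0"
  obtains c3 c4 where "0 < c3" "0 < c4"
    "\<And>x y t. 0 < t \<Longrightarrow> t \<le> C0 * t0 g (min (norm x) (norm y)) \<Longrightarrow>
      p t x y \<le> c3 * t powr (- real DIM('a) / 2) * exp (- c4 * E g t x y)"
proof -
  from kernel_le_exp_max obtain C c where C: "1 \<le> C" "0 < c" and bd:
    "\<And>t x y. 0 < t \<Longrightarrow> exp_bound C c t x y" by blast
  show ?thesis
  proof
    show "0 < C" "0 < c / (4 + C0)" using C assms by auto
    fix x y :: 'a and t assume t: "0 < t" "t \<le> C0 * t0 g (min (norm x) (norm y))"
    from bd[OF t(1), of x y] obtain m where m: "p t x y \<le> C * t powr (- real DIM('a) / 2) * exp (- c * m)"
      "(norm (x - y))\<^sup>2 / t \<le> m"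
      "min (t * g (norm x)) (travel x) \<le> m"
      "min (t * g (norm y)) (travel y) \<le> m" by blast
    let ?a = "min (norm x) (norm y)" and ?b = "max (norm x) (norm y)"
    have "(norm (x - y))\<^sup>2 / t + t * g ?a + norm (x - y) * sqrt (g ?b) \<le> (4 + C0) * m"
    proof (rule short_time_exponent_le[where g = g and a = ?a and b = ?b and D = "norm (x - y)"])
      show "t \<le> C0 * ((1 + ?a) / sqrt (g ?a))" using t(2) by (simp add: t0_def)
      show "min (t * g ?a) ((1 + ?a) * sqrt (g ?a)) \<le> m" "min (t * g ?b) ((1 + ?b) * sqrt (g ?b)) \<le> m"
        using m by (auto simp: min_def max_def)
    qed (use t assms m norm_diff_min_max[of x y] in \<open>auto intro!: g_ge_1 simp: le_max_iff_disj\<close>)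
    then have "E g t x y \<le> (4 + C0) * m" unfolding E_def min_max_g .
    then have "c / (4 + C0) * E g t x y \<le> c / (4 + C0) * ((4 + C0) * m)"
      using C assms by (intro mult_left_mono) auto
    also have "\<dots> = c * m" using assms by simp
    finally have "exp (- c * m) \<le> exp (- (c / (4 + C0)) * E g t x y)" by simp
    then have "C * t powr (- real DIM('a) / 2) * exp (- c * m) \<le> C * t powr (- real DIM('a) / 2) * exp (- (c / (4 + C0)) * E g t x y)"
      using C by (intro mult_left_mono) auto
    with m(1) show "p t x y \<le> C * t powr (- real DIM('a) / 2) * exp (- (c / (4 + C0)) * E g t x y)"
      by linarith
  qed
qed

lemma \<psi>_product:
  "exp (- t) * \<psi> g t x * \<psi> g t (y :: 'a) =
    exp (- (t + (travel x + (1 + norm x)\<^sup>2 / t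
      + (travel y + (1 + norm y)\<^sup>2 / t))))"
  unfolding \<psi>_def by (simp add: mult_exp_exp algebra_simps)

text \<open>One half of the exponent \<open>c * m\<close> pays for \<open>t^(-d/2)\<close>, the
  other half controls the spatial part \<open>S\<close> of \<open>\<psi>\<close>. The factor
  \<open>exp (- t)\<close> comes from \<open>kernel_le_exp_decay\<close>.\<close>

lemma kernel_upper_long_time:
  assumes C0: "0 < C0"
  obtains c7 c8 where "0 < c7" "0 < c8"
    "\<And>x y t. C0 * t0 g (min (norm x) (norm y)) \<le> t \<Longrightarrow>
      p t x y \<le> c7 * (exp (- t) * \<psi> g t x * \<psi> g t y) powr c8"
proof -
  from kernel_le_exp_max obtain C c where C: "1 \<le> C" "0 < c" and bd:
    "\<And>t x y. 0 < t \<Longrightarrow> exp_bound C c t x y" by blast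
  have v: "C1 \<le> V z" if "1 < norm z" for z
    using V_lower[OF that] g_ge_1[of "norm z"] C1_pos by (smt (verit) mult_le_cancel_left1 norm_ge_zero)
  obtain D d where D: "0 < D" "0 < d" "\<And>t x y. 2 \<le> t \<Longrightarrow> p t x y \<le> D * exp (- d * t)"
    using kernel_le_exp_decay[OF C1_pos v] by blast
  define e where "e = real DIM('a) / 2"
  have e: "0 < e" by (simp add: e_def)
  define k where "k = max 1 (1 / C0)"
  have k: "1 \<le> k" "1 / C0 \<le> k" by (auto simp: k_def)
  define K where "K = c0\<^sup>2 + g 3"
  have K: "1 \<le> K" using g_ge_1[of 3] zero_le_power2[of c0] unfolding K_def by linarith
  define L where "L = k + 5 * k\<^sup>2 + 2 * K * k + 7"
  have L: "0 < L" unfolding L_def using k K by (intro add_nonneg_pos add_nonneg_nonneg) auto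
  \<comment> \<open>Chosen so that \<open>1 / t \<le> k\<^sup>2 * m\<close> gives
    \<open>\<epsilon> / t \<le> c / 2 * m\<close>.\<close>
  define \<epsilon> where "\<epsilon> = c / (2 * k\<^sup>2)"
  have \<epsilon>: "0 < \<epsilon>" using C k by (simp add: \<epsilon>_def)
  define F where "F = C * (e / \<epsilon>) powr e"
  have F: "0 < F" using C e \<epsilon> by (simp add: F_def)
  \<comment> \<open>\<open>D\<close> serves \<open>t \<ge> 2\<close>; for \<open>t < 2\<close> the
    factor \<open>exp (2 * d)\<close> compensates the missing exponential decay in
    \<open>t\<close>.\<close>
  define H where "H = F + F * exp (2 * d) + D"
  define h where "h = min (c / (2 * L)) d"
  have h: "0 < h" using C L D by (simp add: h_def)
  show ?thesis
  proof
    show "0 < H" using F D by (simp add: H_def add_pos_pos)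
    show "0 < h / 2" using h by simp
    fix x y :: 'a and t assume t: "C0 * t0 g (min (norm x) (norm y)) \<le> t"
    let ?a = "min (norm x) (norm y)" and ?b = "max (norm x) (norm y)"
    have ga: "1 \<le> g ?a" "1 \<le> g ?b" by (auto intro!: g_ge_1 simp: le_max_iff_disj)
    have "0 < C0 * t0 g ?a" using C0 ga by (auto simp: t0_def intro!: mult_pos_pos divide_pos_pos add_pos_nonneg)
    with t have t0: "0 < t" by linarith
    from bd[OF t0, of x y] obtain m where m: "p t x y \<le> C * t powr (- real DIM('a) / 2) * exp (- c * m)"
      "(norm (x - y))\<^sup>2 / t \<le> m"
      "min (t * g (norm x)) (travel x) \<le> m"
      "min (t * g (norm y)) (travel y) \<le> m" by blast
    have gb: "g ?b \<le> K * g ?a" if "?b \<le> 2 * ?a + 1"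
      using order_trans[OF g_mono[OF _ that] g_affine_le[of ?a]] by (simp add: K_def le_max_iff_disj)
    have mm: "min (t * g ?a) ((1 + ?a) * sqrt (g ?a)) \<le> m" "min (t * g ?b) ((1 + ?b) * sqrt (g ?b)) \<le> m"
      using m by (auto simp: min_def max_def)
    have tt: "C0 * ((1 + ?a) / sqrt (g ?a)) \<le> t" using t by (simp add: t0_def)
    have ab: "0 \<le> ?a" "?a \<le> ?b" by auto
    note ex = long_time_exponent_le[OF ab norm_diff_min_max(2) ga K gb C0 tt k m(2) mm]
    define S where "S = travel x + (1 + norm x)\<^sup>2 / t
      + (travel y + (1 + norm y)\<^sup>2 / t)"
    have S: "S \<le> L * m"
      using ex(3) unfolding S_def L_def by (auto simp: min_def max_def split: if_splits)
    have S0: "0 \<le> S" unfolding S_def using t0 g_ge_1[of "norm x"] g_ge_1[of "norm y"]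
      by (intro add_nonneg_nonneg mult_nonneg_nonneg) auto
    have m0: "0 \<le> m" using m(2) t0 by (meson divide_nonneg_pos order_trans zero_le_power2)
    have "t powr (- real DIM('a) / 2) = (1 / t) powr e"
      using t0 by (simp add: e_def powr_minus powr_divide inverse_eq_divide)
    also have "\<dots> \<le> (e / \<epsilon>) powr e * exp (\<epsilon> * (1 / t))"
      using t0 e \<epsilon> by (intro powr_le_exp) auto
    also have "\<dots> \<le> (e / \<epsilon>) powr e * exp (c / 2 * m)"
    proof -
      have "\<epsilon> * (1 / t) \<le> \<epsilon> * (k\<^sup>2 * m)" using ex(2) \<epsilon> by (intro mult_left_mono) auto
      also have "\<dots> = c / 2 * m" using k by (simp add: \<epsilon>_def)
      finally show ?thesis by (intro mult_left_mono) auto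
    qed
    finally have Tb: "t powr (- real DIM('a) / 2) \<le> (e / \<epsilon>) powr e * exp (c / 2 * m)" .
    have "p t x y \<le> C * ((e / \<epsilon>) powr e * exp (c / 2 * m)) * exp (- c * m)"
      using m(1) Tb C by (smt (verit) exp_ge_zero mult_left_mono mult_right_mono)
    also have "\<dots> = F * exp (- (c / 2) * m)"
      by (simp add: F_def mult_exp_exp mult.assoc)
    finally have pF: "p t x y \<le> F * exp (- (c / 2) * m)" .
    have p1: "p t x y \<le> H * exp (- h * S)"
    proof -
      have "h * S \<le> c / (2 * L) * (L * m)" using S S0 C L h by (intro mult_mono) (auto simp: h_def)
      also have "\<dots> = c / 2 * m" using L by simp
      finally have "F * exp (- (c / 2) * m) \<le> H * exp (- h * S)"
        using F D by (intro mult_mono) (auto simp: H_def)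
      with pF show ?thesis by linarith
    qed
    have p2: "p t x y \<le> H * exp (- h * t)"
    proof (cases "2 \<le> t")
      case True
      have "h * t \<le> d * t" using t0 by (intro mult_right_mono) (auto simp: h_def)
      then have "D * exp (- d * t) \<le> H * exp (- h * t)"
        using F D by (intro mult_mono) (auto simp: H_def)
      with D(3)[OF True, of x y] show ?thesis by linarith
    next
      case False
      have "F * exp (- (c / 2) * m) \<le> F * 1" using F C m0 by (intro mult_left_mono) auto
      also have "\<dots> \<le> F * (exp (2 * d) * exp (- h * t))"
      proof -
        have "h * t \<le> d * 2" using t0 False h by (intro mult_mono) (auto simp: h_def)
        then show ?thesis using F by (intro mult_left_mono) (auto simp: mult_exp_exp)
      qed
      also have "\<dots> \<le> H * exp (- h * t)"
        unfolding mult.assoc[symmetric] using F D by (intro mult_right_mono) (auto simp: H_def)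
      finally show ?thesis using pF by linarith
    qed
    \<comment> \<open>The larger of \<open>t\<close> and \<open>S\<close> is at least
      \<open>(t + S) / 2\<close>, which is why the rate is halved.\<close>
    have "p t x y \<le> H * exp (- (h / 2) * (t + S))"
    proof (cases "S \<le> t")
      case True
      have "H * exp (- h * t) \<le> H * exp (- (h / 2) * (t + S))"
        using True h \<open>0 < H\<close> by (intro mult_left_mono) (auto simp: field_simps)
      with p2 show ?thesis by linarith
    next
      case False
      have "H * exp (- h * S) \<le> H * exp (- (h / 2) * (t + S))"
        using False h \<open>0 < H\<close> by (intro mult_left_mono) (auto simp: field_simps)
      with p1 show ?thesis by linarith
    qed
    then show "p t x y \<le> H * (exp (- t) * \<psi> g t x * \<psi> g t y) powr (h / 2)"
      unfolding \<psi>_product S_def[symmetric] exp_powr_real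
      by (simp only: mult.commute[of _ "h / 2"] mult_minus_right mult_minus_left)
  qed
qed

end

section \<open>Lower bounds along chains of balls\<close>

lemma gauss_chain_append: "gauss_chain (L @ L') f = gauss_chain L (gauss_chain L' f)"
proof
  show "gauss_chain (L @ L') f x = gauss_chain L (gauss_chain L' f) x" for x
    by (induction L arbitrary: x) simp_all
qed

text \<open>
  In a step \<open>(h, A, K)\<close> the path has to hit \<open>A\<close> after time \<open>h\<close>, and \<open>K\<close> bounds the conditional mean of
  \<open>V\<close> at all intermediate times.
\<close>

type_synonym 'a step = "real \<times> 'a set \<times> real"

definition duration :: "'a step list \<Rightarrow> real" where
  "duration L = sum_list (map fst L)"

text \<open>A bound for the mean action along the chain, obtained by integrating \<open>rate\<close>
  in time; it is the exponent lost in Jensen's inequality.\<close>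

definition cost :: "'a step list \<Rightarrow> real" where
  "cost L = sum_list (map (\<lambda>(h, A, K). h * K) L)"

definition weights :: "'a step list \<Rightarrow> (real \<times> ('a \<Rightarrow> ennreal)) list" where
  "weights L = map (\<lambda>(h, A, K). (h, indicator A)) L"

fun rate :: "'a step list \<Rightarrow> real \<Rightarrow> real" where
  "rate [] s = 0"
| "rate ((h, A, K) # L) s = (if s < h then K else rate L (s - h))"

lemma borel_measurable_rate [measurable]: "rate L \<in> borel_measurable borel"
proof (induction L)
  case (Cons e L)
  obtain h A K where e: "e = (h, A, K)" by (cases e)
  have [measurable]: "rate L \<in> borel_measurable borel" by (fact Cons)
  show ?case unfolding e rate.simps by measurable
qed simp

lemma path_weight_le_terminal:
  assumes "\<And>e z. e \<in> set L \<Longrightarrow> snd e z \<le> 1"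
  shows "path_weight L f \<tau> X \<le> f (X (\<tau> + sum_list (map fst L)))"
  using assms
proof (induction L arbitrary: \<tau>)
  case (Cons e L)
  have "path_weight (e # L) f \<tau> X \<le> 1 * path_weight L f (\<tau> + fst e) X"
    unfolding path_weight.simps by (intro mult_right_mono Cons.prems) auto
  also have "\<dots> \<le> f (X (\<tau> + fst e + sum_list (map fst L)))"
    using Cons.IH[of "\<tau> + fst e"] Cons.prems by simp
  finally show ?case by (simp add: add.assoc)
qed simp

section \<open>The mean action along a chain of balls\<close>

context nonneg_potential
begin

text \<open>Unnormalised form of: the conditional mean of \<open>V\<close> at any intermediate time
  is at most \<open>K\<close>, for all endpoints in \<open>S\<close> and \<open>A\<close>.\<close>

definition bridge_le :: "'a set \<Rightarrow> real \<Rightarrow> 'a set \<Rightarrow> real \<Rightarrow> bool" where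
  "bridge_le S h A K \<longleftrightarrow> (\<forall>x\<in>S. \<forall>y\<in>A. \<forall>s. 0 < s \<and> s < h \<longrightarrow>
    mid_integral s (h - s) (\<lambda>z. ennreal (V z)) x y
      \<le> ennreal K * ennreal (gauss h (y - x)))"

fun chain :: "'a set \<Rightarrow> 'a step list \<Rightarrow> 'a set \<Rightarrow> bool" where
  "chain S [] S' \<longleftrightarrow> S = S'"
| "chain S ((h, A, K) # L) S' \<longleftrightarrow> 0 < h \<and> 0 \<le> K \<and> A \<in> sets borel \<and> bridge_le S h A K \<and> chain A L S'"

text \<open>
  Weighting additionally by \<open>V\<close> at time \<open>s\<close>; integrated over \<open>s\<close>, this computes the mean action.
\<close>

fun insert_time :: "real \<Rightarrow> 'a step list \<Rightarrow> (real \<times> ('a \<Rightarrow> ennreal)) list" where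
  "insert_time s [] = []"
| "insert_time s ((h, A, K) # L) =
    (if s < h then (s, \<lambda>z. ennreal (V z)) # (h - s, indicator A) # weights L
     else (h, indicator A) # insert_time (s - h) L)"

lemma bridge_le_mono: "bridge_le S h A K \<Longrightarrow> S0 \<subseteq> S \<Longrightarrow> bridge_le S0 h A K"
  unfolding bridge_le_def by blast

lemma chain_mono: "chain S L S' \<Longrightarrow> S0 \<subseteq> S \<Longrightarrow> L \<noteq> [] \<Longrightarrow> chain S0 L S'"
  by (cases L) (auto intro: bridge_le_mono)

lemma chain_append: "chain S L S1 \<Longrightarrow> chain S1 L' S' \<Longrightarrow> chain S (L @ L') S'"
  by (induction S L S1 rule: chain.induct) auto

lemma chain_weights:
  assumes "chain S L S'" "e \<in> set (weights L)"
  shows "0 < fst e" "snd e \<in> borel_measurable borel" "snd e z \<le> 1"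
proof -
  obtain h A K where e: "(h, A, K) \<in> set L" "e = (h, indicator A)"
    using assms(2) by (auto simp: weights_def)
  from assms(1) e(1) have "0 < h \<and> A \<in> sets borel"
    by (induction S L S' rule: chain.induct) auto
  then show "0 < fst e" "snd e \<in> borel_measurable borel" "snd e z \<le> 1"
    by (auto simp: e(2) indicator_def)
qed

lemma chain_nonneg:
  assumes "chain S L S'" shows "0 \<le> cost L" "0 \<le> duration L" "0 \<le> rate L s"
proof -
  show "0 \<le> cost L" "0 \<le> duration L"
    using assms by (induction S L S' rule: chain.induct) (auto simp: cost_def duration_def)
  show "0 \<le> rate L s"
    using assms by (induction S L S' arbitrary: s rule: chain.induct) auto
qed

lemma insert_time_path_weight:
  assumes "chain S L S'" "0 \<le> s" "s < duration L"
  shows "path_weight (insert_time s L) f \<tau> X = ennreal (V (X (\<tau> + s))) * path_weight (weights L) f \<tau> X"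
  using assms
proof (induction S L S' arbitrary: s \<tau> rule: chain.induct)
  case (2 S h A K L S')
  show ?case
  proof (cases "s < h")
    case True
    then show ?thesis by (simp add: weights_def add.assoc)
  next
    case False
    have "path_weight (insert_time (s - h) L) f (\<tau> + h) X
      = ennreal (V (X (\<tau> + h + (s - h)))) * path_weight (weights L) f (\<tau> + h) X"
      using 2 False by (intro 2(1)) (auto simp: duration_def)
    with False show ?thesis by (simp add: weights_def mult_ac)
  qed
qed (simp add: duration_def)

text \<open>The exceptional set consists of the times at which one step ends and the next begins;
  inserting such a time would create a step of length 0, to which the Gaussian chain formula does
  not apply.\<close>

lemma insert_time_pos:
  assumes "chain S L S'"
  shows "\<exists>F. finite F \<and> (\<forall>s. 0 < s \<longrightarrow> s < duration L \<longrightarrow> s \<notin> F \<longrightarrow> (\<forall>e\<in>set (insert_time s L). 0 < fst e))"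
  using assms
proof (induction S L S' rule: chain.induct)
  case (2 S h A K L S')
  then obtain F where F: "finite F"
    "\<And>s. 0 < s \<Longrightarrow> s < duration L \<Longrightarrow> s \<notin> F \<Longrightarrow> (\<forall>e\<in>set (insert_time s L). 0 < fst e)" by auto
  have "\<forall>e\<in>set (insert_time s ((h, A, K) # L)). 0 < fst e"
    if s: "0 < s" "s < duration ((h, A, K) # L)" "s \<notin> insert h ((\<lambda>u. u + h) ` F)" for s
  proof (cases "s < h")
    case True
    then show ?thesis using 2(2) s chain_weights(1)[of A L S'] by auto
  next
    case False
    have "s - h \<notin> F" using s(3) by (auto simp: image_iff)
    with False s F(2)[of "s - h"] 2(2) show ?thesis by (auto simp: duration_def)
  qed
  with F(1) show ?case by (intro exI[of _ "insert h ((\<lambda>u. u + h) ` F)"]) auto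
qed auto

lemma insert_time_measurable:
  assumes "chain S L S'" "e \<in> set (insert_time s L)"
  shows "snd e \<in> borel_measurable borel"
  using assms
proof (induction S L S' arbitrary: s rule: chain.induct)
  case (2 S h A K L S')
  then show ?case using chain_weights(2)[of A L S' e] by (auto split: if_splits)
qed simp

text \<open>In the step that contains \<open>s\<close>, \<open>nn_integral_two_steps\<close> pins
  both ends and \<open>bridge_le\<close> applies. Steps before it pass the bound on, and steps after
  it are unchanged.\<close>

lemma gauss_chain_insert_time_le:
  assumes "chain S L S'" "x \<in> S" "0 < s" "s < duration L"
    and "\<forall>e\<in>set (insert_time s L). 0 < fst e" and f: "f \<in> borel_measurable borel"
  shows "gauss_chain (insert_time s L) f x \<le> ennreal (rate L s) * gauss_chain (weights L) f x"
  using assms(1-5)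
proof (induction S L S' arbitrary: s x rule: chain.induct)
  case (2 S h A K L S')
  have [measurable]: "A \<in> sets borel" using 2 by simp
  have ch: "chain A L S'" using 2 by simp
  have [measurable]: "gauss_chain (weights L) f \<in> borel_measurable borel"
    using chain_weights(2)[OF ch] by (intro borel_measurable_gauss_chain f) auto
  have w: "gauss_chain (weights ((h, A, K) # L)) f x
    = (\<integral>\<^sup>+y. ennreal (gauss h (y - x)) * (indicator A y * gauss_chain (weights L) f y) \<partial>lborel)"
    by (simp add: weights_def)
  show ?case
  proof (cases "s < h")
    case True
    have "gauss_chain (insert_time s ((h, A, K) # L)) f x
      = (\<integral>\<^sup>+z. ennreal (gauss s (z - x)) * (ennreal (V z) *
          (\<integral>\<^sup>+y. ennreal (gauss (h - s) (y - z)) * (indicator A y * gauss_chain (weights L) f y) \<partial>lborel)) \<partial>lborel)"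
      using True by simp
    also have "\<dots> = (\<integral>\<^sup>+y. mid_integral s (h - s) (\<lambda>z. ennreal (V z)) x y * (indicator A y * gauss_chain (weights L) f y) \<partial>lborel)"
      by (rule nn_integral_two_steps) measurable
    also have "\<dots> \<le> (\<integral>\<^sup>+y. ennreal K * (ennreal (gauss h (y - x)) * (indicator A y * gauss_chain (weights L) f y)) \<partial>lborel)"
    proof (intro nn_integral_mono)
      fix y
      show "mid_integral s (h - s) (\<lambda>z. ennreal (V z)) x y
         * (indicator A y * gauss_chain (weights L) f y)
        \<le> ennreal K * (ennreal (gauss h (y - x)) * (indicator A y * gauss_chain (weights L) f y))"
      proof (cases "y \<in> A")
        case yA: True
        have "mid_integral s (h - s) (\<lambda>z. ennreal (V z)) x y
          \<le> ennreal K * ennreal (gauss h (y - x))"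
          using 2 yA True by (auto simp: bridge_le_def)
        then show ?thesis unfolding mult.assoc[symmetric] by (intro mult_right_mono) auto
      qed simp
    qed
    also have "\<dots> = ennreal K * gauss_chain (weights ((h, A, K) # L)) f x"
      unfolding w by (intro nn_integral_cmult) measurable
    finally show ?thesis using True by simp
  next
    case False
    \<comment> \<open>At \<open>s = h\<close> the next step would be split at time 0, contradicting
      positivity of the inserted step lengths.\<close>
    then have sh: "s \<noteq> h" "0 < s - h" "s - h < duration L" "\<forall>e\<in>set (insert_time (s - h) L). 0 < fst e"
    proof -
      have "L \<noteq> []" using False "2.prems"(4) by (auto simp: duration_def)
      then obtain h' A' K' L' where L: "L = (h', A', K') # L'" by (cases L) auto
      have h': "0 < h'" using ch L by simp
      show p: "\<forall>e\<in>set (insert_time (s - h) L). 0 < fst e" using "2.prems"(5) False by simp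
      show "s \<noteq> h" using p h' unfolding L by auto
      then show "0 < s - h" using False by simp
      show "s - h < duration L" using "2.prems"(4) by (simp add: duration_def)
    qed
    have "gauss_chain (insert_time s ((h, A, K) # L)) f x
      = (\<integral>\<^sup>+y. ennreal (gauss h (y - x)) * (indicator A y * gauss_chain (insert_time (s - h) L) f y) \<partial>lborel)"
      using False by simp
    also have "\<dots> \<le> (\<integral>\<^sup>+y. ennreal (rate L (s - h)) * (ennreal (gauss h (y - x)) * (indicator A y * gauss_chain (weights L) f y)) \<partial>lborel)"
    proof (intro nn_integral_mono)
      fix y
      show "ennreal (gauss h (y - x)) * (indicator A y * gauss_chain (insert_time (s - h) L) f y)
        \<le> ennreal (rate L (s - h)) * (ennreal (gauss h (y - x)) * (indicator A y * gauss_chain (weights L) f y))"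
      proof (cases "y \<in> A")
        case True
        have "gauss_chain (insert_time (s - h) L) f y \<le> ennreal (rate L (s - h)) * gauss_chain (weights L) f y"
          using 2(1)[OF ch True sh(2-4)] .
        from mult_left_mono[OF this, of "ennreal (gauss h (y - x))"] True show ?thesis
          by (simp add: mult_ac)
      qed simp
    qed
    also have "\<dots> = ennreal (rate L (s - h)) * gauss_chain (weights ((h, A, K) # L)) f x"
      unfolding w by (intro nn_integral_cmult) measurable
    finally show ?thesis using False by simp
  qed
qed (simp add: duration_def)

lemma nn_integral_rate_le:
  assumes "chain S L S'"
  shows "(\<integral>\<^sup>+s. indicator {0..<duration L} s * ennreal (rate L s) \<partial>lborel) \<le> ennreal (cost L)"
  using assms
proof (induction S L S' rule: chain.induct)
  case (2 S h A K L S')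
  have ch: "chain A L S'" and h: "0 < h" and K: "0 \<le> K" using 2 by auto
  let ?L = "(h, A, K) # L"
  have dur: "duration ?L = h + duration L" by (simp add: duration_def)
  have "(\<integral>\<^sup>+s. indicator {0..<duration ?L} s * ennreal (rate ?L s) \<partial>lborel)
    = (\<integral>\<^sup>+s. ennreal K * indicator {0..<h} s + indicator {h..<h + duration L} s * ennreal (rate L (s - h)) \<partial>lborel)"
    using chain_nonneg(2)[OF ch] h by (intro nn_integral_cong) (auto simp: dur indicator_def)
  also have "\<dots> = ennreal K * ennreal h + (\<integral>\<^sup>+s. indicator {h..<h + duration L} s * ennreal (rate L (s - h)) \<partial>lborel)"
    using h by (subst nn_integral_add) (auto simp: nn_integral_cmult_indicator)
  also have "(\<integral>\<^sup>+s. indicator {h..<h + duration L} s * ennreal (rate L (s - h)) \<partial>lborel)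
    = (\<integral>\<^sup>+s. indicator {h..<h + duration L} (h + s) * ennreal (rate L (h + s - h)) \<partial>lborel)"
    by (rule nn_integral_lborel_shift[symmetric]) measurable
  also have "\<dots> = (\<integral>\<^sup>+s. indicator {0..<duration L} s * ennreal (rate L s) \<partial>lborel)"
    by (intro nn_integral_cong) (auto simp: indicator_def)
  also have "ennreal K * ennreal h + \<dots> \<le> ennreal K * ennreal h + ennreal (cost L)"
    by (intro add_left_mono 2(1) ch)
  also have "\<dots> = ennreal (cost ?L)"
    using K h chain_nonneg(1)[OF ch] by (simp add: cost_def ennreal_mult mult.commute)
  finally show ?case .
qed (simp add: duration_def cost_def)

lemma measurable_path_weight:
  assumes "\<And>e. e \<in> set L \<Longrightarrow> snd e \<in> borel_measurable borel" "f \<in> borel_measurable borel"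
  shows "(\<lambda>\<omega>. path_weight L f \<tau> (path x \<omega>)) \<in> borel_measurable M"
  using assms(1)
proof (induction L arbitrary: \<tau>)
  case Nil
  show ?case using assms(2) by simp
next
  case (Cons e L)
  have [measurable]: "snd e \<in> borel_measurable borel" using Cons.prems by simp
  have [measurable]: "(\<lambda>\<omega>. path_weight L f (\<tau> + fst e) (path x \<omega>)) \<in> borel_measurable M"
    using Cons by simp
  show ?case by simp
qed

text \<open>Jensen's inequality for the measure with density \<open>w\<close>, the weight of hitting
  all sets and then reading \<open>f\<close>. Tonelli writes the mean action as an integral over
  \<open>s\<close> of chains with an inserted factor \<open>V\<close>, which \<open>rate\<close>
  bounds.\<close>

lemma chain_semigroup_ge:
  assumes ch: "chain S L S'" and x: "x \<in> S" and f: "f \<in> bcontfun" "\<And>z. 0 \<le> f z"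
  shows "ennreal (exp (- cost L)) * gauss_chain (weights L) (\<lambda>z. ennreal (f z)) x
    \<le> ennreal (semigroup (duration L) f x)"
proof -
  define t where "t = duration L"
  have t: "0 \<le> t" using chain_nonneg[OF ch] by (simp add: t_def)
  have [measurable]: "f \<in> borel_measurable borel"
    using f(1) by (rule borel_measurable_bcontfun)
  define w where "w \<omega> = path_weight (weights L) (\<lambda>z. ennreal (f z)) 0 (path x \<omega>)" for \<omega>
  have [measurable]: "w \<in> borel_measurable M"
    unfolding w_def using chain_weights(2)[OF ch] by (intro measurable_path_weight) auto
  have wt: "map fst (weights L) = map fst L" by (auto simp: weights_def)
  have w_le: "w \<omega> \<le> ennreal (f (path x \<omega> t))" for \<omega>
    using path_weight_le_terminal[of "weights L" "\<lambda>z. ennreal (f z)" 0 "path x \<omega>"] chain_weights(3)[OF ch]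
    unfolding w_def t_def duration_def wt by simp
  have W: "(\<integral>\<^sup>+\<omega>. w \<omega> \<partial>M) = gauss_chain (weights L) (\<lambda>z. ennreal (f z)) x"
    unfolding w_def using chain_weights[OF ch] by (intro gauss_chain_eq_path_integral) auto
  obtain b where b: "\<And>z. f z \<le> b"
    using f(1) unfolding bcontfun_def bounded_iff by (force simp: abs_le_iff)
  have "(\<integral>\<^sup>+\<omega>. w \<omega> \<partial>M) \<le> (\<integral>\<^sup>+\<omega>. ennreal b \<partial>M)"
    using w_le b by (intro nn_integral_mono) (meson ennreal_leI order_trans)
  also have "\<dots> < \<infinity>" by (simp add: emeasure_space_1)
  finally have Wfin: "(\<integral>\<^sup>+\<omega>. w \<omega> \<partial>M) < \<infinity>" .
  interpret pair_sigma_finite lborel M ..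
  have "(\<integral>\<^sup>+\<omega>. w \<omega> * ennreal (action t x \<omega>) \<partial>M)
    = (\<integral>\<^sup>+\<omega>. (\<integral>\<^sup>+s. w \<omega> * (ennreal (V (path x \<omega> s)) * indicator {0..t} s) \<partial>lborel) \<partial>M)"
  proof (intro nn_integral_cong)
    fix \<omega> assume \<omega>[measurable]: "\<omega> \<in> space M"
    have [measurable]: "(\<lambda>s. V (path x \<omega> s)) \<in> borel_measurable lborel"
      using \<omega> by measurable
    show "w \<omega> * ennreal (action t x \<omega>) = (\<integral>\<^sup>+s. w \<omega> * (ennreal (V (path x \<omega> s)) * indicator {0..t} s) \<partial>lborel)"
      unfolding action_nn[OF \<omega>] by (intro nn_integral_cmult[symmetric]) measurable
  qed
  also have "\<dots> = (\<integral>\<^sup>+s. (\<integral>\<^sup>+\<omega>. w \<omega> * (ennreal (V (path x \<omega> s)) * indicator {0..t} s) \<partial>M) \<partial>lborel)"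
    by (rule Fubini') (simp add: split_beta', measurable)
  also have "\<dots> \<le> (\<integral>\<^sup>+s. (indicator {0..<t} s * ennreal (rate L s)) * (\<integral>\<^sup>+\<omega>. w \<omega> \<partial>M) \<partial>lborel)"
  proof (intro nn_integral_mono_AE)
    obtain F where F: "finite F"
      "\<And>s. 0 < s \<Longrightarrow> s < duration L \<Longrightarrow> s \<notin> F \<Longrightarrow> (\<forall>e\<in>set (insert_time s L). 0 < fst e)"
      using insert_time_pos[OF ch] by blast
    \<comment> \<open>The junction times form a finite set, hence they do not affect the integral
      over \<open>s\<close>.\<close>
    have "AE s in lborel. s \<notin> insert 0 (insert t F)"
      using F(1) by (intro AE_not_in finite_imp_null_set_lborel) auto
    then show "AE s in lborel. (\<integral>\<^sup>+\<omega>. w \<omega> * (ennreal (V (path x \<omega> s)) * indicator {0..t} s) \<partial>M)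
      \<le> (indicator {0..<t} s * ennreal (rate L s)) * (\<integral>\<^sup>+\<omega>. w \<omega> \<partial>M)"
    proof eventually_elim
      case (elim s)
      show ?case
      proof (cases "s \<in> {0..t}")
        case True
        then have s: "0 < s" "s < t" "s \<notin> F" using elim by auto
        have "(\<integral>\<^sup>+\<omega>. w \<omega> * (ennreal (V (path x \<omega> s)) * indicator {0..t} s) \<partial>M)
          = (\<integral>\<^sup>+\<omega>. path_weight (insert_time s L) (\<lambda>z. ennreal (f z)) 0 (path x \<omega>) \<partial>M)"
          using s by (intro nn_integral_cong) (simp add: insert_time_path_weight[OF ch] t_def w_def mult.commute)
        also have "\<dots> = gauss_chain (insert_time s L) (\<lambda>z. ennreal (f z)) x"
          using F(2)[of s] s insert_time_measurable[OF ch] by (intro gauss_chain_eq_path_integral) (auto simp: t_def)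
        also have "\<dots> \<le> ennreal (rate L s) * gauss_chain (weights L) (\<lambda>z. ennreal (f z)) x"
          using F(2)[of s] s by (intro gauss_chain_insert_time_le[OF ch x]) (auto simp: t_def)
        finally show ?thesis unfolding W using s by simp
      next
        case False
        then show ?thesis by simp
      qed
    qed
  qed
  also have "\<dots> = (\<integral>\<^sup>+s. indicator {0..<t} s * ennreal (rate L s) \<partial>lborel) * (\<integral>\<^sup>+\<omega>. w \<omega> \<partial>M)"
    by (intro nn_integral_multc) measurable
  also have "\<dots> \<le> ennreal (cost L) * (\<integral>\<^sup>+\<omega>. w \<omega> \<partial>M)"
    unfolding t_def by (intro mult_right_mono nn_integral_rate_le[OF ch]) simp
  finally have "ennreal (exp (- cost L)) * (\<integral>\<^sup>+\<omega>. w \<omega> \<partial>M) \<le> (\<integral>\<^sup>+\<omega>. w \<omega> * ennreal (exp (- action t x \<omega>)) \<partial>M)"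
    by (intro nn_integral_exp_minus_ge action_nonneg chain_nonneg[OF ch] Wfin) auto
  also have "\<dots> \<le> (\<integral>\<^sup>+\<omega>. ennreal (f (path x \<omega> t)) * ennreal (exp (- action t x \<omega>)) \<partial>M)"
    by (intro nn_integral_mono mult_right_mono w_le) simp
  also have "\<dots> = ennreal (semigroup t f x)"
    by (rule semigroup_nn(1)[OF t f, symmetric])
  finally show ?thesis unfolding W t_def .
qed

text \<open>A lower bound \<open>c\<close>, uniform over starting points in \<open>S\<close>, for
  the transition density into \<open>S'\<close>. The witnessing chain is part of the notion, so that
  bounds can be composed before Jensen is applied. The test functions are arbitrary Borel functions
  because in a composition the remainder of a chain takes their place.\<close>

definition lower :: "'a set \<Rightarrow> real \<Rightarrow> 'a set \<Rightarrow> real \<Rightarrow> bool" where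
  "lower S t S' c \<longleftrightarrow> (\<exists>L. L \<noteq> [] \<and> chain S L S' \<and> duration L = t \<and>
    (\<forall>x\<in>S. \<forall>f\<in>borel_measurable borel.
      ennreal c * (\<integral>\<^sup>+y\<in>S'. f y \<partial>lborel) \<le> ennreal (exp (- cost L)) * gauss_chain (weights L) f x))"

lemma lower_mono:
  assumes "lower S t S' c" "S0 \<subseteq> S" "c' \<le> c"
  shows "lower S0 t S' c'"
proof -
  from assms(1) obtain L where L: "L \<noteq> []" "chain S L S'" "duration L = t"
    "\<And>x f. x \<in> S \<Longrightarrow> f \<in> borel_measurable borel \<Longrightarrow>
      ennreal c * (\<integral>\<^sup>+y\<in>S'. f y \<partial>lborel) \<le> ennreal (exp (- cost L)) * gauss_chain (weights L) f x"
    unfolding lower_def by blast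
  have "ennreal c' * (\<integral>\<^sup>+y\<in>S'. f y \<partial>lborel) \<le> ennreal c * (\<integral>\<^sup>+y\<in>S'. f y \<partial>lborel)" for f
    using assms(3) by (intro mult_right_mono ennreal_leI) auto
  then have "ennreal c' * (\<integral>\<^sup>+y\<in>S'. f y \<partial>lborel) \<le> ennreal (exp (- cost L)) * gauss_chain (weights L) f x"
    if "x \<in> S0" "f \<in> borel_measurable borel" for x f
    using L(4)[of x f] that assms(2) by (meson order_trans subsetD)
  with L(1,3) chain_mono[OF L(2) assms(2) L(1)] show ?thesis
    unfolding lower_def by blast
qed

text \<open>The chains are concatenated and their costs add. Integrating the second bound over the
  intermediate set contributes its volume.\<close>

lemma lower_comp:
  assumes 1: "lower S t1 S1 \<kappa>1" and 2: "lower S1 t2 S2 \<kappa>2" and v: "ennreal v \<le> emeasure lborel S1"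
    and nn: "0 \<le> \<kappa>1" "0 \<le> \<kappa>2" "0 \<le> v" and S1: "S1 \<in> sets borel"
  shows "lower S (t1 + t2) S2 (\<kappa>1 * \<kappa>2 * v)"
proof -
  from 1 obtain L1 where L1: "L1 \<noteq> []" "chain S L1 S1" "duration L1 = t1"
    "\<And>x f. x \<in> S \<Longrightarrow> f \<in> borel_measurable borel \<Longrightarrow>
      ennreal \<kappa>1 * (\<integral>\<^sup>+y\<in>S1. f y \<partial>lborel) \<le> ennreal (exp (- cost L1)) * gauss_chain (weights L1) f x"
    unfolding lower_def by blast
  from 2 obtain L2 where L2: "L2 \<noteq> []" "chain S1 L2 S2" "duration L2 = t2"
    "\<And>x f. x \<in> S1 \<Longrightarrow> f \<in> borel_measurable borel \<Longrightarrow>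
      ennreal \<kappa>2 * (\<integral>\<^sup>+y\<in>S2. f y \<partial>lborel) \<le> ennreal (exp (- cost L2)) * gauss_chain (weights L2) f x"
    unfolding lower_def by blast
  have [measurable]: "S1 \<in> sets borel" by (fact S1)
  show ?thesis
    unfolding lower_def
  proof (intro exI[of _ "L1 @ L2"] conjI ballI)
    show "L1 @ L2 \<noteq> []" "chain S (L1 @ L2) S2" "duration (L1 @ L2) = t1 + t2"
      using L1 L2 chain_append[OF L1(2) L2(2)] by (auto simp: duration_def)
    fix x and f :: "'a \<Rightarrow> ennreal" assume x: "x \<in> S" and f: "f \<in> borel_measurable borel"
    define F where "F = gauss_chain (weights L2) f"
    have [measurable]: "F \<in> borel_measurable borel"
      unfolding F_def using chain_weights(2)[OF L2(2)] by (intro borel_measurable_gauss_chain f) auto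
    let ?I = "\<integral>\<^sup>+y\<in>S2. f y \<partial>lborel"
    have "ennreal (\<kappa>1 * \<kappa>2 * v) * ?I = ennreal \<kappa>1 * (ennreal \<kappa>2 * ?I * ennreal v)"
      using nn by (simp add: ennreal_mult mult_ac)
    also have "\<dots> \<le> ennreal \<kappa>1 * (ennreal \<kappa>2 * ?I * emeasure lborel S1)"
      by (intro mult_left_mono v) auto
    also have "\<dots> = ennreal \<kappa>1 * (\<integral>\<^sup>+z\<in>S1. ennreal \<kappa>2 * ?I \<partial>lborel)"
      by (simp add: nn_integral_cmult_indicator)
    also have "\<dots> \<le> ennreal \<kappa>1 * (\<integral>\<^sup>+z\<in>S1. ennreal (exp (- cost L2)) * F z \<partial>lborel)"
      using L2(4)[OF _ f] by (intro mult_left_mono nn_integral_mono) (auto simp: F_def indicator_def)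
    also have "\<dots> = ennreal (exp (- cost L2)) * (ennreal \<kappa>1 * (\<integral>\<^sup>+z\<in>S1. F z \<partial>lborel))"
    proof -
      have "(\<integral>\<^sup>+z\<in>S1. ennreal (exp (- cost L2)) * F z \<partial>lborel) = ennreal (exp (- cost L2)) * (\<integral>\<^sup>+z\<in>S1. F z \<partial>lborel)"
        by (subst nn_integral_cmult[symmetric]) (auto simp: mult.assoc)
      then show ?thesis by (simp only: mult.left_commute)
    qed
    also have "\<dots> \<le> ennreal (exp (- cost L2)) * (ennreal (exp (- cost L1)) * gauss_chain (weights L1) F x)"
      using L1(4)[OF x] by (intro mult_left_mono) auto
    also have "\<dots> = ennreal (exp (- cost (L1 @ L2))) * gauss_chain (weights (L1 @ L2)) f x"
      unfolding mult.assoc[symmetric] F_def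
      by (simp add: weights_def gauss_chain_append cost_def ennreal_mult[symmetric] mult_exp_exp algebra_simps)
    finally show "ennreal (\<kappa>1 * \<kappa>2 * v) * ?I \<le> ennreal (exp (- cost (L1 @ L2))) * gauss_chain (weights (L1 @ L2)) f x" .
  qed
qed

end

context schroedinger_kernel
begin

lemma lower_kernel:
  assumes low: "lower S t S' c" and x: "x \<in> S" and r: "0 < r" "ball y r \<subseteq> S'" and t: "0 < t"
  shows "c \<le> p t x y"
proof (rule kernel_geI[OF t r(1)])
  fix f :: "'a \<Rightarrow> real" assume f: "f \<in> bcontfun" "\<And>z. 0 \<le> f z" "\<And>z. z \<notin> ball y r \<Longrightarrow> f z = 0"
  have [measurable]: "f \<in> borel_measurable borel"
    using f(1) by (rule borel_measurable_bcontfun)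
  from low obtain L where L: "chain S L S'" "duration L = t"
    "\<And>f. f \<in> borel_measurable borel \<Longrightarrow>
      ennreal c * (\<integral>\<^sup>+y\<in>S'. f y \<partial>lborel) \<le> ennreal (exp (- cost L)) * gauss_chain (weights L) f x"
    using x unfolding lower_def by blast
  have "mass f = (\<integral>\<^sup>+z\<in>S'. ennreal (f z) \<partial>lborel)"
  proof (intro nn_integral_cong)
    fix z
    show "ennreal (f z) = ennreal (f z) * indicator S' z"
      using f(3)[of z] subsetD[OF r(2), of z] by (cases "z \<in> ball y r") (simp_all del: mem_ball)
  qed
  then have "ennreal c * mass f \<le> ennreal (exp (- cost L)) * gauss_chain (weights L) (\<lambda>z. ennreal (f z)) x"
    using L(3)[of "\<lambda>z. ennreal (f z)"] by simp
  also have "\<dots> \<le> ennreal (semigroup t f x)"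
    using chain_semigroup_ge[OF L(1) x f(1,2)] L(2) by simp
  finally show "ennreal c * mass f \<le> ennreal (semigroup t f x)" .
qed

end

section \<open>Combining the lower bounds\<close>

lemma sqrt_power_eq_powr:
  assumes "0 < h" shows "sqrt h ^ n = h powr (real n / 2)"
  using assms by (simp add: powr_half_sqrt[symmetric] powr_power)

context schroedinger_growth
begin

lemma V_le:
  obtains K where "0 < K" "\<And>z. V z \<le> K * g (norm z)"
proof -
  have "bounded (V ` cball 0 1)" using V_bounded by (auto simp: locally_bounded_def)
  then obtain b where b: "\<And>z. norm z \<le> 1 \<Longrightarrow> V z \<le> b"
    unfolding bounded_iff by (force simp: abs_le_iff)
  show ?thesis
  proof
    show "0 < C2 + \<bar>b\<bar>" using C2_pos by linarith
    fix z :: 'a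
    have gz: "1 \<le> g (norm z)" by (simp add: g_ge_1)
    show "V z \<le> (C2 + \<bar>b\<bar>) * g (norm z)"
    proof (cases "norm z \<le> 1")
      case True
      have "V z \<le> (C2 + \<bar>b\<bar>) * 1" using b[OF True] C2_pos by simp
      also have "\<dots> \<le> (C2 + \<bar>b\<bar>) * g (norm z)" using gz C2_pos by (intro mult_left_mono) auto
      finally show ?thesis .
    next
      case False
      have "V z \<le> C2 * g (norm z)" using V_upper[of z] False by simp
      also have "\<dots> \<le> (C2 + \<bar>b\<bar>) * g (norm z)" using gz by (intro mult_right_mono) auto
      finally show ?thesis .
    qed
  qed
qed

lemma g_power_two_le: "0 \<le> r \<Longrightarrow> g (2 ^ n * r) \<le> c0 ^ n * g r"
proof (induction n)
  case (Suc n)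
  have "g (2 ^ Suc n * r) \<le> c0 * g (2 ^ n * r)"
    using g_double[of "2 ^ n * r"] Suc.prems by (simp add: mult.assoc)
  also have "\<dots> \<le> c0 * (c0 ^ n * g r)" using Suc c0_ge_1 by (intro mult_left_mono) auto
  finally show ?case by simp
qed simp

text \<open>With \<open>n\<close> the least integer above \<open>u\<close>,
  \<open>1 + u \<le> 2 ^ n\<close>, so \<open>n\<close> doublings bound \<open>g (R + u)\<close> by
  \<open>c0 ^ n * g (R + 1)\<close>. This is at most exponential in \<open>u\<close>, and the
  Gaussian factor beats it.\<close>

lemma g_add_gauss_le:
  obtains K where "0 < K" "\<And>R u. 0 \<le> R \<Longrightarrow> 0 \<le> u \<Longrightarrow> g (R + u) * exp (- u\<^sup>2 / 4) \<le> K * g R"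
proof
  define l where "l = ln c0"
  have l: "0 \<le> l" "c0 = exp l" using c0_ge_1 by (auto simp: l_def)
  let ?k = "c0\<^sup>2 + g 3"
  have k: "0 < ?k" using g_ge_1[of 3] zero_le_power2[of c0] by linarith
  show "0 < exp (l + l\<^sup>2) * ?k" using k by simp
  fix R u :: real assume R: "0 \<le> R" and u: "0 \<le> u"
  define n where "n = nat \<lceil>u\<rceil>"
  have n: "u \<le> real n" "real n \<le> u + 1" using u unfolding n_def by linarith+
  have "1 + u \<le> 2 ^ n"
  proof -
    have "real (Suc n) \<le> real (2 ^ n)" using less_exp[of n] by (intro of_nat_mono) (rule Suc_leI)
    with n show ?thesis by simp
  qed
  then have "(1 + u) * (R + 1) \<le> 2 ^ n * (R + 1)" using R by (intro mult_right_mono) auto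
  moreover have "0 \<le> u * R" using R u by simp
  ultimately have "R + u \<le> 2 ^ n * (R + 1)" by (simp add: algebra_simps)
  then have "g (R + u) \<le> g (2 ^ n * (R + 1))" using R u by (intro g_mono) auto
  also have "\<dots> \<le> c0 ^ n * g (R + 1)" using R by (intro g_power_two_le) auto
  also have "\<dots> \<le> c0 ^ n * (?k * g R)"
    using order_trans[OF g_mono[of "R + 1" "2 * R + 1"] g_affine_le[of R]] R c0_ge_1 by (intro mult_left_mono) auto
  also have "c0 ^ n = exp (real n * l)" unfolding l(2) by (simp add: exp_of_nat_mult)
  also have "exp (real n * l) * (?k * g R) \<le> exp ((u + 1) * l) * (?k * g R)"
    using n l k g_ge_1[OF R] by (intro mult_right_mono) (auto intro!: mult_right_mono)
  finally have "g (R + u) * exp (- u\<^sup>2 / 4) \<le> exp ((u + 1) * l) * (?k * g R) * exp (- u\<^sup>2 / 4)"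
    by (rule mult_right_mono) simp
  also have "\<dots> = exp ((u + 1) * l - u\<^sup>2 / 4) * (?k * g R)"
  proof -
    have "exp ((u + 1) * l - u\<^sup>2 / 4) = exp ((u + 1) * l) * exp (- u\<^sup>2 / 4)" by (simp add: mult_exp_exp)
    then show ?thesis by (simp only: mult_ac)
  qed
  also have "\<dots> \<le> exp (l + l\<^sup>2) * (?k * g R)"
  proof -
    \<comment> \<open>The square of \<open>u / 2 - l\<close> is nonnegative.\<close>
    have "(u + 1) * l - u\<^sup>2 / 4 \<le> l + l\<^sup>2"
      using zero_le_power2[of "u / 2 - l"] by (simp add: power2_eq_square algebra_simps)
    then show ?thesis using k g_ge_1[OF R] by (intro mult_right_mono) auto
  qed
  finally show "g (R + u) * exp (- u\<^sup>2 / 4) \<le> exp (l + l\<^sup>2) * ?k * g R" by (simp only: mult.assoc)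
qed

text \<open>The bridge mean is a convex combination of the endpoints, so it stays in the ball of
  radius \<open>R\<close>. Its variance is at most 1 because \<open>h \<le> 1\<close>, and
  \<open>g_add_gauss_le\<close> handles the deviation using one half of the Gaussian
  exponent.\<close>

lemma bridge_integral_le:
  obtains K where "0 < K" "\<And>h s R x y. h \<le> 1 \<Longrightarrow> 0 < s \<Longrightarrow> s < h \<Longrightarrow> norm x \<le> R \<Longrightarrow> norm y \<le> R \<Longrightarrow>
    mid_integral s (h - s) (\<lambda>z. ennreal (V z)) x y
      \<le> ennreal (K * g R) * ennreal (gauss h (y - x))"
proof -
  from V_le obtain Vc where Vc: "0 < Vc" "\<And>z. V z \<le> Vc * g (norm z)" by blast
  from g_add_gauss_le obtain Kg where Kg: "0 < Kg"
    "\<And>R u. 0 \<le> R \<Longrightarrow> 0 \<le> u \<Longrightarrow> g (R + u) * exp (- u\<^sup>2 / 4) \<le> Kg * g R" by blast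
  let ?q = "2 powr (real DIM('a) / 2)"
  show ?thesis
  proof
    show "0 < Vc * ?q * Kg" using Vc Kg by simp
    fix h s R :: real and x y :: 'a assume h: "h \<le> 1" and s: "0 < s" "s < h" and R: "norm x \<le> R" "norm y \<le> R"
    have R0: "0 \<le> R" using R(1) norm_ge_zero[of x] by linarith
    define w where "w = s * (h - s) / h"
    have w: "0 < w" "w \<le> 1"
    proof -
      show "0 < w" using s by (simp add: w_def)
      have "w \<le> h - s" using s by (simp add: w_def divide_le_eq mult.commute mult_left_mono)
      then show "w \<le> 1" using s h by linarith
    qed
    define m where "m = ((h - s) / h) *\<^sub>R x + (s / h) *\<^sub>R y"
    have m: "norm m \<le> R"
    proof -
      have "norm m \<le> (h - s) / h * norm x + s / h * norm y"
        unfolding m_def using s by (intro order_trans[OF norm_triangle_ineq]) auto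
      also have "\<dots> \<le> (h - s) / h * R + s / h * R" using s R by (intro add_mono mult_left_mono) auto
      also have "\<dots> = R" using s by (simp add: field_simps)
      finally show ?thesis .
    qed
    have pt: "gauss s (z - x) * V z * gauss (h - s) (y - z) \<le> Vc * ?q * Kg * g R * gauss h (y - x) * gauss (2 * w) (z - m)" for z
    proof -
      have "gauss s (z - x) * gauss (h - s) (y - z) = gauss h (y - x) * gauss w (z - m)"
        using gauss_bridge[of s "h - s" z x y] s by (simp add: w_def m_def)
      then have "gauss s (z - x) * V z * gauss (h - s) (y - z) = gauss h (y - x) * (gauss w (z - m) * V z)"
        by (simp add: mult_ac)
      also have "gauss w (z - m) * V z \<le> Vc * ?q * Kg * g R * gauss (2 * w) (z - m)"
      proof -
        let ?u = "norm (z - m)"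
        have "norm z \<le> R + ?u" using m norm_triangle_ineq[of m "z - m"] by simp
        then have "g (norm z) \<le> g (R + ?u)" by (intro g_mono) auto
        then have "V z \<le> Vc * g (R + ?u)" using Vc by (meson mult_left_mono less_imp_le order_trans)
        moreover have "exp (- ?u\<^sup>2 / (4 * w)) \<le> exp (- ?u\<^sup>2 / 4)"
        proof -
          have "?u\<^sup>2 / 4 \<le> ?u\<^sup>2 / (4 * w)" by (rule frac_le) (use w in auto)
          then show ?thesis by simp
        qed
        ultimately have "exp (- ?u\<^sup>2 / (4 * w)) * V z \<le> exp (- ?u\<^sup>2 / 4) * (Vc * g (R + ?u))"
          by (intro mult_mono) auto
        also have "\<dots> = Vc * (g (R + ?u) * exp (- ?u\<^sup>2 / 4))" by simp
        also have "\<dots> \<le> Vc * (Kg * g R)" using Kg(2)[OF R0, of ?u] Vc by (intro mult_left_mono) auto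
        finally have "?q * gauss (2 * w) (z - m) * (exp (- ?u\<^sup>2 / (4 * w)) * V z) \<le> ?q * gauss (2 * w) (z - m) * (Vc * (Kg * g R))"
          by (intro mult_left_mono) auto
        then show ?thesis unfolding gauss_double[OF w(1)] by (simp only: mult_ac)
      qed
      finally show ?thesis by (simp add: mult_left_mono) (simp add: mult_ac)
    qed
    have c: "0 \<le> Vc * ?q * Kg * g R * gauss h (y - x)"
      using Vc Kg g_ge_1[OF R0] by (intro mult_nonneg_nonneg) auto
    have "mid_integral s (h - s) (\<lambda>z. ennreal (V z)) x y
      \<le> (\<integral>\<^sup>+z. ennreal (Vc * ?q * Kg * g R * gauss h (y - x)) * ennreal (gauss (2 * w) (z - m)) \<partial>lborel)"
    proof (intro nn_integral_mono)
      fix z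
      show "ennreal (gauss s (z - x)) * ennreal (V z) * ennreal (gauss (h - s) (y - z))
        \<le> ennreal (Vc * ?q * Kg * g R * gauss h (y - x)) * ennreal (gauss (2 * w) (z - m))"
        using ennreal_leI[OF pt[of z]] c by (simp add: ennreal_mult[symmetric])
    qed
    also have "\<dots> = ennreal (Vc * ?q * Kg * g R * gauss h (y - x))"
      using w by (simp add: nn_integral_cmult nn_integral_gauss)
    also have "\<dots> = ennreal (Vc * ?q * Kg * g R) * ennreal (gauss h (y - x))"
      using Vc Kg g_ge_1[OF R0] by (intro ennreal_mult) auto
    finally show "mid_integral s (h - s) (\<lambda>z. ennreal (V z)) x y
      \<le> ennreal (Vc * ?q * Kg * g R) * ennreal (gauss h (y - x))" .
  qed
qed

text \<open>Endpoints moved by at most \<open>sqrt h\<close> change the distance by at most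
  \<open>2 * sqrt h\<close>, and the square of the sum over \<open>2 * h\<close> is at most
  \<open>(norm (a - b))\<^sup>2 / h + 4\<close>; this is the factor
  \<open>exp (- 4)\<close>.\<close>

lemma lower_one_step:
  obtains K where "0 < K" "\<And>h R a b r1 r2. 0 < h \<Longrightarrow> h \<le> 1 \<Longrightarrow> norm a \<le> R \<Longrightarrow> norm b \<le> R \<Longrightarrow>
    r1 \<le> sqrt h \<Longrightarrow> r2 \<le> sqrt h \<Longrightarrow>
    lower (ball a r1) h (ball b r2)
      ((2 * pi) powr (- real DIM('a) / 2) * exp (- 4) * h powr (- real DIM('a) / 2)
        * exp (- ((norm (a - b))\<^sup>2 / h + K * (h * g R))))"
proof -
  from bridge_integral_le obtain Kb where Kb: "0 < Kb" "\<And>h s R x y. h \<le> 1 \<Longrightarrow> 0 < s \<Longrightarrow> s < h \<Longrightarrow> norm x \<le> R \<Longrightarrow> norm y \<le> R \<Longrightarrow>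
    mid_integral s (h - s) (\<lambda>z. ennreal (V z)) x y
      \<le> ennreal (Kb * g R) * ennreal (gauss h (y - x))" by blast
  let ?k = "c0\<^sup>2 + g 3"
  have k: "0 < ?k" using g_ge_1[of 3] zero_le_power2[of c0] by linarith
  show ?thesis
  proof
    show "0 < Kb * ?k" using Kb k by simp
    fix h R r1 r2 :: real and a b :: 'a
    assume h: "0 < h" "h \<le> 1" and R: "norm a \<le> R" "norm b \<le> R" and r: "r1 \<le> sqrt h" "r2 \<le> sqrt h"
    have R0: "0 \<le> R" using R(1) norm_ge_zero[of a] by linarith
    have sh: "sqrt h \<le> 1" "0 < sqrt h" using h by auto
    \<comment> \<open>Points of the two balls have norm at most \<open>R + 1\<close> since
      \<open>sqrt h \<le> 1\<close>; \<open>g_affine_le\<close> returns to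
      \<open>g R\<close>.\<close>
    define K where "K = Kb * g (R + 1)"
    have K0: "0 \<le> K" unfolding K_def using Kb R0 g_ge_1[of "R + 1"] by simp
    have Kle: "K \<le> Kb * ?k * g R"
      using order_trans[OF g_mono[of "R + 1" "2 * R + 1"] g_affine_le[of R]] R0 Kb(1)
      unfolding K_def mult.assoc by (intro mult_left_mono) auto
    define L where "L = [(h, ball b r2, K)]"
    let ?c = "(2 * pi) powr (- real DIM('a) / 2) * exp (- 4) * h powr (- real DIM('a) / 2)
        * exp (- ((norm (a - b))\<^sup>2 / h + Kb * ?k * (h * g R)))"
    show "lower (ball a r1) h (ball b r2) ?c"
      unfolding lower_def
    proof (intro exI[of _ L] conjI ballI)
      show "L \<noteq> []" "duration L = h" by (auto simp: L_def duration_def)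
      have nb: "norm x \<le> R + 1" if "x \<in> ball c r" "r \<le> sqrt h" "norm c \<le> R" for x c r
      proof -
        have "norm (x - c) < r" using that(1) by (simp add: dist_norm norm_minus_commute)
        then show ?thesis using that(2,3) sh(1) norm_triangle_ineq2[of x c] by linarith
      qed
      show "chain (ball a r1) L (ball b r2)"
      proof -
        have "bridge_le (ball a r1) h (ball b r2) K"
          unfolding bridge_le_def K_def
        proof (intro ballI allI impI)
          fix x y s assume "x \<in> ball a r1" "y \<in> ball b r2" "0 < s \<and> s < h"
          then show "mid_integral s (h - s) (\<lambda>z. ennreal (V z)) x y
            \<le> ennreal (Kb * g (R + 1)) * ennreal (gauss h (y - x))"
            using nb r R by (intro Kb(2)[OF h(2)]) blast+
        qed
        then show ?thesis using h K0 by (simp add: L_def)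
      qed
      fix x and f :: "'a \<Rightarrow> ennreal" assume x: "x \<in> ball a r1" and f[measurable]: "f \<in> borel_measurable borel"
      define q where "q = (2 * pi) powr (- real DIM('a) / 2) * h powr (- real DIM('a) / 2) * exp (- 4 - (norm (a - b))\<^sup>2 / h)"
      have q: "q \<le> gauss h (y - x)" if y: "y \<in> ball b r2" for y
      proof -
        let ?D = "norm (a - b)"
        have "norm (y - x) = norm ((y - b) + (a - x) - (a - b))" by simp
        also have "\<dots> \<le> norm (y - b) + norm (a - x) + ?D"
          using norm_triangle_ineq4[of "(y - b) + (a - x)" "a - b"] norm_triangle_ineq[of "y - b" "a - x"] by linarith
        also have "\<dots> \<le> ?D + 2 * sqrt h"
          using x y r by (simp add: dist_norm norm_minus_commute)
        finally have "(norm (y - x))\<^sup>2 \<le> (?D + 2 * sqrt h)\<^sup>2" by (intro power_mono) auto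
        also have "\<dots> \<le> 2 * ?D\<^sup>2 + 8 * h"
        proof -
          have "0 \<le> (?D - 2 * sqrt h)\<^sup>2" by simp
          then show ?thesis using h by (simp add: power2_sum power2_diff power_mult_distrib)
        qed
        finally have "(norm (y - x))\<^sup>2 / (2 * h) \<le> (2 * ?D\<^sup>2 + 8 * h) / (2 * h)"
          using h by (intro divide_right_mono) auto
        also have "\<dots> = ?D\<^sup>2 / h + 4" using h by (simp add: field_simps)
        finally have e: "exp (- 4 - ?D\<^sup>2 / h) \<le> exp (- (norm (y - x))\<^sup>2 / (2 * h))" by simp
        have "(2 * pi * h) powr (- real DIM('a) / 2) = (2 * pi) powr (- real DIM('a) / 2) * h powr (- real DIM('a) / 2)"
          using h by (simp add: powr_mult)
        then show ?thesis unfolding q_def gauss_def using e by (simp only:) (intro mult_left_mono, auto)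
      qed
      have q0: "0 \<le> q" by (simp add: q_def)
      have cq: "?c \<le> exp (- cost L) * q"
      proof -
        have "h * K \<le> h * (Kb * ?k * g R)" using Kle h by (intro mult_left_mono) auto
        then have "exp (- (Kb * ?k * (h * g R))) \<le> exp (- cost L)" by (simp add: L_def cost_def mult_ac)
        then have "exp (- (Kb * ?k * (h * g R))) * q \<le> exp (- cost L) * q" using q0 by (intro mult_right_mono) auto
        moreover have "?c = exp (- (Kb * ?k * (h * g R))) * q"
          unfolding q_def by (simp add: exp_diff exp_minus exp_add field_simps)
        ultimately show ?thesis by simp
      qed
      have "ennreal ?c * (\<integral>\<^sup>+y\<in>ball b r2. f y \<partial>lborel) \<le> ennreal (exp (- cost L) * q) * (\<integral>\<^sup>+y\<in>ball b r2. f y \<partial>lborel)"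
        by (intro mult_right_mono ennreal_leI cq) auto
      also have "\<dots> = ennreal (exp (- cost L)) * (\<integral>\<^sup>+y. ennreal q * (f y * indicator (ball b r2) y) \<partial>lborel)"
      proof -
        have "(\<integral>\<^sup>+y. ennreal q * (f y * indicator (ball b r2) y) \<partial>lborel) = ennreal q * (\<integral>\<^sup>+y\<in>ball b r2. f y \<partial>lborel)"
          by (intro nn_integral_cmult borel_measurable_times_ennreal borel_measurable_indicator) auto
        then show ?thesis using q0 by (simp add: ennreal_mult mult.assoc)
      qed
      also have "\<dots> \<le> ennreal (exp (- cost L)) * gauss_chain (weights L) f x"
      proof (intro mult_left_mono)
        show "(\<integral>\<^sup>+y. ennreal q * (f y * indicator (ball b r2) y) \<partial>lborel) \<le> gauss_chain (weights L) f x"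
          unfolding L_def weights_def list.map gauss_chain.simps prod.case fst_conv snd_conv
        proof (intro nn_integral_mono)
          fix y
          show "ennreal q * (f y * indicator (ball b r2) y) \<le> ennreal (gauss h (y - x)) * (indicator (ball b r2) y * f y)"
          proof (cases "y \<in> ball b r2")
            case True
            then show ?thesis using q[OF True] by (auto intro!: mult_right_mono ennreal_leI)
          qed simp
        qed
      qed simp
      finally show "ennreal ?c * (\<integral>\<^sup>+y\<in>ball b r2. f y \<partial>lborel) \<le> ennreal (exp (- cost L)) * gauss_chain (weights L) f x" .
    qed
  qed
qed

text \<open>The intermediate centres are equally spaced on the segment from \<open>a\<close> to
  \<open>b\<close>. The volume of each intermediate ball, of order \<open>h^(d/2)\<close>, cancels
  one prefactor \<open>h^(-d/2)\<close>, so a further step costs only \<open>\<beta>\<close> and its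
  own exponent.\<close>

lemma lower_equal_steps:
  obtains K \<beta> where "0 < K" "0 < \<beta>" "\<beta> \<le> 1"
    "\<And>k h R \<delta> a b r. 0 < h \<Longrightarrow> h \<le> 1 \<Longrightarrow> norm a \<le> R \<Longrightarrow> norm b \<le> R \<Longrightarrow> 0 \<le> \<delta> \<Longrightarrow>
      norm (a - b) \<le> real (Suc k) * \<delta> \<Longrightarrow> r \<le> sqrt h \<Longrightarrow>
    lower (ball a (sqrt h)) (real (Suc k) * h) (ball b r)
      (h powr (- real DIM('a) / 2) * \<beta> ^ (Suc k) * (1 / unit_ball_vol (real DIM('a)))
        * exp (- (real (Suc k) * (\<delta>\<^sup>2 / h + K * (h * g R)))))"
proof -
  from lower_one_step obtain K where K: "0 < K" "\<And>h R a b r1 r2. 0 < h \<Longrightarrow> h \<le> 1 \<Longrightarrow> norm a \<le> R \<Longrightarrow> norm b \<le> R \<Longrightarrow>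
    r1 \<le> sqrt h \<Longrightarrow> r2 \<le> sqrt h \<Longrightarrow>
    lower (ball a r1) h (ball b r2)
      ((2 * pi) powr (- real DIM('a) / 2) * exp (- 4) * h powr (- real DIM('a) / 2)
        * exp (- ((norm (a - b))\<^sup>2 / h + K * (h * g R))))" by blast
  define \<beta>0 where "\<beta>0 = (2 * pi) powr (- real DIM('a) / 2) * exp (- 4)"
  define v where "v = unit_ball_vol (real DIM('a))"
  have v: "0 < v" by (simp add: v_def)
  have \<beta>0: "0 < \<beta>0" by (simp add: \<beta>0_def)
  \<comment> \<open>Writing the one-step constant as at least \<open>\<beta> / v\<close> makes each
    intermediate volume factor \<open>v\<close> cancel, so the constant after \<open>n\<close> steps
    is \<open>\<beta> ^ n / v\<close>.\<close>
  define \<beta> where "\<beta> = min 1 (\<beta>0 * v)"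
  have \<beta>: "0 < \<beta>" "\<beta> \<le> 1" "\<beta> * (1 / v) \<le> \<beta>0" using v \<beta>0 by (auto simp: \<beta>_def field_simps)
  show ?thesis
  proof (rule that[OF K(1) \<beta>(1,2)])
    fix k :: nat and h R \<delta> r :: real and a b :: 'a
    assume h: "0 < h" "h \<le> 1" and R: "norm a \<le> R" "norm b \<le> R" and \<delta>: "0 \<le> \<delta>"
      and ab: "norm (a - b) \<le> real (Suc k) * \<delta>" and r: "r \<le> sqrt h"
    define T where "T = h powr (- real DIM('a) / 2)"
    have T: "0 < T" using h by (simp add: T_def)
    have TT: "sqrt h ^ DIM('a) * T = 1"
      unfolding T_def sqrt_power_eq_powr[OF h(1)] using h by (simp add: powr_add[symmetric])
    define X where "X = \<delta>\<^sup>2 / h + K * (h * g R)"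
    have step: "lower (ball a' (sqrt h)) h (ball b' r') (T * \<beta> * (1 / v) * exp (- X))"
      if "norm a' \<le> R" "norm b' \<le> R" "norm (a' - b') \<le> \<delta>" "r' \<le> sqrt h" for a' b' :: 'a and r'
    proof (rule lower_mono[OF K(2)[OF h that(1,2) order_refl that(4)] order_refl])
      have "(norm (a' - b'))\<^sup>2 / h \<le> \<delta>\<^sup>2 / h" using that h by (intro divide_right_mono power_mono) auto
      then have "exp (- X) \<le> exp (- ((norm (a' - b'))\<^sup>2 / h + K * (h * g R)))" by (simp add: X_def)
      then have "\<beta> * (1 / v) * T * exp (- X) \<le> \<beta>0 * T * exp (- ((norm (a' - b'))\<^sup>2 / h + K * (h * g R)))"
        using \<beta> T \<beta>0 v by (intro mult_mono) auto
      then show "T * \<beta> * (1 / v) * exp (- X) \<le> (2 * pi) powr (- real DIM('a) / 2) * exp (- 4) * h powr (- real DIM('a) / 2)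
        * exp (- ((norm (a' - b'))\<^sup>2 / h + K * (h * g R)))"
        unfolding \<beta>0_def[symmetric] T_def[symmetric] by (simp add: mult_ac)
    qed
    have "lower (ball a (sqrt h)) (real (Suc k) * h) (ball b r) (T * \<beta> ^ (Suc k) * (1 / v) * exp (- (real (Suc k) * X)))"
      using R ab
    proof (induction k arbitrary: a)
      case 0
      then show ?case using step[of a b r] r by simp
    next
      case (Suc k)
      let ?n = "real (Suc (Suc k))"
      define a1 where "a1 = a + (1 / ?n) *\<^sub>R (b - a)"
      have a1: "a1 = (1 - 1 / ?n) *\<^sub>R a + (1 / ?n) *\<^sub>R b" unfolding a1_def by (simp add: algebra_simps del: of_nat_Suc)
      have n1: "norm a1 \<le> R"
      proof -
        have "norm a1 \<le> (1 - 1 / ?n) * norm a + (1 / ?n) * norm b"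
          unfolding a1 by (intro order_trans[OF norm_triangle_ineq]) (simp del: of_nat_Suc)
        also have "\<dots> \<le> (1 - 1 / ?n) * R + (1 / ?n) * R"
          using Suc.prems by (intro add_mono mult_left_mono) (auto simp del: of_nat_Suc)
        also have "\<dots> = R" by (simp add: algebra_simps del: of_nat_Suc)
        finally show ?thesis .
      qed
      have d1: "norm (a - a1) \<le> \<delta>"
      proof -
        have "norm (a - a1) = (1 / ?n) * norm (a - b)"
          unfolding a1_def by (simp add: norm_minus_commute del: of_nat_Suc)
        also have "\<dots> \<le> (1 / ?n) * (?n * \<delta>)" using Suc.prems by (intro mult_left_mono) auto
        finally show ?thesis by (simp del: of_nat_Suc)
      qed
      have d2: "norm (a1 - b) \<le> real (Suc k) * \<delta>"
      proof -
        have "a1 - b = (1 - 1 / ?n) *\<^sub>R (a - b)" unfolding a1_def by (simp add: algebra_simps del: of_nat_Suc)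
        then have "norm (a1 - b) = (1 - 1 / ?n) * norm (a - b)" by (simp del: of_nat_Suc)
        also have "\<dots> \<le> (1 - 1 / ?n) * (?n * \<delta>)" using Suc.prems by (intro mult_left_mono) (auto simp del: of_nat_Suc)
        also have "\<dots> = (?n - 1) * \<delta>" by (simp add: field_simps del: of_nat_Suc)
        finally show ?thesis by simp
      qed
      have st: "lower (ball a (sqrt h)) h (ball a1 (sqrt h)) (T * \<beta> * (1 / v) * exp (- X))"
        using Suc.prems n1 d1 by (intro step) auto
      have ih: "lower (ball a1 (sqrt h)) (real (Suc k) * h) (ball b r) (T * \<beta> ^ (Suc k) * (1 / v) * exp (- (real (Suc k) * X)))"
        using Suc.prems n1 d2 by (intro Suc.IH) auto
      have "lower (ball a (sqrt h)) (h + real (Suc k) * h) (ball b r)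
        (T * \<beta> * (1 / v) * exp (- X) * (T * \<beta> ^ (Suc k) * (1 / v) * exp (- (real (Suc k) * X))) * (v * sqrt h ^ DIM('a)))"
        using T \<beta> v h by (intro lower_comp[OF st ih]) (auto simp: emeasure_ball v_def)
      moreover have "h + real (Suc k) * h = ?n * h" by (simp add: algebra_simps)
      moreover have "T * \<beta> * (1 / v) * exp (- X) * (T * \<beta> ^ (Suc k) * (1 / v) * exp (- (real (Suc k) * X))) * (v * sqrt h ^ DIM('a))
        = (sqrt h ^ DIM('a) * T) * (T * \<beta> ^ Suc (Suc k) * (1 / v) * (exp (- X) * exp (- (real (Suc k) * X))))"
        using v by (simp add: field_simps)
      moreover have "exp (- X) * exp (- (real (Suc k) * X)) = exp (- (?n * X))"
        by (simp add: mult_exp_exp algebra_simps)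
      ultimately show ?case unfolding TT by (simp only: mult_1)
    qed
    then show "lower (ball a (sqrt h)) (real (Suc k) * h) (ball b r)
      (h powr (- real DIM('a) / 2) * \<beta> ^ (Suc k) * (1 / unit_ball_vol (real DIM('a)))
        * exp (- (real (Suc k) * (\<delta>\<^sup>2 / h + K * (h * g R)))))"
      unfolding T_def v_def X_def .
  qed
qed

text \<open>\<open>h\<close> is the length of a single step, so \<open>sqrt h\<close> is the usable
  radius; its lower bound controls how small the balls become.\<close>

abbreviation direct :: "real \<Rightarrow> real \<Rightarrow> real \<Rightarrow> real \<Rightarrow> 'a \<Rightarrow> 'a \<Rightarrow> bool" where
  "direct c K t R a b \<equiv> \<exists>h. 0 < h \<and> h \<le> t \<and> min t (1 / g R) / 2 \<le> h \<and>
    (\<forall>r\<le>sqrt h. lower (ball a (sqrt h)) t (ball b r)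
      (c * h powr (- real DIM('a) / 2) * exp (- ((norm (a - b))\<^sup>2 / t + K * (t * g R)))))"

text \<open>About \<open>t * g R\<close> steps give \<open>h * g R \<le> 1\<close>, hence
  \<open>h \<le> 1\<close>. The accumulated \<open>\<beta> ^ n\<close> is exponential in
  \<open>t * g R\<close> and joins the potential term of the exponent.\<close>

lemma lower_direct:
  obtains c K where "0 < c" "0 < K"
    "\<And>t R a b. 0 < t \<Longrightarrow> norm a \<le> R \<Longrightarrow> norm b \<le> R \<Longrightarrow>
      direct c K t R a b"
proof -
  from lower_equal_steps obtain K \<beta> where K: "0 < K" and \<beta>: "0 < \<beta>" "\<beta> \<le> 1" and low:
    "\<And>k h R \<delta> a b r. 0 < h \<Longrightarrow> h \<le> 1 \<Longrightarrow> norm a \<le> R \<Longrightarrow> norm b \<le> R \<Longrightarrow> 0 \<le> \<delta> \<Longrightarrow>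
      norm (a - b) \<le> real (Suc k) * \<delta> \<Longrightarrow> r \<le> sqrt h \<Longrightarrow>
    lower (ball a (sqrt h)) (real (Suc k) * h) (ball b r)
      (h powr (- real DIM('a) / 2) * \<beta> ^ (Suc k) * (1 / unit_ball_vol (real DIM('a)))
        * exp (- (real (Suc k) * (\<delta>\<^sup>2 / h + K * (h * g R)))))" by blast
  define v where "v = unit_ball_vol (real DIM('a))"
  have v: "0 < v" by (simp add: v_def)
  define l where "l = - ln \<beta>"
  have l: "0 \<le> l" "\<beta> = exp (- l)" using \<beta> by (auto simp: l_def)
  show ?thesis
  proof
    show "0 < exp (- l) * (1 / v)" using v by simp
    show "0 < K + l" using K l by simp
    fix t R :: real and a b :: 'a assume t: "0 < t" and R: "norm a \<le> R" "norm b \<le> R"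
    have R0: "0 \<le> R" using R(1) norm_ge_zero[of a] by linarith
    have gR: "1 \<le> g R" using g_ge_1[OF R0] .
    have tg: "0 < t * g R" using t gR by simp
    \<comment> \<open>\<open>Suc k\<close> is the least integer not below \<open>t * g R\<close>; it
      is at least 1 because \<open>t * g R > 0\<close>.\<close>
    define k where "k = nat \<lceil>t * g R\<rceil> - 1"
    have n: "t * g R \<le> real (Suc k)" "real (Suc k) \<le> t * g R + 1"
      using tg unfolding k_def by linarith+
    let ?n = "real (Suc k)"
    have n0: "0 < ?n" by simp
    define h where "h = t / ?n"
    have h0: "0 < h" using t by (simp add: h_def)
    have nh: "?n * h = t" by (simp add: h_def del: of_nat_Suc)
    have ht: "h \<le> t"
    proof -
      have "1 * h \<le> ?n * h" using h0 by (intro mult_right_mono) auto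
      then show ?thesis using nh by simp
    qed
    have hg: "h * g R \<le> 1"
      using n(1) n0 by (simp add: h_def divide_le_eq del: of_nat_Suc)
    have h1: "h \<le> 1"
    proof -
      have "h * 1 \<le> h * g R" using h0 gR by (intro mult_left_mono) auto
      with hg show ?thesis by simp
    qed
    have hlow: "min t (1 / g R) / 2 \<le> h"
    proof -
      have "?n \<le> 2 * max (t * g R) 1" using n(2) by auto
      moreover have "min t (1 / g R) * max (t * g R) 1 \<le> t"
        using t gR by (auto simp: min_def max_def field_simps)
      ultimately have "min t (1 / g R) * ?n \<le> 2 * t"
      proof -
        assume a1: "?n \<le> 2 * max (t * g R) 1" and a2: "min t (1 / g R) * max (t * g R) 1 \<le> t"
        have "0 \<le> min t (1 / g R)" using t gR by simp
        from mult_left_mono[OF a1 this] a2 show ?thesis by linarith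
      qed
      then show ?thesis unfolding h_def using n0 by (simp add: field_simps del: of_nat_Suc)
    qed
    define \<delta> where "\<delta> = norm (a - b) / ?n"
    have "lower (ball a (sqrt h)) t (ball b r)
          (exp (- l) * (1 / v) * h powr (- real DIM('a) / 2) * exp (- ((norm (a - b))\<^sup>2 / t + (K + l) * (t * g R))))"
      if r: "r \<le> sqrt h" for r
    proof (rule lower_mono[OF _ order_refl])
      show "lower (ball a (sqrt h)) t (ball b r) (h powr (- real DIM('a) / 2) * \<beta> ^ (Suc k) * (1 / v)
        * exp (- (?n * (\<delta>\<^sup>2 / h + K * (h * g R)))))"
        using low[OF h0 h1 R, of \<delta> k r] r unfolding nh v_def by (simp add: \<delta>_def del: of_nat_Suc)
      have e: "?n * (\<delta>\<^sup>2 / h + K * (h * g R)) = (norm (a - b))\<^sup>2 / t + K * (t * g R)"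
      proof -
        have "?n * (\<delta>\<^sup>2 / h) = (norm (a - b))\<^sup>2 / t"
          using t n0 by (simp add: \<delta>_def h_def power_divide power2_eq_square field_simps del: of_nat_Suc)
        moreover have "?n * (K * (h * g R)) = K * (?n * h * g R)" by (simp only: mult_ac)
        ultimately show ?thesis unfolding nh by (simp add: distrib_left del: of_nat_Suc)
      qed
      have "exp (- l) * exp (- (l * (t * g R))) \<le> \<beta> ^ Suc k"
      proof -
        have "\<beta> ^ Suc k = exp (- (?n * l))" unfolding l(2) by (simp add: exp_of_nat_mult[symmetric] del: of_nat_Suc power_Suc)
        moreover have "?n * l \<le> (t * g R + 1) * l" using n l by (intro mult_right_mono) auto
        ultimately show ?thesis by (simp add: mult_exp_exp algebra_simps del: of_nat_Suc)
      qed
      then have "(h powr (- real DIM('a) / 2) * (1 / v) * exp (- ((norm (a - b))\<^sup>2 / t + K * (t * g R)))) * (exp (- l) * exp (- (l * (t * g R))))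
        \<le> (h powr (- real DIM('a) / 2) * (1 / v) * exp (- ((norm (a - b))\<^sup>2 / t + K * (t * g R)))) * \<beta> ^ Suc k"
        using v by (intro mult_left_mono) auto
      moreover have "exp (- ((norm (a - b))\<^sup>2 / t + (K + l) * (t * g R)))
        = exp (- ((norm (a - b))\<^sup>2 / t + K * (t * g R))) * exp (- (l * (t * g R)))"
        by (simp add: mult_exp_exp algebra_simps)
      ultimately show "exp (- l) * (1 / v) * h powr (- real DIM('a) / 2) * exp (- ((norm (a - b))\<^sup>2 / t + (K + l) * (t * g R)))
        \<le> h powr (- real DIM('a) / 2) * \<beta> ^ (Suc k) * (1 / v) * exp (- (?n * (\<delta>\<^sup>2 / h + K * (h * g R))))"
        unfolding e by (simp only: mult_ac)
    qed
    with h0 ht hlow show "\<exists>h. 0 < h \<and> h \<le> t \<and> min t (1 / g R) / 2 \<le> h \<and>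
        (\<forall>r\<le>sqrt h. lower (ball a (sqrt h)) t (ball b r)
          (exp (- l) * (1 / v) * h powr (- real DIM('a) / 2) * exp (- ((norm (a - b))\<^sup>2 / t + (K + l) * (t * g R)))))"
      by blast
  qed
qed

text \<open>Equal radii at both ends, and all smaller ones, allow two such bounds to be joined at a
  common ball; \<open>q\<close> limits the volume lost in doing so.\<close>

abbreviation lower_balls :: "'a \<Rightarrow> real \<Rightarrow> 'a \<Rightarrow> real \<Rightarrow> real \<Rightarrow> bool" where
  "lower_balls x t y q c \<equiv> \<exists>\<rho>>0. q \<le> \<rho>\<^sup>2 \<and>
    (\<forall>r. 0 < r \<and> r \<le> \<rho> \<longrightarrow> lower (ball x r) t (ball y r) c)"

text \<open>The stages meet in a ball of radius \<open>sqrt (min h1 h2)\<close>. Its volume cancels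
  the prefactor with the smaller of \<open>h1\<close> and \<open>h2\<close>; the other one is at
  least \<open>(t1 + t2)^(-d/2)\<close>.\<close>

lemma lower_two_stage:
  obtains c K where "0 < c" "0 < K"
    "\<And>t1 t2 R1 R2 x y z. 0 < t1 \<Longrightarrow> 0 < t2 \<Longrightarrow> norm x \<le> R1 \<Longrightarrow> norm y \<le> R1 \<Longrightarrow> norm y \<le> R2 \<Longrightarrow> norm z \<le> R2 \<Longrightarrow>
      lower_balls x (t1 + t2) z (min (min t1 (1 / g R1)) (min t2 (1 / g R2)) / 2) (c * (t1 + t2) powr (- real DIM('a) / 2)
            * exp (- ((norm (x - y))\<^sup>2 / t1 + K * (t1 * g R1) + ((norm (y - z))\<^sup>2 / t2 + K * (t2 * g R2)))))"
proof -
  from lower_direct obtain c K where c: "0 < c" and K: "0 < K" and low: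
    "\<And>t R a b. 0 < t \<Longrightarrow> norm a \<le> R \<Longrightarrow> norm b \<le> R \<Longrightarrow>
      direct c K t R a b"
    by blast
  define v where "v = unit_ball_vol (real DIM('a))"
  have v: "0 < v" by (simp add: v_def)
  show ?thesis
  proof
    show "0 < c * c * v" using c v by simp
    show "0 < K" by (fact K)
    fix t1 t2 R1 R2 :: real and x y z :: 'a
    assume t: "0 < t1" "0 < t2" and R: "norm x \<le> R1" "norm y \<le> R1" "norm y \<le> R2" "norm z \<le> R2"
    from low[OF t(1) R(1,2)] obtain h1 where h1: "0 < h1" "h1 \<le> t1" "min t1 (1 / g R1) / 2 \<le> h1"
      "\<And>r. r \<le> sqrt h1 \<Longrightarrow> lower (ball x (sqrt h1)) t1 (ball y r)
          (c * h1 powr (- real DIM('a) / 2) * exp (- ((norm (x - y))\<^sup>2 / t1 + K * (t1 * g R1))))" by blast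
    from low[OF t(2) R(3,4)] obtain h2 where h2: "0 < h2" "h2 \<le> t2" "min t2 (1 / g R2) / 2 \<le> h2"
      "\<And>r. r \<le> sqrt h2 \<Longrightarrow> lower (ball y (sqrt h2)) t2 (ball z r)
          (c * h2 powr (- real DIM('a) / 2) * exp (- ((norm (y - z))\<^sup>2 / t2 + K * (t2 * g R2))))" by blast
    define \<rho> where "\<rho> = sqrt (min h1 h2)"
    have \<rho>: "0 < \<rho>" "\<rho> \<le> sqrt h1" "\<rho> \<le> sqrt h2" "\<rho>\<^sup>2 = min h1 h2"
      using h1(1) h2(1) by (auto simp: \<rho>_def)
    define e where "e = real DIM('a) / 2"
    define X1 where "X1 = (norm (x - y))\<^sup>2 / t1 + K * (t1 * g R1)"
    define X2 where "X2 = (norm (y - z))\<^sup>2 / t2 + K * (t2 * g R2)"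
    have pre: "(t1 + t2) powr (- e) \<le> h1 powr (- e) * h2 powr (- e) * \<rho> ^ DIM('a)"
    proof -
      have m: "\<rho> ^ DIM('a) = (min h1 h2) powr e"
        unfolding \<rho>_def e_def using h1(1) h2(1) by (intro sqrt_power_eq_powr) auto
      have "h1 powr (- e) * h2 powr (- e) * (min h1 h2) powr e = (max h1 h2) powr (- e)"
      proof (cases "h1 \<le> h2")
        case True
        then have "h1 powr (- e) * h2 powr (- e) * (min h1 h2) powr e = h2 powr (- e) * (h1 powr (- e) * h1 powr e)"
          by (simp add: min_def)
        also have "h1 powr (- e) * h1 powr e = 1" using h1(1) by (simp add: powr_add[symmetric])
        finally show ?thesis using True by (simp add: max_def)
      next
        case False
        then have "h1 powr (- e) * h2 powr (- e) * (min h1 h2) powr e = h1 powr (- e) * (h2 powr (- e) * h2 powr e)"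
          by (simp add: min_def)
        also have "h2 powr (- e) * h2 powr e = 1" using h2(1) by (simp add: powr_add[symmetric])
        finally show ?thesis using False by (simp add: max_def)
      qed
      moreover have "(t1 + t2) powr (- e) \<le> (max h1 h2) powr (- e)"
        using h1 h2 t by (intro powr_mono2') (auto simp: e_def)
      ultimately show ?thesis unfolding m by simp
    qed
    have "lower (ball x r) (t1 + t2) (ball z r) (c * c * v * (t1 + t2) powr (- e) * exp (- (X1 + X2)))"
      if r: "0 < r" "r \<le> \<rho>" for r
    proof (rule lower_mono)
      show "lower (ball x (sqrt h1)) (t1 + t2) (ball z r)
        (c * h1 powr (- e) * exp (- X1) * (c * h2 powr (- e) * exp (- X2)) * (v * \<rho> ^ DIM('a)))"
      proof (rule lower_comp)
        show "lower (ball x (sqrt h1)) t1 (ball y \<rho>) (c * h1 powr (- e) * exp (- X1))"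
          using h1(4)[OF \<rho>(2)] by (simp add: e_def X1_def)
        show "lower (ball y \<rho>) t2 (ball z r) (c * h2 powr (- e) * exp (- X2))"
        proof (rule lower_mono[OF h2(4)])
          show "r \<le> sqrt h2" "ball y \<rho> \<subseteq> ball y (sqrt h2)" using r \<rho> by (auto intro: subset_ball)
        qed (simp add: e_def X2_def)
        show "ennreal (v * \<rho> ^ DIM('a)) \<le> emeasure lborel (ball y \<rho>)"
          using \<rho> by (simp add: emeasure_ball v_def)
      qed (use c v \<rho> in auto)
      show "ball x r \<subseteq> ball x (sqrt h1)" using r \<rho> by (intro subset_ball) auto
      have "c * c * v * exp (- (X1 + X2)) * (t1 + t2) powr (- e)
        \<le> c * c * v * exp (- (X1 + X2)) * (h1 powr (- e) * h2 powr (- e) * \<rho> ^ DIM('a))"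
        using c v by (intro mult_left_mono pre) auto
      moreover have "exp (- (X1 + X2)) = exp (- X1) * exp (- X2)" by (simp add: mult_exp_exp)
      ultimately show "c * c * v * (t1 + t2) powr (- e) * exp (- (X1 + X2))
        \<le> c * h1 powr (- e) * exp (- X1) * (c * h2 powr (- e) * exp (- X2)) * (v * \<rho> ^ DIM('a))"
        by (simp add: mult_ac)
    qed
    moreover have "min (min t1 (1 / g R1)) (min t2 (1 / g R2)) / 2 \<le> \<rho>\<^sup>2"
      unfolding \<rho>(4)
      using h1(3) h2(3) min.cobounded1[of "min t1 (1 / g R1)" "min t2 (1 / g R2)"]
        min.cobounded2[of "min t1 (1 / g R1)" "min t2 (1 / g R2)"]
      by (intro min.boundedI) linarith+
    ultimately show "lower_balls x (t1 + t2) z (min (min t1 (1 / g R1)) (min t2 (1 / g R2)) / 2) (c * c * v * (t1 + t2) powr (- real DIM('a) / 2)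
            * exp (- ((norm (x - y))\<^sup>2 / t1 + K * (t1 * g R1) + ((norm (y - z))\<^sup>2 / t2 + K * (t2 * g R2)))))"
      using \<rho>(1) unfolding X1_def X2_def e_def minus_divide_left by blast
  qed
qed

text \<open>Waiting at the endpoint of smaller norm costs a multiple of \<open>t * g a\<close>.
  Crossing in time \<open>s = m / G\<close> costs at most a multiple of
  \<open>D * sqrt G + 1\<close>. Without enough time to wait, the straight path is already
  cheap.\<close>

lemma lower_E:
  obtains c K where "0 < c" "0 < K"
    "\<And>t x y. 0 < t \<Longrightarrow> lower_balls x t y (min t (1 / g (max (norm x) (norm y))) / 4) (c * t powr (- real DIM('a) / 2) * exp (- K * E g t x y))"
proof -
  from lower_direct obtain ca Ka where ca: "0 < ca" and Ka: "0 < Ka" and lowa: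
    "\<And>t R a b. 0 < t \<Longrightarrow> norm a \<le> R \<Longrightarrow> norm b \<le> R \<Longrightarrow>
      direct ca Ka t R a b"
    by blast
  from lower_two_stage obtain cb Kb where cb: "0 < cb" and Kb: "0 < Kb" and lowb:
    "\<And>t1 t2 R1 R2 x y z. 0 < t1 \<Longrightarrow> 0 < t2 \<Longrightarrow> norm x \<le> R1 \<Longrightarrow> norm y \<le> R1 \<Longrightarrow> norm y \<le> R2 \<Longrightarrow> norm z \<le> R2 \<Longrightarrow>
      lower_balls x (t1 + t2) z (min (min t1 (1 / g R1)) (min t2 (1 / g R2)) / 2) (cb * (t1 + t2) powr (- real DIM('a) / 2)
            * exp (- ((norm (x - y))\<^sup>2 / t1 + Kb * (t1 * g R1) + ((norm (y - z))\<^sup>2 / t2 + Kb * (t2 * g R2)))))"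
    by blast
  define K where "K = 1 + 2 * Ka + Kb"
  define c where "c = min (ca * exp (- 2 * Ka)) (cb * exp (- Kb))"
  have comb1: "u1 + 2 * Ka * u3 \<le> K * u1 + K * u2 + K * u3"
    and comb2: "Kb * u2 + u3 + Kb * u3 \<le> K * u1 + K * u2 + K * u3"
    if "0 \<le> u1" "0 \<le> u2" "0 \<le> u3" for u1 u2 u3
  proof -
    have "0 \<le> Ka * u1" "0 \<le> Ka * u2" "0 \<le> Ka * u3" "0 \<le> Kb * u1" "0 \<le> Kb * u2" "0 \<le> Kb * u3"
      using that Ka Kb by auto
    then show "u1 + 2 * Ka * u3 \<le> K * u1 + K * u2 + K * u3" "Kb * u2 + u3 + Kb * u3 \<le> K * u1 + K * u2 + K * u3"
      using that unfolding K_def distrib_right mult.assoc by linarith+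
  qed
  show ?thesis
  proof
    show "0 < c" "0 < K" using ca cb Ka Kb by (auto simp: c_def K_def)
    fix t :: real and x y :: 'a assume t: "0 < t"
    define a where "a = min (norm x) (norm y)"
    define b where "b = max (norm x) (norm y)"
    define G where "G = g b"
    define D where "D = norm (x - y)"
    \<comment> \<open>The maximum with 1 keeps the crossing time \<open>m / G\<close> at least
      \<open>1 / G\<close> even when \<open>x\<close> and \<open>y\<close> coincide, so the balls do
      not degenerate.\<close>
    define m where "m = max (D * sqrt G) 1"
    have ab: "0 \<le> a" "a \<le> b" "norm x \<le> b" "norm y \<le> b" by (auto simp: a_def b_def)
    have ga: "1 \<le> g a" using ab by (intro g_ge_1)
    have gaG: "g a \<le> G" unfolding G_def using ab by (intro g_mono)
    have G: "1 \<le> G" using ga gaG by simp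
    have sG: "sqrt G * sqrt G = G" "0 < sqrt G" using G by auto
    have D: "0 \<le> D" by (simp add: D_def)
    have DG: "0 \<le> D * sqrt G" using D sG by simp
    have m: "1 \<le> m" "D * sqrt G \<le> m" "m \<le> D * sqrt G + 1" using DG by (auto simp: m_def)
    have E: "E g t x y = D\<^sup>2 / t + t * g a + D * sqrt G"
      unfolding E_def min_max_g G_def a_def b_def D_def by simp
    have tga: "0 \<le> t * g a" using t ga by simp
    have Dt: "0 \<le> D\<^sup>2 / t" using t by simp
    define T where "T = t powr (- real DIM('a) / 2)"
    have T: "0 < T" using t by (simp add: T_def)
    show "lower_balls x t y (min t (1 / g (max (norm x) (norm y))) / 4) (c * t powr (- real DIM('a) / 2) * exp (- K * E g t x y))"
      unfolding b_def[symmetric] G_def[symmetric] T_def[symmetric]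
    proof (cases "t * G \<le> 2 * m")
      \<comment> \<open>Here \<open>t * G\<close> is at most \<open>2 * (D * sqrt G + 1)\<close>, so
        even the rate at the larger norm fits into \<open>E\<close> up to a constant.\<close>
      case True
      from lowa[OF t ab(3,4)] obtain h where h: "0 < h" "h \<le> t" "min t (1 / G) / 2 \<le> h"
        "\<And>r. r \<le> sqrt h \<Longrightarrow> lower (ball x (sqrt h)) t (ball y r)
          (ca * h powr (- real DIM('a) / 2) * exp (- (D\<^sup>2 / t + Ka * (t * G))))"
        unfolding G_def D_def by blast
      have le: "c * T * exp (- K * E g t x y) \<le> ca * h powr (- real DIM('a) / 2) * exp (- (D\<^sup>2 / t + Ka * (t * G)))"
      proof -
        have "t * G \<le> 2 * (D * sqrt G) + 2" using True m by linarith
        then have "Ka * (t * G) \<le> Ka * (2 * (D * sqrt G) + 2)" using Ka by (intro mult_left_mono) auto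
        moreover have "D\<^sup>2 / t + 2 * Ka * (D * sqrt G) \<le> K * E g t x y"
        proof -
          have "D\<^sup>2 / t + 2 * Ka * (D * sqrt G) \<le> K * (D\<^sup>2 / t) + K * (t * g a) + K * (D * sqrt G)"
            by (rule comb1[OF Dt tga DG])
          then show ?thesis unfolding E by (simp add: distrib_left)
        qed
        ultimately have "- K * E g t x y - 2 * Ka \<le> - (D\<^sup>2 / t + Ka * (t * G))"
          by (simp add: algebra_simps)
        then have "exp (- 2 * Ka) * exp (- K * E g t x y) \<le> exp (- (D\<^sup>2 / t + Ka * (t * G)))"
          by (simp add: mult_exp_exp)
        moreover have "T \<le> h powr (- real DIM('a) / 2)"
          unfolding T_def using h by (intro powr_mono2') auto
        ultimately have "(ca * T) * (exp (- 2 * Ka) * exp (- K * E g t x y)) \<le> (ca * h powr (- real DIM('a) / 2)) * exp (- (D\<^sup>2 / t + Ka * (t * G)))"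
          using ca T by (intro mult_mono) auto
        moreover have "c * (T * exp (- K * E g t x y)) \<le> ca * exp (- 2 * Ka) * (T * exp (- K * E g t x y))"
          using T by (intro mult_right_mono) (auto simp: c_def)
        ultimately show ?thesis by (simp add: mult_ac)
      qed
      have "lower (ball x r) t (ball y r) (c * T * exp (- K * E g t x y))" if "0 < r" "r \<le> sqrt h" for r
        using that by (intro lower_mono[OF h(4) _ le] subset_ball) auto
      moreover have "min t (1 / G) / 4 \<le> (sqrt h)\<^sup>2" using h t G by (simp add: min_def split: if_splits)
      ultimately show "lower_balls x t y (min t (1 / G) / 4) (c * T * exp (- K * E g t x y))"
        using h(1) by (intro exI[of _ "sqrt h"]) auto
    next
      case False
      define s where "s = m / G"
      have sG': "s * G = m" using G by (simp add: s_def)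
      have s: "0 < s" "1 / G \<le> s" using m G by (auto simp: s_def divide_right_mono)
      have ts: "2 * s < t"
      proof -
        have "2 * s * G < t * G" using False sG' by simp
        then show ?thesis using G by simp
      qed
      have Ds: "D\<^sup>2 / s \<le> D * sqrt G"
      proof -
        have "D\<^sup>2 * G = (D * sqrt G) * (D * sqrt G)" using sG(1) by (simp add: power2_eq_square mult_ac)
        also have "\<dots> \<le> (D * sqrt G) * m" using DG m by (intro mult_left_mono) auto
        finally have "D\<^sup>2 * G \<le> D * sqrt G * s * G" by (simp add: sG' mult.assoc)
        then have "D\<^sup>2 \<le> D * sqrt G * s" using G by simp
        then show ?thesis using s by (simp add: divide_le_eq)
      qed
      define X where "X = Kb * ((t - s) * g a) + (D\<^sup>2 / s + Kb * (s * G))"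
      have cost: "X \<le> K * E g t x y + Kb"
      proof -
        have "(t - s) * g a \<le> t * g a" using s ga by (intro mult_right_mono) auto
        then have "Kb * ((t - s) * g a) \<le> Kb * (t * g a)" using Kb by (intro mult_left_mono) auto
        moreover have "Kb * (s * G) \<le> Kb * (D * sqrt G + 1)" unfolding sG' using m Kb by (intro mult_left_mono) auto
        moreover have "Kb * (t * g a) + D * sqrt G + Kb * (D * sqrt G) \<le> K * (D\<^sup>2 / t) + K * (t * g a) + K * (D * sqrt G)"
          by (rule comb2[OF Dt tga DG])
        ultimately show ?thesis using Ds unfolding E X_def by (simp add: distrib_left)
      qed
      have le: "c * T * exp (- K * E g t x y) \<le> cb * T * exp (- X)"
      proof -
        have "exp (- Kb) * exp (- K * E g t x y) \<le> exp (- X)"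
          using cost by (simp add: mult_exp_exp)
        then have "(cb * T) * (exp (- Kb) * exp (- K * E g t x y)) \<le> (cb * T) * exp (- X)"
          using cb T by (intro mult_left_mono) auto
        moreover have "c * (T * exp (- K * E g t x y)) \<le> cb * exp (- Kb) * (T * exp (- K * E g t x y))"
          using T by (intro mult_right_mono) (auto simp: c_def)
        ultimately show ?thesis by (simp add: mult_ac)
      qed
      have rad: "min t (1 / G) / 4 \<le> min (min (t - s) (1 / g a)) (min s (1 / G)) / 2"
      proof -
        have "1 / G \<le> 1 / g a" using ga gaG by (intro frac_le) auto
        moreover have "0 < 1 / G" using G by simp
        moreover have "min t i / 4 \<le> min (min (t - s) j) (min s i) / 2" if "i \<le> j" "0 < i" "i \<le> s" for i j
          using that s(1) ts by (auto simp: min_def)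
        ultimately show ?thesis using s by blast
      qed
      have "lower_balls x t y (min (min (t - s) (1 / g a)) (min s (1 / G)) / 2) (cb * T * exp (- X))"
      proof (cases "norm x \<le> norm y")
        case True
        then have "a = norm x" "b = norm y" by (auto simp: a_def b_def)
        then show ?thesis
          using lowb[of "t - s" s x a x b y] s ts ab unfolding X_def G_def D_def T_def by simp
      next
        \<comment> \<open>Now \<open>y\<close> has the smaller norm, so the crossing comes first and
          the waiting second.\<close>
        case False
        then have "a = norm y" "b = norm x" by (auto simp: a_def b_def)
        then show ?thesis
          using lowb[of s "t - s" x b y a y] s ts ab unfolding X_def G_def D_def T_def
          by (simp add: min.commute add_ac)
      qed
      then show "lower_balls x t y (min t (1 / G) / 4) (c * T * exp (- K * E g t x y))"
        using rad le by (meson order_trans lower_mono order_refl)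
    qed
  qed
qed

lemma kernel_lower_short_time:
  obtains c1 c2 where "0 < c1" "0 < c2"
    "\<And>x y t. 0 < t \<Longrightarrow> c1 * t powr (- real DIM('a) / 2) * exp (- c2 * E g t x y) \<le> p t x y"
proof -
  from lower_E obtain c K where cK: "0 < c" "0 < K" and low:
    "\<And>t x y. 0 < t \<Longrightarrow> lower_balls x t y (min t (1 / g (max (norm x) (norm y))) / 4) (c * t powr (- real DIM('a) / 2) * exp (- K * E g t x y))" by blast
  show ?thesis
  proof (rule that[OF cK])
    fix x y :: 'a and t :: real assume t: "0 < t"
    from low[OF t, of x y] obtain \<rho> where "0 < \<rho>" "lower (ball x \<rho>) t (ball y \<rho>)
          (c * t powr (- real DIM('a) / 2) * exp (- K * E g t x y))" by blast
    then show "c * t powr (- real DIM('a) / 2) * exp (- K * E g t x y) \<le> p t x y"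
      using t by (intro lower_kernel[of "ball x \<rho>" t "ball y \<rho>" _ x \<rho>]) auto
  qed
qed

text \<open>Each half of the path joins an endpoint to the origin, where the smaller value of
  \<open>g\<close> is \<open>g 0\<close>; hence its exponent \<open>E\<close> is at most a multiple
  of \<open>Q\<close>, the negative logarithm of
  \<open>exp (- t) * \<psi> g t x * \<psi> g t y\<close>.\<close>

lemma kernel_lower_long_time:
  obtains c5 c6 where "0 < c5" "0 < c6"
    "\<And>x y t. 0 < t \<Longrightarrow> c5 * (exp (- t) * \<psi> g t x * \<psi> g t y) powr c6 \<le> p t x y"
proof -
  from lower_E obtain c K where cK: "0 < c" "0 < K" and low:
    "\<And>t x y. 0 < t \<Longrightarrow> lower_balls x t y (min t (1 / g (max (norm x) (norm y))) / 4) (c * t powr (- real DIM('a) / 2) * exp (- K * E g t x y))" by blast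
  define v where "v = unit_ball_vol (real DIM('a))"
  have v: "0 < v" by (simp add: v_def)
  define e where "e = real DIM('a) / 2"
  have e: "0 < e" by (simp add: e_def)
  \<comment> \<open>The three terms of \<open>E (t / 2) z 0\<close> contribute 2, \<open>g 0\<close>
    and 1.\<close>
  define K1 where "K1 = 3 + g 0"
  have g0: "1 \<le> g 0" by (simp add: g_ge_1)
  \<comment> \<open>The summands pay for the two prefactors, the two exponents \<open>E\<close>, and
    the volume of the middle ball.\<close>
  define c6 where "c6 = 2 * e + 2 * (K * K1) + 4 * real DIM('a)"
  show ?thesis
  proof
    show "0 < c * c * v" using cK v by simp
    show "0 < c6" using e cK g0 by (simp add: c6_def K1_def add_pos_pos)
    fix x y :: 'a and t :: real assume t: "0 < t"
    define A where "A z = travel z" for z :: 'a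
    define S where "S z = A z + (1 + norm z)\<^sup>2 / t" for z :: 'a
    define Q where "Q = t + (S x + S y)"
    have gz: "1 \<le> sqrt (g (norm z))" for z :: 'a using g_ge_1[of "norm z"] by simp
    have A: "1 \<le> A z" "norm z * sqrt (g (norm z)) \<le> A z" "sqrt (g (norm z)) \<le> A z" for z
      using gz[of z] mult_mono[of 1 "1 + norm z" 1 "sqrt (g (norm z))"]
      by (auto simp: A_def distrib_right)
    have S: "A z \<le> S z" "(1 + norm z)\<^sup>2 / t \<le> S z" "0 \<le> S z" for z
      using A(1)[of z] t by (auto simp: S_def add_nonneg_nonneg)
    have Q: "t \<le> Q" "S x \<le> Q" "S y \<le> Q" "1 \<le> Q"
      using S[of x] S[of y] A(1)[of x] t unfolding Q_def by linarith+
    have T: "exp (- (e * Q)) \<le> (t / 2) powr (- e)"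
    proof -
      have "ln (t / 2) \<le> t / 2" using ln_le_minus_one[of "t / 2"] t by linarith
      also have "\<dots> \<le> Q" using Q t by linarith
      finally have "e * ln (t / 2) \<le> e * Q" using e by (intro mult_left_mono) auto
      then show ?thesis using t by (simp add: powr_def)
    qed
    have Eb: "E g (t / 2) z 0 \<le> K1 * Q" "E g (t / 2) 0 z \<le> K1 * Q" "1 / (4 * Q) \<le> \<rho>"
      if z: "S z \<le> Q" and \<rho>: "0 < \<rho>" "min (t / 2) (1 / g (norm z)) / 4 \<le> \<rho>\<^sup>2" for z \<rho>
    proof -
      have gz0: "g 0 \<le> g (norm z)" by (intro g_mono) auto
      have "(norm z)\<^sup>2 / (t / 2) \<le> 2 * Q"
      proof -
        have "(norm z)\<^sup>2 / t \<le> (1 + norm z)\<^sup>2 / t" using t by (intro divide_right_mono power_mono) auto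
        with S(2)[of z] z have "(norm z)\<^sup>2 / t \<le> Q" by linarith
        then have "2 * ((norm z)\<^sup>2 / t) \<le> 2 * Q" by (rule mult_left_mono) simp
        moreover have "(norm z)\<^sup>2 / (t / 2) = 2 * ((norm z)\<^sup>2 / t)" by simp
        ultimately show ?thesis by (simp only:)
      qed
      moreover have "t / 2 * g 0 \<le> g 0 * Q"
      proof -
        have "t / 2 * g 0 \<le> Q * g 0" using Q t g0 by (intro mult_right_mono) auto
        then show ?thesis by (simp add: mult.commute)
      qed
      moreover have "norm z * sqrt (g (norm z)) \<le> Q" using A(2)[of z] S(1)[of z] z by linarith
      ultimately have "(norm z)\<^sup>2 / (t / 2) + t / 2 * g 0 + norm z * sqrt (g (norm z)) \<le> K1 * Q"
        unfolding K1_def distrib_right by linarith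
      then show "E g (t / 2) z 0 \<le> K1 * Q" "E g (t / 2) 0 z \<le> K1 * Q"
        unfolding E_def using max_absorb1[OF gz0] max_absorb2[OF gz0] min_absorb1[OF gz0] min_absorb2[OF gz0]
        by simp_all
      show "1 / (4 * Q) \<le> \<rho>"
      proof (rule power2_le_imp_le)
        have "1 / t \<le> Q"
        proof -
          have "1 / t \<le> (1 + norm z)\<^sup>2 / t" using t by (intro divide_right_mono) (auto simp: power2_eq_square algebra_simps)
          then show ?thesis using S(2)[of z] z by linarith
        qed
        then have "1 \<le> Q * t" using t by (simp add: field_simps)
        then have "1 * 1 \<le> (Q * t) * Q" using Q by (intro mult_mono) auto
        then have 1: "1 / (4 * Q)\<^sup>2 \<le> t / 2 / 4"
          using Q by (simp add: field_simps power2_eq_square)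
        have "sqrt (g (norm z)) \<le> Q" using A(3)[of z] S(1)[of z] z by linarith
        then have "(sqrt (g (norm z)))\<^sup>2 \<le> Q\<^sup>2" using gz[of z] by (intro power_mono) auto
        then have "g (norm z) \<le> Q\<^sup>2" using g_ge_1[of "norm z"] by simp
        then have "4 * g (norm z) \<le> (4 * Q)\<^sup>2" using g_ge_1[of "norm z"] by (simp add: power_mult_distrib)
        then have 2: "1 / (4 * Q)\<^sup>2 \<le> 1 / g (norm z) / 4"
          using g_ge_1[of "norm z"] Q by (simp add: frac_le)
        have "(1 / (4 * Q))\<^sup>2 = 1 / (4 * Q)\<^sup>2" by (simp add: power_divide)
        with 1 2 \<rho>(2) show "(1 / (4 * Q))\<^sup>2 \<le> \<rho>\<^sup>2" by (auto simp: min_def split: if_splits)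
      qed (use \<rho> in simp)
    qed
    have t2: "0 < t / 2" using t by simp
    from low[OF t2, of x 0] obtain \<rho>1 where \<rho>1: "0 < \<rho>1" "min (t / 2) (1 / g (norm x)) / 4 \<le> \<rho>1\<^sup>2"
      "\<And>r. 0 < r \<Longrightarrow> r \<le> \<rho>1 \<Longrightarrow> lower (ball x r) (t / 2) (ball 0 r) (c * (t / 2) powr (- e) * exp (- K * E g (t / 2) x 0))"
      by (auto simp: e_def)
    from low[OF t2, of 0 y] obtain \<rho>2 where \<rho>2: "0 < \<rho>2" "min (t / 2) (1 / g (norm y)) / 4 \<le> \<rho>2\<^sup>2"
      "\<And>r. 0 < r \<Longrightarrow> r \<le> \<rho>2 \<Longrightarrow> lower (ball 0 r) (t / 2) (ball y r) (c * (t / 2) powr (- e) * exp (- K * E g (t / 2) 0 y))"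
      by (auto simp: e_def)
    \<comment> \<open>This radius is admissible for both halves and only polynomially small in
      \<open>Q\<close>, so its volume is at least \<open>exp (- 4 * d * Q)\<close> up to a
      constant.\<close>
    define r where "r = 1 / (4 * Q)"
    have r: "0 < r" "r \<le> \<rho>1" "r \<le> \<rho>2"
      using Q Eb(3)[OF Q(2) \<rho>1(1,2)] Eb(3)[OF Q(3) \<rho>2(1,2)] by (auto simp: r_def)
    define w where "w = c * exp (- (e * Q)) * exp (- (K * (K1 * Q)))"
    have half: "w \<le> c * (t / 2) powr (- e) * exp (- K * E')"
      if "E' \<le> K1 * Q" for E'
    proof -
      have "K * E' \<le> K * (K1 * Q)" using that cK by (intro mult_left_mono) auto
      then show ?thesis unfolding w_def using T cK by (intro mult_mono) auto
    qed
    have w: "0 \<le> w" using cK by (simp add: w_def)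
    have "lower (ball x r) (t / 2 + t / 2) (ball y r)
      (w * w * (v * r ^ DIM('a)))"
    proof (rule lower_comp)
      show "lower (ball x r) (t / 2) (ball 0 r) w"
        by (rule lower_mono[OF \<rho>1(3)[OF r(1,2)] order_refl half[OF Eb(1)[OF Q(2) \<rho>1(1,2)]]])
      show "lower (ball 0 r) (t / 2) (ball y r) w"
        by (rule lower_mono[OF \<rho>2(3)[OF r(1,3)] order_refl half[OF Eb(2)[OF Q(3) \<rho>2(1,2)]]])
      show "ennreal (v * r ^ DIM('a)) \<le> emeasure lborel (ball (0::'a) r)"
        using r by (simp add: emeasure_ball v_def)
    qed (use w v r in auto)
    then have "lower (ball x r) t (ball y r)
      (w * w * (v * r ^ DIM('a)))"
      by simp
    then have pl: "w * w * (v * r ^ DIM('a)) \<le> p t x y"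
      using t r by (intro lower_kernel[of "ball x r" t "ball y r" _ x r]) auto
    have "exp (- (4 * real DIM('a) * Q)) \<le> r ^ DIM('a)"
    proof -
      have "4 * Q \<le> exp (4 * Q)" using exp_ge_add_one_self[of "4 * Q"] by linarith
      then have "exp (- (4 * Q)) \<le> r" using Q by (simp add: r_def exp_minus field_simps)
      then have "exp (- (4 * Q)) ^ DIM('a) \<le> r ^ DIM('a)" by (intro power_mono) auto
      then show ?thesis by (simp add: exp_of_nat_mult[symmetric] mult_ac)
    qed
    then have "w * w * (v * exp (- (4 * real DIM('a) * Q))) \<le> p t x y"
      using w v by (intro order_trans[OF _ pl] mult_left_mono) auto
    moreover have "w * w * (v * exp (- (4 * real DIM('a) * Q))) = c * c * v * exp (- Q * c6)"
    proof -
      have "exp (- Q * c6) = exp (- (e * Q)) * exp (- (K * (K1 * Q))) * (exp (- (e * Q)) * exp (- (K * (K1 * Q)))) * exp (- (4 * real DIM('a) * Q))"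
        unfolding mult_exp_exp by (simp add: c6_def algebra_simps)
      then show ?thesis unfolding w_def by (simp only: mult_ac)
    qed
    moreover have "(exp (- t) * \<psi> g t x * \<psi> g t y) powr c6 = exp (- Q * c6)"
      unfolding \<psi>_product exp_powr_real by (simp add: Q_def S_def A_def)
    ultimately show "c * c * v * (exp (- t) * \<psi> g t x * \<psi> g t y) powr c6 \<le> p t x y"
      by simp
  qed
qed

end

theorem theorem1p1:
  fixes M :: "'w measure"
    and B :: "real \<Rightarrow> 'w \<Rightarrow> 'a::euclidean_space"
    and V :: "'a \<Rightarrow> real"
    and g :: "real \<Rightarrow> real"
    and p :: "real \<Rightarrow> 'a \<Rightarrow> 'a \<Rightarrow> real"
    and C1 C2 :: real
  assumes "standard_brownian_motion M B"
    and "V \<in> borel_measurable borel" and "\<And>x. 0 \<le> V x" and "locally_bounded V"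
    and "C1 > 0" and "C2 > 0" and "g \<in> growth_class"
    and "\<And>x. norm x > 1 \<Longrightarrow> C1 * g (norm x) \<le> V x \<and> V x \<le> C2 * g (norm x)"
    and "heat_kernel M B V p"
  shows "\<forall>C0>0. \<exists>c1>0. \<exists>c2>0. \<exists>c3>0. \<exists>c4>0. \<exists>c5>0. \<exists>c6>0. \<exists>c7>0. \<exists>c8>0.
    (\<forall>x y t. 0 < t \<and> t \<le> C0 * t0 g (min (norm x) (norm y)) \<longrightarrow>
       c1 * t powr (- real DIM('a) / 2) * exp (- c2 * E g t x y) \<le> p t x y \<and>
       p t x y \<le> c3 * t powr (- real DIM('a) / 2) * exp (- c4 * E g t x y)) \<and>
    (\<forall>x y t. t \<ge> C0 * t0 g (min (norm x) (norm y)) \<longrightarrow>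
       c5 * (exp (- t) * \<psi> g t x * \<psi> g t y) powr c6 \<le> p t x y \<and>
       p t x y \<le> c7 * (exp (- t) * \<psi> g t x * \<psi> g t y) powr c8)"
proof (intro allI impI, goal_cases)
  case (1 C0)
  then have C0: "0 < C0" .
  from assms(7) obtain c0 where g: "mono_on {0..} g" "\<And>r. 0 \<le> r \<Longrightarrow> 1 \<le> g r" "\<And>r. 0 \<le> r \<Longrightarrow> g (2 * r) \<le> c0 * g r"
    unfolding growth_class_def by blast
  interpret standard_brownian_motion M B by (fact assms(1))
  interpret schroedinger_growth M B V p g C1 C2 c0
    by unfold_locales (use assms g in \<open>auto simp: mono_on_def\<close>)
  from kernel_lower_short_time obtain c1 c2 where 1: "0 < c1" "0 < c2"
    "\<And>x y t. 0 < t \<Longrightarrow> c1 * t powr (- real DIM('a) / 2) * exp (- c2 * E g t x y) \<le> p t x y" by blast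
  from kernel_upper_short_time[OF C0] obtain c3 c4 where 2: "0 < c3" "0 < c4"
    "\<And>x y t. 0 < t \<Longrightarrow> t \<le> C0 * t0 g (min (norm x) (norm y)) \<Longrightarrow>
      p t x y \<le> c3 * t powr (- real DIM('a) / 2) * exp (- c4 * E g t x y)" by blast
  from kernel_lower_long_time obtain c5 c6 where 3: "0 < c5" "0 < c6"
    "\<And>x y t. 0 < t \<Longrightarrow> c5 * (exp (- t) * \<psi> g t x * \<psi> g t y) powr c6 \<le> p t x y" by blast
  from kernel_upper_long_time[OF C0] obtain c7 c8 where 4: "0 < c7" "0 < c8"
    "\<And>x y t. C0 * t0 g (min (norm x) (norm y)) \<le> t \<Longrightarrow>
      p t x y \<le> c7 * (exp (- t) * \<psi> g t x * \<psi> g t y) powr c8" by blast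
  \<comment> \<open>In (ii) positivity of \<open>t\<close> is a consequence of
    \<open>t0 > 0\<close>.\<close>
  have t0_pos: "0 < t" if "C0 * t0 g (min (norm x) (norm y)) \<le> t" for x y :: 'a and t
  proof -
    have "1 \<le> g (min (norm x) (norm y))" by (intro g_ge_1) auto
    then have "0 < C0 * t0 g (min (norm x) (norm y))"
      using C0 by (auto simp: t0_def intro!: mult_pos_pos divide_pos_pos add_pos_nonneg)
    with that show ?thesis by linarith
  qed
  show ?case
    by (rule exI[of _ c1], rule conjI[OF 1(1)], rule exI[of _ c2], rule conjI[OF 1(2)],
        rule exI[of _ c3], rule conjI[OF 2(1)], rule exI[of _ c4], rule conjI[OF 2(2)],
        rule exI[of _ c5], rule conjI[OF 3(1)], rule exI[of _ c6], rule conjI[OF 3(2)],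
        rule exI[of _ c7], rule conjI[OF 4(1)], rule exI[of _ c8], rule conjI[OF 4(2)])
      (use 1(3) 2(3) 3(3) 4(3) t0_pos in blast)
qed

end
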